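(* Let $Ax$ be a subset of the time axioms $\{$(rs), (ls), (up dir), (down dir), (circ), (dens), (ref), (lin), (tri), (tr)$\}$ and let $\widehat{Ax}$ be the set of corresponding time conditions among (RS), (LS), (Up Dir), (Down Dir), (Circ), (Dens), (Ref), (Lin), (Tri), (Tr). Then the full subcategory $\mathbf{DCA}(Ax)$ of dynamic contact algebras satisfying $Ax$ (with DCA-morphisms) is dually equivalent to the full subcategory $\mathbf{DMS}(\widehat{Ax})^*$ of $T_0$ and DM-compact dynamic mereotopological spaces whose time structure $(T,\prec)$ satisfies $\widehat{Ax}$ (with DMS-morphisms).
   Context: DCA: $(B,C^s,C^t,\mathcal{B})$, Boolean algebra $0\neq1$, contact relations $C^s,C^t$, precontact $\mathcal{B}$ (precontact: $aCb\Rightarrow a,b\neq0$, upward monotone, additive in each argument; contact: also symmetric and $a\cdot b\neq0\Rightarrow aCb$), with $aC^sb\Rightarrow aC^tb$, $a\overline{C^t}b\Rightarrow\exists c(a\overline{C^t}c\wedge c^*\overline{C^t}b)$, $a\overline{\mathcal{B}}b\Rightarrow\exists c(a\overline{C^t}c\wedge c^*\overline{\mathcal{B}}b)$, $a\overline{\mathcal{B}}b\Rightarrow\exists c(a\overline{\mathcal{B}}c\wedge c^*\overline{C^t}b)$. DCA-morphism: Boolean homomorphism $f$ with $f(a)Rf(b)\Rightarrow aRb$ for $R=C^s,C^t,\mathcal{B}$. DMS $S=(X^t,X^s,T,\prec,M)$: $X^t$ a nonempty space; $M$ a Boolean subalgebra of regular closed sets forming a closed base; $X^s,T\subseteq X^t$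 nonempty; each nonempty regular closed set meets $X^s$; $\prec$ on $X^t$; $aC^tb$ iff $a\cap b\neq\emptyset$, $aC^sb$ iff $a\cap b\cap X^s\neq\emptyset$, $a\mathcal{B}b$ iff $\exists x\in a,y\in b\,x\prec y$; $S^+=(M,C^s,C^t,\mathcal{B})$ must be a DCA; $x\prec y$ iff $\forall a,b\in M(x\in a,y\in b\Rightarrow a\mathcal{B}b)$; $\rho_S(x)=\{a\in M:x\in a\}$ is a cluster for $x\in T$. t-clans/s-clans: $\Gamma$ with $1\in\Gamma,0\notin\Gamma$, upward closed, prime, pairwise $C^t$-/$C^s$-related; clusters: t-clans with $\forall a\notin\Gamma\exists b\in\Gamma\,a\overline{C^t}b$. $T_0$: $X^t$ is $T_0$; DM-compact: every t-clan, s-clan, cluster of $S^+$ is $\rho_S(x)$ for some $x$ in $X^t$, $X^s$, $T$ resp. DMS-morphism $\theta:X^t_1\to X^t_2$: $\theta(X^s_1)\subseteq X^s_2$, preserves $\prec$, $\theta^{-1}$ maps $M_2$ into $M_1$ as a Boolean homomorphism. Time axioms: (rs) $a\neq0\Rightarrow a\mathcal{B}1$; (ls) $a\neq0\Rightarrow1\mathcal{B}a$; (up dir) $a,b\neq0\Rightarrow a\mathcal{B}p\vee b\mathcal{B}p^*$; (down dir) $a,b\neq0\Rightarrow p\mathcal{B}a\vee p^*\mathcal{B}b$; (circ) $a\mathcal{B}b\Rightarrow b\mathcal{B}p\vee p^*\mathcal{B}a$; (dens) $a\mathcal{B}b\Rightarrow a\mathcal{B}p\vee p^*\mathcal{B}b$;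 (ref) $aC^tb\Rightarrow a\mathcal{B}b$; (lin) $a,b\neq0\Rightarrow a\mathcal{B}b\vee b\mathcal{B}a$; (tri) $a,b\neq0\Rightarrow aC^tb\vee a\mathcal{B}b\vee b\mathcal{B}a$; (tr) $a\overline{\mathcal{B}}b\Rightarrow\exists c(a\overline{\mathcal{B}}c\wedge c^*\overline{\mathcal{B}}b)$. Time conditions: (RS) $\forall m\exists n\,m\prec n$; (LS) $\forall m\exists n\,n\prec m$; (Up Dir) $\forall i,j\exists k(i\prec k\wedge j\prec k)$; (Down Dir) $\forall i,j\exists k(k\prec i\wedge k\prec j)$; (Circ) $i\prec j\Rightarrow\exists k(j\prec k\wedge k\prec i)$; (Dens) $i\prec j\Rightarrow\exists k(i\prec k\prec j)$; (Ref) $\forall m\,m\prec m$; (Lin) $\forall m,n(m\prec n\vee n\prec m)$; (Tri) $\forall m,n(m=n\vee m\prec n\vee n\prec m)$; (Tr) transitivity. *)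

theory Defs
  imports "HOL-Analysis.Analysis" "HOL-Library.Equipollence"
begin

section \<open>Categories and dual equivalence\<close>

text \<open>Hom-sets need not be disjoint (morphisms will be functions without a recorded codomain), so
  composition and functors on morphisms take the relevant objects as arguments:
  \<open>Comp C x y z g f\<close> is \<open>g \<circ> f\<close> for \<open>f : x \<rightarrow> y\<close> and \<open>g : y \<rightarrow> z\<close>.\<close>

record ('o, 'm) cat =
  Ob :: "'o set"
  Hom :: "'o \<Rightarrow> 'o \<Rightarrow> 'm set"
  Comp :: "'o \<Rightarrow> 'o \<Rightarrow> 'o \<Rightarrow> 'm \<Rightarrow> 'm \<Rightarrow> 'm"
  Ident :: "'o \<Rightarrow> 'm"

locale category =
  fixes C :: "('o, 'm) cat"
  assumes Ident_in_Hom: "x \<in> Ob C \<Longrightarrow> Ident C x \<in> Hom C x x"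
    and Comp_in_Hom: "\<lbrakk>x \<in> Ob C; y \<in> Ob C; z \<in> Ob C; f \<in> Hom C x y; g \<in> Hom C y z\<rbrakk>
      \<Longrightarrow> Comp C x y z g f \<in> Hom C x z"
    and Comp_Ident_right: "\<lbrakk>x \<in> Ob C; y \<in> Ob C; f \<in> Hom C x y\<rbrakk>
      \<Longrightarrow> Comp C x x y f (Ident C x) = f"
    and Comp_Ident_left: "\<lbrakk>x \<in> Ob C; y \<in> Ob C; f \<in> Hom C x y\<rbrakk>
      \<Longrightarrow> Comp C x y y (Ident C y) f = f"
    and Comp_assoc: "\<lbrakk>w \<in> Ob C; x \<in> Ob C; y \<in> Ob C; z \<in> Ob C;
        f \<in> Hom C w x; g \<in> Hom C x y; h \<in> Hom C y z\<rbrakk>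
      \<Longrightarrow> Comp C w y z h (Comp C w x y g f) = Comp C w x z (Comp C x y z h g) f"

definition opposite :: "('o, 'm) cat \<Rightarrow> ('o, 'm) cat" where
  "opposite C = \<lparr>Ob = Ob C, Hom = (\<lambda>x y. Hom C y x),
     Comp = (\<lambda>x y z g f. Comp C z y x f g), Ident = Ident C\<rparr>"

definition full_subcategory :: "('o, 'm) cat \<Rightarrow> ('o \<Rightarrow> bool) \<Rightarrow> ('o, 'm) cat" where
  "full_subcategory C P = C\<lparr>Ob := {x \<in> Ob C. P x}\<rparr>"

record ('o, 'm, 'p, 'n) func =
  fobj :: "'o \<Rightarrow> 'p"
  fmor :: "'o \<Rightarrow> 'o \<Rightarrow> 'm \<Rightarrow> 'n"

locale is_functor =
  fixes C :: "('o, 'm) cat" and D :: "('p, 'n) cat" and F :: "('o, 'm, 'p, 'n) func"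
  assumes fobj_in_Ob: "x \<in> Ob C \<Longrightarrow> fobj F x \<in> Ob D"
    and fmor_in_Hom: "\<lbrakk>x \<in> Ob C; y \<in> Ob C; f \<in> Hom C x y\<rbrakk>
      \<Longrightarrow> fmor F x y f \<in> Hom D (fobj F x) (fobj F y)"
    and fmor_Ident: "x \<in> Ob C \<Longrightarrow> fmor F x x (Ident C x) = Ident D (fobj F x)"
    and fmor_Comp: "\<lbrakk>x \<in> Ob C; y \<in> Ob C; z \<in> Ob C; f \<in> Hom C x y; g \<in> Hom C y z\<rbrakk>
      \<Longrightarrow> fmor F x z (Comp C x y z g f) =
          Comp D (fobj F x) (fobj F y) (fobj F z) (fmor F y z g) (fmor F x y f)"

definition id_func :: "('o, 'm, 'o, 'm) func" where
  "id_func = \<lparr>fobj = (\<lambda>x. x), fmor = (\<lambda>x y f. f)\<rparr>"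

definition comp_func ::
    "('p, 'n, 'q, 'k) func \<Rightarrow> ('o, 'm, 'p, 'n) func \<Rightarrow> ('o, 'm, 'q, 'k) func" where
  "comp_func G F = \<lparr>fobj = (\<lambda>x. fobj G (fobj F x)),
     fmor = (\<lambda>x y f. fmor G (fobj F x) (fobj F y) (fmor F x y f))\<rparr>"

definition isomorphism :: "('o, 'm) cat \<Rightarrow> 'o \<Rightarrow> 'o \<Rightarrow> 'm \<Rightarrow> bool" where
  "isomorphism C x y f \<longleftrightarrow> f \<in> Hom C x y \<and>
     (\<exists>g \<in> Hom C y x. Comp C x y x g f = Ident C x \<and> Comp C y x y f g = Ident C y)"

definition natural_isomorphism ::
    "('o, 'm) cat \<Rightarrow> ('p, 'n) cat \<Rightarrow> ('o, 'm, 'p, 'n) func \<Rightarrow> ('o, 'm, 'p, 'n) func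
      \<Rightarrow> ('o \<Rightarrow> 'n) \<Rightarrow> bool" where
  "natural_isomorphism C D F G \<eta> \<longleftrightarrow>
     (\<forall>x \<in> Ob C. isomorphism D (fobj F x) (fobj G x) (\<eta> x)) \<and>
     (\<forall>x \<in> Ob C. \<forall>y \<in> Ob C. \<forall>f \<in> Hom C x y.
        Comp D (fobj F x) (fobj F y) (fobj G y) (\<eta> y) (fmor F x y f) =
        Comp D (fobj F x) (fobj G x) (fobj G y) (fmor G x y f) (\<eta> x))"

definition equivalent_categories :: "('o, 'm) cat \<Rightarrow> ('p, 'n) cat \<Rightarrow> bool" where
  "equivalent_categories C D \<longleftrightarrow> category C \<and> category D \<and>
     (\<exists>F G \<eta> \<epsilon>. is_functor C D F \<and> is_functor D C G \<and>
        natural_isomorphism C C id_func (comp_func G F) \<eta> \<and>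
        natural_isomorphism D D (comp_func F G) id_func \<epsilon>)"

definition dually_equivalent :: "('o, 'm) cat \<Rightarrow> ('p, 'n) cat \<Rightarrow> bool" where
  "dually_equivalent C D \<longleftrightarrow> equivalent_categories (opposite C) D"


section \<open>Dynamic contact algebras\<close>

record 'a boolean_alg =
  carrier :: "'a set"
  join :: "'a \<Rightarrow> 'a \<Rightarrow> 'a"
  meet :: "'a \<Rightarrow> 'a \<Rightarrow> 'a"
  neg :: "'a \<Rightarrow> 'a"
  bzero :: "'a"
  bone :: "'a"

locale boolean_alg =
  fixes A :: "('a, 'z) boolean_alg_scheme"
  assumes join_closed: "\<lbrakk>a \<in> carrier A; b \<in> carrier A\<rbrakk> \<Longrightarrow> join A a b \<in> carrier A"
    and meet_closed: "\<lbrakk>a \<in> carrier A; b \<in> carrier A\<rbrakk> \<Longrightarrow> meet A a b \<in> carrier A"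
    and neg_closed: "a \<in> carrier A \<Longrightarrow> neg A a \<in> carrier A"
    and bzero_closed: "bzero A \<in> carrier A"
    and bone_closed: "bone A \<in> carrier A"
    and join_assoc: "\<lbrakk>a \<in> carrier A; b \<in> carrier A; c \<in> carrier A\<rbrakk>
      \<Longrightarrow> join A (join A a b) c = join A a (join A b c)"
    and meet_assoc: "\<lbrakk>a \<in> carrier A; b \<in> carrier A; c \<in> carrier A\<rbrakk>
      \<Longrightarrow> meet A (meet A a b) c = meet A a (meet A b c)"
    and join_comm: "\<lbrakk>a \<in> carrier A; b \<in> carrier A\<rbrakk> \<Longrightarrow> join A a b = join A b a"
    and meet_comm: "\<lbrakk>a \<in> carrier A; b \<in> carrier A\<rbrakk> \<Longrightarrow> meet A a b = meet A b a"
    and meet_join_distrib: "\<lbrakk>a \<in> carrier A; b \<in> carrier A; c \<in> carrier A\<rbrakk>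
      \<Longrightarrow> meet A a (join A b c) = join A (meet A a b) (meet A a c)"
    and join_meet_distrib: "\<lbrakk>a \<in> carrier A; b \<in> carrier A; c \<in> carrier A\<rbrakk>
      \<Longrightarrow> join A a (meet A b c) = meet A (join A a b) (join A a c)"
    and join_bzero: "a \<in> carrier A \<Longrightarrow> join A a (bzero A) = a"
    and meet_bone: "a \<in> carrier A \<Longrightarrow> meet A a (bone A) = a"
    and join_neg: "a \<in> carrier A \<Longrightarrow> join A a (neg A a) = bone A"
    and meet_neg: "a \<in> carrier A \<Longrightarrow> meet A a (neg A a) = bzero A"
    and bzero_neq_bone: "bzero A \<noteq> bone A"

definition le :: "('a, 'z) boolean_alg_scheme \<Rightarrow> 'a \<Rightarrow> 'a \<Rightarrow> bool" where
  "le A a b \<longleftrightarrow> join A a b = b"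

definition precontact :: "('a, 'z) boolean_alg_scheme \<Rightarrow> ('a \<Rightarrow> 'a \<Rightarrow> bool) \<Rightarrow> bool" where
  "precontact A R \<longleftrightarrow>
     (\<forall>a \<in> carrier A. \<forall>b \<in> carrier A. R a b \<longrightarrow> a \<noteq> bzero A \<and> b \<noteq> bzero A) \<and>
     (\<forall>a \<in> carrier A. \<forall>b \<in> carrier A. \<forall>a' \<in> carrier A. \<forall>b' \<in> carrier A.
        R a b \<and> le A a a' \<and> le A b b' \<longrightarrow> R a' b') \<and>
     (\<forall>a \<in> carrier A. \<forall>b \<in> carrier A. \<forall>c \<in> carrier A.
        R a (join A b c) \<longrightarrow> R a b \<or> R a c) \<and>
     (\<forall>a \<in> carrier A. \<forall>b \<in> carrier A. \<forall>c \<in> carrier A.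
        R (join A a b) c \<longrightarrow> R a c \<or> R b c)"

definition contact :: "('a, 'z) boolean_alg_scheme \<Rightarrow> ('a \<Rightarrow> 'a \<Rightarrow> bool) \<Rightarrow> bool" where
  "contact A R \<longleftrightarrow> precontact A R \<and>
     (\<forall>a \<in> carrier A. \<forall>b \<in> carrier A. R a b \<longrightarrow> R b a) \<and>
     (\<forall>a \<in> carrier A. \<forall>b \<in> carrier A. meet A a b \<noteq> bzero A \<longrightarrow> R a b)"

text \<open>\<open>Cs\<close>, \<open>Ct\<close>, \<open>Pre\<close> are space contact, time contact and the precedence relation.
  Their values outside the carrier are irrelevant.\<close>

record 'a dca = "'a boolean_alg" +
  Cs :: "'a \<Rightarrow> 'a \<Rightarrow> bool"
  Ct :: "'a \<Rightarrow> 'a \<Rightarrow> bool"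
  Pre :: "'a \<Rightarrow> 'a \<Rightarrow> bool"

locale dca = boolean_alg A for A :: "'a dca" +
  assumes contact_Cs: "contact A (Cs A)"
    and contact_Ct: "contact A (Ct A)"
    and precontact_Pre: "precontact A (Pre A)"
    and Cs_imp_Ct: "\<lbrakk>a \<in> carrier A; b \<in> carrier A; Cs A a b\<rbrakk> \<Longrightarrow> Ct A a b"
    and Ct_normal: "\<lbrakk>a \<in> carrier A; b \<in> carrier A; \<not> Ct A a b\<rbrakk>
      \<Longrightarrow> \<exists>c \<in> carrier A. \<not> Ct A a c \<and> \<not> Ct A (neg A c) b"
    and Ct_Pre: "\<lbrakk>a \<in> carrier A; b \<in> carrier A; \<not> Pre A a b\<rbrakk>
      \<Longrightarrow> \<exists>c \<in> carrier A. \<not> Ct A a c \<and> \<not> Pre A (neg A c) b"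
    and Pre_Ct: "\<lbrakk>a \<in> carrier A; b \<in> carrier A; \<not> Pre A a b\<rbrakk>
      \<Longrightarrow> \<exists>c \<in> carrier A. \<not> Pre A a c \<and> \<not> Ct A (neg A c) b"

definition boolean_hom ::
    "('a, 'y) boolean_alg_scheme \<Rightarrow> ('b, 'z) boolean_alg_scheme \<Rightarrow> ('a \<Rightarrow> 'b) \<Rightarrow> bool" where
  "boolean_hom A B f \<longleftrightarrow> f \<in> carrier A \<rightarrow> carrier B \<and>
     (\<forall>a \<in> carrier A. \<forall>b \<in> carrier A. f (join A a b) = join B (f a) (f b)) \<and>
     (\<forall>a \<in> carrier A. \<forall>b \<in> carrier A. f (meet A a b) = meet B (f a) (f b)) \<and>
     (\<forall>a \<in> carrier A. f (neg A a) = neg B (f a)) \<and>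
     f (bzero A) = bzero B \<and> f (bone A) = bone B"

definition dca_morphism :: "'a dca \<Rightarrow> 'b dca \<Rightarrow> ('a \<Rightarrow> 'b) \<Rightarrow> bool" where
  "dca_morphism A B f \<longleftrightarrow> boolean_hom A B f \<and>
     (\<forall>a \<in> carrier A. \<forall>b \<in> carrier A. Cs B (f a) (f b) \<longrightarrow> Cs A a b) \<and>
     (\<forall>a \<in> carrier A. \<forall>b \<in> carrier A. Ct B (f a) (f b) \<longrightarrow> Ct A a b) \<and>
     (\<forall>a \<in> carrier A. \<forall>b \<in> carrier A. Pre B (f a) (f b) \<longrightarrow> Pre A a b)"

definition clan ::
    "('a, 'z) boolean_alg_scheme \<Rightarrow> ('a \<Rightarrow> 'a \<Rightarrow> bool) \<Rightarrow> 'a set \<Rightarrow> bool" where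
  "clan A R \<Gamma> \<longleftrightarrow> \<Gamma> \<subseteq> carrier A \<and> bone A \<in> \<Gamma> \<and> bzero A \<notin> \<Gamma> \<and>
     (\<forall>a \<in> \<Gamma>. \<forall>b \<in> carrier A. le A a b \<longrightarrow> b \<in> \<Gamma>) \<and>
     (\<forall>a \<in> carrier A. \<forall>b \<in> carrier A. join A a b \<in> \<Gamma> \<longrightarrow> a \<in> \<Gamma> \<or> b \<in> \<Gamma>) \<and>
     (\<forall>a \<in> \<Gamma>. \<forall>b \<in> \<Gamma>. R a b)"

definition t_clan :: "'a dca \<Rightarrow> 'a set \<Rightarrow> bool" where
  "t_clan A \<Gamma> \<longleftrightarrow> clan A (Ct A) \<Gamma>"

definition s_clan :: "'a dca \<Rightarrow> 'a set \<Rightarrow> bool" where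
  "s_clan A \<Gamma> \<longleftrightarrow> clan A (Cs A) \<Gamma>"

definition cluster :: "'a dca \<Rightarrow> 'a set \<Rightarrow> bool" where
  "cluster A \<Gamma> \<longleftrightarrow> t_clan A \<Gamma> \<and> (\<forall>a \<in> carrier A - \<Gamma>. \<exists>b \<in> \<Gamma>. \<not> Ct A a b)"


section \<open>Dynamic mereotopological spaces\<close>

definition regular_closedin :: "'b topology \<Rightarrow> 'b set \<Rightarrow> bool" where
  "regular_closedin X a \<longleftrightarrow> X closure_of (X interior_of a) = a"

definition rc_meet :: "'b topology \<Rightarrow> 'b set \<Rightarrow> 'b set \<Rightarrow> 'b set" where
  "rc_meet X a b = X closure_of (X interior_of (a \<inter> b))"

definition rc_neg :: "'b topology \<Rightarrow> 'b set \<Rightarrow> 'b set" where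
  "rc_neg X a = X closure_of (topspace X - a)"

definition rc_subalgebra :: "'b topology \<Rightarrow> 'b set set \<Rightarrow> bool" where
  "rc_subalgebra X M \<longleftrightarrow> (\<forall>a \<in> M. regular_closedin X a) \<and> {} \<in> M \<and> topspace X \<in> M \<and>
     (\<forall>a \<in> M. \<forall>b \<in> M. a \<union> b \<in> M) \<and> (\<forall>a \<in> M. \<forall>b \<in> M. rc_meet X a b \<in> M) \<and>
     (\<forall>a \<in> M. rc_neg X a \<in> M)"

definition closed_base :: "'b topology \<Rightarrow> 'b set set \<Rightarrow> bool" where
  "closed_base X M \<longleftrightarrow> (\<forall>a \<in> M. closedin X a) \<and>
     (\<forall>F. closedin X F \<longrightarrow> (\<exists>N \<subseteq> M. F = topspace X \<inter> \<Inter>N))"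

text \<open>The space \<open>X\<^sup>t\<close> is the topology \<open>Xt\<close>; the sets \<open>X\<^sup>s\<close> and \<open>T\<close> are \<open>Xs\<close> and \<open>Tm\<close>.\<close>

record 'b dms =
  Xt :: "'b topology"
  Xs :: "'b set"
  Tm :: "'b set"
  prec :: "'b \<Rightarrow> 'b \<Rightarrow> bool"
  alg :: "'b set set"

definition dual_algebra :: "'b dms \<Rightarrow> 'b set dca" where
  "dual_algebra S =
     \<lparr>carrier = alg S, join = (\<union>), meet = rc_meet (Xt S), neg = rc_neg (Xt S),
      bzero = {}, bone = topspace (Xt S),
      Cs = (\<lambda>a b. a \<inter> b \<inter> Xs S \<noteq> {}), Ct = (\<lambda>a b. a \<inter> b \<noteq> {}),
      Pre = (\<lambda>a b. \<exists>x \<in> a. \<exists>y \<in> b. prec S x y)\<rparr>"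

definition rho :: "'b dms \<Rightarrow> 'b \<Rightarrow> 'b set set" where
  "rho S x = {a \<in> alg S. x \<in> a}"

locale dms =
  fixes S :: "'b dms"
  assumes Xt_nonempty: "topspace (Xt S) \<noteq> {}"
    and alg_subalgebra: "rc_subalgebra (Xt S) (alg S)"
    and alg_closed_base: "closed_base (Xt S) (alg S)"
    and Xs_subset: "Xs S \<subseteq> topspace (Xt S)"
    and Xs_nonempty: "Xs S \<noteq> {}"
    and Tm_subset: "Tm S \<subseteq> topspace (Xt S)"
    and Tm_nonempty: "Tm S \<noteq> {}"
    and regular_closed_meets_Xs: "\<lbrakk>regular_closedin (Xt S) a; a \<noteq> {}\<rbrakk> \<Longrightarrow> a \<inter> Xs S \<noteq> {}"
    and dca_dual_algebra: "dca (dual_algebra S)"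
    and prec_iff: "\<lbrakk>x \<in> topspace (Xt S); y \<in> topspace (Xt S)\<rbrakk> \<Longrightarrow>
      prec S x y \<longleftrightarrow>
        (\<forall>a \<in> alg S. \<forall>b \<in> alg S. x \<in> a \<and> y \<in> b \<longrightarrow> Pre (dual_algebra S) a b)"
    and cluster_rho: "x \<in> Tm S \<Longrightarrow> cluster (dual_algebra S) (rho S x)"

definition dm_compact :: "'b dms \<Rightarrow> bool" where
  "dm_compact S \<longleftrightarrow>
     (\<forall>\<Gamma>. t_clan (dual_algebra S) \<Gamma> \<longrightarrow> (\<exists>x \<in> topspace (Xt S). \<Gamma> = rho S x)) \<and>
     (\<forall>\<Gamma>. s_clan (dual_algebra S) \<Gamma> \<longrightarrow> (\<exists>x \<in> Xs S. \<Gamma> = rho S x)) \<and>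
     (\<forall>\<Gamma>. cluster (dual_algebra S) \<Gamma> \<longrightarrow> (\<exists>x \<in> Tm S. \<Gamma> = rho S x))"

definition dms_morphism :: "'b dms \<Rightarrow> 'c dms \<Rightarrow> ('b \<Rightarrow> 'c) \<Rightarrow> bool" where
  "dms_morphism S S' \<theta> \<longleftrightarrow>
     \<theta> \<in> topspace (Xt S) \<rightarrow> topspace (Xt S') \<and> \<theta> ` Xs S \<subseteq> Xs S' \<and>
     (\<forall>x \<in> topspace (Xt S). \<forall>y \<in> topspace (Xt S). prec S x y \<longrightarrow> prec S' (\<theta> x) (\<theta> y)) \<and>
     boolean_hom (dual_algebra S') (dual_algebra S) (\<lambda>a. \<theta> -` a \<inter> topspace (Xt S))"


section \<open>Time axioms and time conditions\<close>

datatype time_axiom =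
  ax_rs | ax_ls | ax_up_dir | ax_down_dir | ax_circ | ax_dens | ax_ref | ax_lin | ax_tri | ax_tr

datatype time_condition = RS | LS | Up_Dir | Down_Dir | Circ | Dens | Ref | Lin | Tri | Tr

fun corresponding :: "time_axiom \<Rightarrow> time_condition" where
  "corresponding ax_rs = RS"
| "corresponding ax_ls = LS"
| "corresponding ax_up_dir = Up_Dir"
| "corresponding ax_down_dir = Down_Dir"
| "corresponding ax_circ = Circ"
| "corresponding ax_dens = Dens"
| "corresponding ax_ref = Ref"
| "corresponding ax_lin = Lin"
| "corresponding ax_tri = Tri"
| "corresponding ax_tr = Tr"

fun satisfies_axiom :: "'a dca \<Rightarrow> time_axiom \<Rightarrow> bool" where
  "satisfies_axiom A ax_rs \<longleftrightarrow> (\<forall>a \<in> carrier A. a \<noteq> bzero A \<longrightarrow> Pre A a (bone A))"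
| "satisfies_axiom A ax_ls \<longleftrightarrow> (\<forall>a \<in> carrier A. a \<noteq> bzero A \<longrightarrow> Pre A (bone A) a)"
| "satisfies_axiom A ax_up_dir \<longleftrightarrow>
     (\<forall>a \<in> carrier A. \<forall>b \<in> carrier A. \<forall>p \<in> carrier A.
        a \<noteq> bzero A \<and> b \<noteq> bzero A \<longrightarrow> Pre A a p \<or> Pre A b (neg A p))"
| "satisfies_axiom A ax_down_dir \<longleftrightarrow>
     (\<forall>a \<in> carrier A. \<forall>b \<in> carrier A. \<forall>p \<in> carrier A.
        a \<noteq> bzero A \<and> b \<noteq> bzero A \<longrightarrow> Pre A p a \<or> Pre A (neg A p) b)"
| "satisfies_axiom A ax_circ \<longleftrightarrow>
     (\<forall>a \<in> carrier A. \<forall>b \<in> carrier A. \<forall>p \<in> carrier A.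
        Pre A a b \<longrightarrow> Pre A b p \<or> Pre A (neg A p) a)"
| "satisfies_axiom A ax_dens \<longleftrightarrow>
     (\<forall>a \<in> carrier A. \<forall>b \<in> carrier A. \<forall>p \<in> carrier A.
        Pre A a b \<longrightarrow> Pre A a p \<or> Pre A (neg A p) b)"
| "satisfies_axiom A ax_ref \<longleftrightarrow>
     (\<forall>a \<in> carrier A. \<forall>b \<in> carrier A. Ct A a b \<longrightarrow> Pre A a b)"
| "satisfies_axiom A ax_lin \<longleftrightarrow>
     (\<forall>a \<in> carrier A. \<forall>b \<in> carrier A.
        a \<noteq> bzero A \<and> b \<noteq> bzero A \<longrightarrow> Pre A a b \<or> Pre A b a)"
| "satisfies_axiom A ax_tri \<longleftrightarrow>
     (\<forall>a \<in> carrier A. \<forall>b \<in> carrier A.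
        a \<noteq> bzero A \<and> b \<noteq> bzero A \<longrightarrow> Ct A a b \<or> Pre A a b \<or> Pre A b a)"
| "satisfies_axiom A ax_tr \<longleftrightarrow>
     (\<forall>a \<in> carrier A. \<forall>b \<in> carrier A.
        \<not> Pre A a b \<longrightarrow> (\<exists>c \<in> carrier A. \<not> Pre A a c \<and> \<not> Pre A (neg A c) b))"

fun satisfies_condition :: "'b set \<Rightarrow> ('b \<Rightarrow> 'b \<Rightarrow> bool) \<Rightarrow> time_condition \<Rightarrow> bool" where
  "satisfies_condition T r RS \<longleftrightarrow> (\<forall>m \<in> T. \<exists>n \<in> T. r m n)"
| "satisfies_condition T r LS \<longleftrightarrow> (\<forall>m \<in> T. \<exists>n \<in> T. r n m)"
| "satisfies_condition T r Up_Dir \<longleftrightarrow> (\<forall>i \<in> T. \<forall>j \<in> T. \<exists>k \<in> T. r i k \<and> r j k)"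
| "satisfies_condition T r Down_Dir \<longleftrightarrow> (\<forall>i \<in> T. \<forall>j \<in> T. \<exists>k \<in> T. r k i \<and> r k j)"
| "satisfies_condition T r Circ \<longleftrightarrow> (\<forall>i \<in> T. \<forall>j \<in> T. r i j \<longrightarrow> (\<exists>k \<in> T. r j k \<and> r k i))"
| "satisfies_condition T r Dens \<longleftrightarrow> (\<forall>i \<in> T. \<forall>j \<in> T. r i j \<longrightarrow> (\<exists>k \<in> T. r i k \<and> r k j))"
| "satisfies_condition T r Ref \<longleftrightarrow> (\<forall>m \<in> T. r m m)"
| "satisfies_condition T r Lin \<longleftrightarrow> (\<forall>m \<in> T. \<forall>n \<in> T. r m n \<or> r n m)"
| "satisfies_condition T r Tri \<longleftrightarrow> (\<forall>m \<in> T. \<forall>n \<in> T. m = n \<or> r m n \<or> r n m)"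
| "satisfies_condition T r Tr \<longleftrightarrow>
     (\<forall>i \<in> T. \<forall>j \<in> T. \<forall>k \<in> T. r i j \<and> r j k \<longrightarrow> r i k)"


section \<open>The two categories\<close>

text \<open>The categories of all algebras and of all spaces are too large for a type of HOL, so both are
  taken relative to a notion of smallness: a predicate \<open>small\<close> on subsets of a type \<open>'a\<close>.
  The algebras are those with a small carrier. Their dual spaces live on sets of clans, that
  is, on subsets of \<open>Pow (carrier A)\<close>; the points of the spaces are therefore taken from a second
  type \<open>'b\<close>, into which the powersets of small sets embed, and a space is small if its algebra
  \<open>alg S\<close> is in bijection with a small set.

  If \<open>small\<close> is a universe, in the sense that every set of subsets of a small set is in
  bijection with a small set, then a T0 space is small in this sense iff its set of points is in
  bijection with a small set (lemma \<open>smallsize_alg_iff\<close>). With \<open>small = (\<lambda>_. True)\<close> and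
  \<open>'b = 'a set\<close> the algebras are all the dynamic contact algebras over \<open>'a\<close>.\<close>

definition smallsize :: "('a set \<Rightarrow> bool) \<Rightarrow> 'c set \<Rightarrow> bool" where
  "smallsize small Y \<longleftrightarrow> (\<exists>X. small X \<and> X \<approx> Y)"

definition DCA :: "('a set \<Rightarrow> bool) \<Rightarrow> ('a dca, 'a \<Rightarrow> 'a) cat" where
  "DCA small =
     \<lparr>Ob = {A. dca A \<and> small (carrier A)},
      Hom = (\<lambda>A B. {f \<in> carrier A \<rightarrow>\<^sub>E carrier B. dca_morphism A B f}),
      Comp = (\<lambda>A B C g f. compose (carrier A) g f),
      Ident = (\<lambda>A. restrict id (carrier A))\<rparr>"

definition DMS :: "('a set \<Rightarrow> bool) \<Rightarrow> ('b dms, 'b \<Rightarrow> 'b) cat" where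
  "DMS small =
     \<lparr>Ob = {S. dms S \<and> smallsize small (alg S)},
      Hom = (\<lambda>S S'. {\<theta> \<in> topspace (Xt S) \<rightarrow>\<^sub>E topspace (Xt S'). dms_morphism S S' \<theta>}),
      Comp = (\<lambda>S S' S'' \<phi> \<theta>. compose (topspace (Xt S)) \<phi> \<theta>),
      Ident = (\<lambda>S. restrict id (topspace (Xt S)))\<rparr>"

definition DCA_Ax :: "('a set \<Rightarrow> bool) \<Rightarrow> time_axiom set \<Rightarrow> ('a dca, 'a \<Rightarrow> 'a) cat" where
  "DCA_Ax small Ax = full_subcategory (DCA small) (\<lambda>A. \<forall>ax \<in> Ax. satisfies_axiom A ax)"

definition DMS_star ::
    "('a set \<Rightarrow> bool) \<Rightarrow> time_condition set \<Rightarrow> ('b dms, 'b \<Rightarrow> 'b) cat" where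
  "DMS_star small Cond = full_subcategory (DMS small)
     (\<lambda>S. t0_space (Xt S) \<and> dm_compact S \<and>
          (\<forall>c \<in> Cond. satisfies_condition (Tm S) (prec S) c))"

lemma (in dms) inj_on_rho:
  assumes "t0_space (Xt S)"
  shows "inj_on (rho S) (topspace (Xt S))"
proof (rule inj_onI, rule ccontr)
  fix x y
  assume xy: "x \<in> topspace (Xt S)" "y \<in> topspace (Xt S)" "rho S x = rho S y" "x \<noteq> y"
  then obtain U where U: "openin (Xt S) U" "x \<notin> U \<longleftrightarrow> y \<in> U"
    using assms unfolding t0_space_def by blast
  then have "closedin (Xt S) (topspace (Xt S) - U)" by blast
  then obtain N where "N \<subseteq> alg S" "topspace (Xt S) - U = topspace (Xt S) \<inter> \<Inter>N"
    using alg_closed_base unfolding closed_base_def by blast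
  then show False
    using xy U unfolding rho_def by blast
qed

lemma (in dms) smallsize_alg_iff:
  fixes small :: "'a set \<Rightarrow> bool"
  assumes t0: "t0_space (Xt S)"
    and universe: "\<And>X Y. \<lbrakk>small X; Y \<subseteq> Pow X\<rbrakk> \<Longrightarrow> smallsize small Y"
  shows "smallsize small (alg S) \<longleftrightarrow> smallsize small (topspace (Xt S))"
proof -
  have Pow: "smallsize small Z" if Y: "smallsize small Y" and h: "inj_on h Z" "h ` Z \<subseteq> Pow Y"
    for Y :: "'c set" and Z :: "'d set" and h
  proof -
    obtain X where X: "small X" "Y \<approx> X"
      using Y eqpoll_sym unfolding smallsize_def by blast
    then obtain g where g: "bij_betw g Y X"
      unfolding eqpoll_def by blast
    have "inj_on (image g) (Pow Y)"
      using g by (simp add: bij_betw_def inj_on_image_Pow)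
    then have "inj_on (image g \<circ> h) Z"
      using comp_inj_on[OF h(1)] inj_on_subset[OF _ h(2)] by blast
    then have Z: "(image g \<circ> h) ` Z \<approx> Z"
      using inj_on_image_eqpoll_self by blast
    have "(image g \<circ> h) ` Z \<subseteq> Pow X"
      using h(2) g unfolding bij_betw_def by fastforce
    from universe[OF X(1) this] obtain V where "small V" "V \<approx> (image g \<circ> h) ` Z"
      unfolding smallsize_def by blast
    then show ?thesis
      using eqpoll_trans[OF _ Z] unfolding smallsize_def by blast
  qed
  have "alg S \<subseteq> Pow (topspace (Xt S))"
    using alg_closed_base closedin_subset unfolding closed_base_def by blast
  moreover have "rho S ` topspace (Xt S) \<subseteq> Pow (alg S)"
    unfolding rho_def by blast
  ultimately show ?thesis
    using Pow[of "topspace (Xt S)" id "alg S"] Pow[of "alg S" "rho S" "topspace (Xt S)"]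
      inj_on_rho[OF t0] by auto
qed

end

theory Submission
  imports Defs
begin

text \<open>A space is dual to an algebra \<open>A\<close> if its points correspond bijectively to the t-clans of \<open>A\<close>,
  with \<open>X\<^sup>s\<close> the s-clans, \<open>T\<close> the clusters, and \<open>x \<prec> y\<close> iff \<open>a \<B> b\<close> for all \<open>a \<in> x\<close>, \<open>b \<in> y\<close>.
  Every algebra has a dual space on its own t-clans, and a \<open>T\<^sub>0\<close>, DM-compact space is dual to
  \<open>S\<^sup>+\<close> via \<open>\<rho>\<close>. Given spaces dual to \<open>A\<close> and \<open>B\<close>, taking preimages matches the homomorphisms
  \<open>A \<rightarrow> B\<close> with the maps of spaces in the opposite direction. So any choice of dual spaces is a fully
  faithful, essentially surjective contravariant functor.

  For the time conditions, normality of \<open>C\<^sup>t\<close> puts each ultrafilter into a unique cluster, and the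
  mixed axioms between \<open>C\<^sup>t\<close> and \<open>\<B>\<close> let precedence of clusters be tested on ultrafilters inside
  them. For (RS), (LS), (Up Dir), (Down Dir), (Circ) and (Dens) one then needs an ultrafilter
  avoiding the sum of two ideals, and the corresponding axiom says precisely that this sum is
  proper; (tr) follows from transitivity by the same argument.\<close>


section \<open>Boolean algebras and ultrafilters\<close>

text \<open>Ultrafilters alone are too few points: two disjoint nonzero regions may be in contact,
  and then no ultrafilter contains both. The union of two ultrafilters linked by the contact
  relation does contain both, and it is a clan. So the points are clans, while existence is still
  proved by extending to ultrafilters.

  The predicate \<open>duality A S e\<close> replaces a pair of canonical constructions because of
  the types involved. Algebras live on \<open>'a\<close>, their clans are sets over
  \<open>'a\<close>, and the dual algebra of a space consists of sets over \<open>'b\<close>; two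
  passages to the dual do not lead back to the original type. Labelling points by clans through
  \<open>e\<close> allows points and regions to be renamed: clans are coded in \<open>'b\<close>,
  and regions are renamed into a small set.

  Dual maps determine each other, so functoriality, and the isomorphism of two spaces dual to one
  algebra, come from uniqueness instead of computation with chosen spaces.

  For (lin) and (tri) the obstacle is different: a disjunction that may vary with the pair of
  regions must become uniform over two ultrafilters. Monotonicity achieves this by passing to
  meets.\<close>

context boolean_alg
begin

text \<open>The element \<open>a + a \<cdot> neg a\<close> is \<open>a\<close> because the product
  is zero, and distributing turns it into \<open>(a + a) \<cdot> (a + neg a)\<close>, which is
  \<open>a + a\<close>.\<close>

lemma join_self:
  assumes a: "a \<in> carrier A"
  shows "join A a a = a"
proof -
  have "join A a (meet A a (neg A a)) = meet A (join A a a) (join A a (neg A a))"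
    using a by (intro join_meet_distrib) (auto intro: neg_closed)
  then show ?thesis
    using a by (simp add: meet_neg join_neg join_bzero meet_bone join_closed)
qed

lemma join_bone:
  assumes a: "a \<in> carrier A"
  shows "join A a (bone A) = bone A"
proof -
  have "join A (join A a a) (neg A a) = join A a (join A a (neg A a))"
    using a by (intro join_assoc) (auto intro: neg_closed)
  then show ?thesis
    using a by (simp add: join_self join_neg)
qed

lemma join_meet_absorb:
  assumes "a \<in> carrier A" "b \<in> carrier A"
  shows "join A a (meet A a b) = a"
proof -
  have "meet A a (join A (bone A) b) = join A (meet A a (bone A)) (meet A a b)"
    using assms bone_closed by (intro meet_join_distrib)
  moreover have "join A (bone A) b = bone A"
    using assms bone_closed join_comm[of "bone A" b] join_bone by simp
  ultimately show ?thesis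
    using assms by (simp add: meet_bone)
qed

lemma le_refl: "a \<in> carrier A \<Longrightarrow> le A a a"
  by (simp add: le_def join_self)

lemma le_antisym: "\<lbrakk>a \<in> carrier A; b \<in> carrier A; le A a b; le A b a\<rbrakk> \<Longrightarrow> a = b"
  by (metis join_comm le_def)

lemma le_trans:
  "\<lbrakk>a \<in> carrier A; b \<in> carrier A; c \<in> carrier A; le A a b; le A b c\<rbrakk> \<Longrightarrow> le A a c"
  by (metis join_assoc le_def)

lemma le_bone: "a \<in> carrier A \<Longrightarrow> le A a (bone A)"
  by (simp add: le_def join_bone)

lemma bzero_le: "a \<in> carrier A \<Longrightarrow> le A (bzero A) a"
  by (metis bzero_closed join_bzero join_comm le_def)

lemma le_join1: "\<lbrakk>a \<in> carrier A; b \<in> carrier A\<rbrakk> \<Longrightarrow> le A a (join A a b)"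
  by (metis join_assoc join_self le_def)

lemma le_join2: "\<lbrakk>a \<in> carrier A; b \<in> carrier A\<rbrakk> \<Longrightarrow> le A b (join A a b)"
  by (metis join_comm le_join1)

lemma meet_le1: "\<lbrakk>a \<in> carrier A; b \<in> carrier A\<rbrakk> \<Longrightarrow> le A (meet A a b) a"
  by (metis join_comm join_meet_absorb le_def meet_closed)

lemma meet_le2: "\<lbrakk>a \<in> carrier A; b \<in> carrier A\<rbrakk> \<Longrightarrow> le A (meet A a b) b"
  by (metis meet_comm meet_le1)

lemma join_lub:
  "\<lbrakk>a \<in> carrier A; b \<in> carrier A; c \<in> carrier A; le A a c; le A b c\<rbrakk> \<Longrightarrow> le A (join A a b) c"
  by (metis join_assoc le_def)

lemma meet_glb:
  "\<lbrakk>a \<in> carrier A; b \<in> carrier A; c \<in> carrier A; le A c a; le A c b\<rbrakk> \<Longrightarrow> le A c (meet A a b)"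
  by (metis join_meet_distrib le_def)

lemma join_mono:
  assumes "a \<in> carrier A" "b \<in> carrier A" "c \<in> carrier A" "d \<in> carrier A" "le A a c" "le A b d"
  shows "le A (join A a b) (join A c d)"
  using assms le_trans[of a c "join A c d"] le_trans[of b d "join A c d"]
  by (intro join_lub) (simp_all add: join_closed le_join1 le_join2)

lemma le_bzero: "\<lbrakk>a \<in> carrier A; le A a (bzero A)\<rbrakk> \<Longrightarrow> a = bzero A"
  by (simp add: join_bzero le_def)

section \<open>Ideals, ultrafilters and the prime ideal theorem\<close>

definition ideal :: "'a set \<Rightarrow> bool" where
  "ideal I \<longleftrightarrow> I \<subseteq> carrier A \<and> bzero A \<in> I \<and>
     (\<forall>a \<in> I. \<forall>b \<in> I. join A a b \<in> I) \<and> (\<forall>a \<in> I. \<forall>b \<in> carrier A. le A b a \<longrightarrow> b \<in> I)"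

lemma ideal_in_carrier: "\<lbrakk>ideal I; a \<in> I\<rbrakk> \<Longrightarrow> a \<in> carrier A"
  unfolding ideal_def by blast

lemma ideal_bzero: "ideal I \<Longrightarrow> bzero A \<in> I"
  unfolding ideal_def by blast

lemma ideal_join: "\<lbrakk>ideal I; a \<in> I; b \<in> I\<rbrakk> \<Longrightarrow> join A a b \<in> I"
  unfolding ideal_def by blast

lemma ideal_le: "\<lbrakk>ideal I; a \<in> I; b \<in> carrier A; le A b a\<rbrakk> \<Longrightarrow> b \<in> I"
  unfolding ideal_def by blast

definition ultrafilter :: "'a set \<Rightarrow> bool" where
  "ultrafilter U \<longleftrightarrow> U \<subseteq> carrier A \<and> bone A \<in> U \<and> bzero A \<notin> U \<and>
     (\<forall>a \<in> U. \<forall>b \<in> carrier A. le A a b \<longrightarrow> b \<in> U) \<and>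
     (\<forall>a \<in> U. \<forall>b \<in> U. meet A a b \<in> U) \<and>
     (\<forall>a \<in> carrier A. \<forall>b \<in> carrier A. join A a b \<in> U \<longrightarrow> a \<in> U \<or> b \<in> U)"

text \<open>The join in the lattice of ideals. Taking everything below some \<open>i + j\<close>
  builds in downward closure, so that no element has to be split into its two parts.\<close>

definition ideal_sum :: "'a set \<Rightarrow> 'a set \<Rightarrow> 'a set" where
  "ideal_sum I J = {x \<in> carrier A. \<exists>i \<in> I. \<exists>j \<in> J. le A x (join A i j)}"

lemma join_join_swap:
  assumes "a \<in> carrier A" "b \<in> carrier A" "c \<in> carrier A" "d \<in> carrier A"
  shows "join A (join A a b) (join A c d) = join A (join A a c) (join A b d)"
proof -
  have "join A (join A a b) (join A c d) = join A a (join A (join A b c) d)"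
    using assms by (simp add: join_assoc join_closed)
  also have "\<dots> = join A a (join A (join A c b) d)"
    using assms by (simp add: join_comm)
  also have "\<dots> = join A (join A a c) (join A b d)"
    using assms by (simp add: join_assoc join_closed)
  finally show ?thesis .
qed

lemma ideal_ideal_sum:
  assumes I: "ideal I" and J: "ideal J"
  shows "ideal (ideal_sum I J)"
  unfolding ideal_def
proof (intro conjI ballI impI)
  show "ideal_sum I J \<subseteq> carrier A"
    unfolding ideal_sum_def by blast
  show "bzero A \<in> ideal_sum I J"
  proof -
    have "bzero A \<in> I" "bzero A \<in> J" "le A (bzero A) (join A (bzero A) (bzero A))"
      using I J bzero_closed bzero_le join_closed ideal_bzero by auto
    then show ?thesis
      using bzero_closed unfolding ideal_sum_def by blast
  qed
next
  fix x y assume "x \<in> ideal_sum I J" "y \<in> ideal_sum I J"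
  then obtain i j k l where *: "x \<in> carrier A" "y \<in> carrier A" "i \<in> I" "k \<in> I" "j \<in> J" "l \<in> J"
    "le A x (join A i j)" "le A y (join A k l)"
    unfolding ideal_sum_def by blast
  then have c: "i \<in> carrier A" "j \<in> carrier A" "k \<in> carrier A" "l \<in> carrier A"
    using I J ideal_in_carrier by blast+
  have "le A (join A x y) (join A (join A i k) (join A j l))"
    using * c join_mono[of x y "join A i j" "join A k l"] join_closed join_join_swap[of i j k l] by simp
  moreover have "join A i k \<in> I" "join A j l \<in> J"
    using * I J ideal_join by blast+
  ultimately show "join A x y \<in> ideal_sum I J"
    using * join_closed unfolding ideal_sum_def by blast
next
  fix x y assume "x \<in> ideal_sum I J" and y: "y \<in> carrier A" "le A y x"
  then obtain i j where *: "x \<in> carrier A" "i \<in> I" "j \<in> J" "le A x (join A i j)"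
    unfolding ideal_sum_def by blast
  moreover have "i \<in> carrier A" "j \<in> carrier A"
    using * I J ideal_in_carrier by blast+
  ultimately have "le A y (join A i j)"
    using y le_trans[of y x "join A i j"] join_closed by simp
  then show "y \<in> ideal_sum I J"
    using y * unfolding ideal_sum_def by blast
qed

lemma ideal_sum_supset:
  assumes "ideal I" "ideal J"
  shows "I \<subseteq> ideal_sum I J" "J \<subseteq> ideal_sum I J"
proof -
  have "le A x (join A x (bzero A))" "le A x (join A (bzero A) x)" if "x \<in> carrier A" for x
    using that bzero_closed le_join1 le_join2 by blast+
  then show "I \<subseteq> ideal_sum I J" "J \<subseteq> ideal_sum I J"
    using assms ideal_in_carrier ideal_bzero unfolding ideal_sum_def by blast+
qed

lemma ideal_principal: "a \<in> carrier A \<Longrightarrow> ideal {x \<in> carrier A. le A x a}"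
  unfolding ideal_def by (auto simp: bzero_closed bzero_le join_closed join_lub intro: le_trans[of _ _ a])

lemma ideal_Union_chain:
  assumes "subset.chain {I. ideal I} \<C>" "\<C> \<noteq> {}"
  shows "ideal (\<Union>\<C>)"
proof -
  have id: "ideal I" if "I \<in> \<C>" for I
    using assms that unfolding subset_chain_def by blast
  have join: "join A a b \<in> \<Union>\<C>" if "a \<in> I" "I \<in> \<C>" "b \<in> J" "J \<in> \<C>" for a b I J
  proof -
    have "I \<subseteq> J \<or> J \<subseteq> I"
      using assms that unfolding subset_chain_def by blast
    then show ?thesis
      using that ideal_join[OF id[of I], of a b] ideal_join[OF id[of J], of a b] by (metis UnionI subsetD)
  qed
  obtain K where K: "K \<in> \<C>"
    using assms(2) by blast
  show ?thesis
    unfolding ideal_def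
  proof (intro conjI ballI impI)
    show "\<Union>\<C> \<subseteq> carrier A"
      using ideal_in_carrier[OF id] by auto
    show "bzero A \<in> \<Union>\<C>"
      using ideal_bzero[OF id] K by auto
    show "join A a b \<in> \<Union>\<C>" if "a \<in> \<Union>\<C>" "b \<in> \<Union>\<C>" for a b
      using that join by auto
    show "b \<in> \<Union>\<C>" if ab: "a \<in> \<Union>\<C>" "b \<in> carrier A" "le A b a" for a b
    proof -
      obtain I where "I \<in> \<C>" "a \<in> I"
        using ab by auto
      then show ?thesis
        using ideal_le[OF id[of I] _ ab(2,3)] by auto
    qed
  qed
qed

text \<open>An ideal that is maximal among those avoiding \<open>a\<close> is prime, so its complement is an
  ultrafilter.\<close>

lemma ultrafilter_avoiding_ideal:
  assumes I: "ideal I" and a: "a \<in> carrier A" "a \<notin> I"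
  obtains U where "ultrafilter U" "a \<in> U" "U \<inter> I = {}"
proof -
  let ?\<A> = "{P. ideal P \<and> I \<subseteq> P \<and> a \<notin> P}"
  have "\<exists>M \<in> ?\<A>. \<forall>P \<in> ?\<A>. M \<subseteq> P \<longrightarrow> P = M"
  proof (rule subset_Zorn_nonempty)
    show "?\<A> \<noteq> {}"
      using I a by blast
  next
    fix \<C> assume \<C>: "\<C> \<noteq> {}" "subset.chain ?\<A> \<C>"
    then have "subset.chain {P. ideal P} \<C>"
      unfolding subset_chain_def by blast
    from ideal_Union_chain[OF this \<C>(1)] show "\<Union>\<C> \<in> ?\<A>"
      using \<C> unfolding subset_chain_def by blast
  qed
  then obtain P where "P \<in> ?\<A>" and max: "\<forall>Q \<in> ?\<A>. P \<subseteq> Q \<longrightarrow> Q = P"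
    by (rule bexE)
  then have P: "ideal P" "I \<subseteq> P" "a \<notin> P"
    by auto
  \<comment> \<open>By maximality the ideal generated by \<open>P\<close> and \<open>x\<close> must
    contain \<open>a\<close>.\<close>
  have below: "\<exists>p \<in> P. le A a (join A p x)" if x: "x \<in> carrier A" "x \<notin> P" for x
  proof (rule ccontr)
    assume no: "\<not> ?thesis"
    let ?Q = "ideal_sum P {y \<in> carrier A. le A y x}"
    have Q: "ideal ?Q" "P \<subseteq> ?Q" "x \<in> ?Q"
      using ideal_ideal_sum[OF P(1) ideal_principal[OF x(1)]]
        ideal_sum_supset[OF P(1) ideal_principal[OF x(1)]] x le_refl by auto
    have "a \<notin> ?Q"
    proof
      assume "a \<in> ?Q"
      then obtain p y where py: "p \<in> P" "y \<in> carrier A" "le A y x" "le A a (join A p y)"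
        unfolding ideal_sum_def by blast
      then have p: "p \<in> carrier A"
        using P ideal_in_carrier by blast
      then have "le A (join A p y) (join A p x)"
        using py x join_mono le_refl by blast
      then have "le A a (join A p x)"
        using le_trans[of a "join A p y" "join A p x"] p py x a join_closed by blast
      then show False
        using no py by blast
    qed
    then show False
      using bspec[OF max, of ?Q] Q P x by auto
  qed
  have prime: "meet A x y \<notin> P"
    if x: "x \<in> carrier A" "x \<notin> P" and y: "y \<in> carrier A" "y \<notin> P" for x y
  proof
    assume m: "meet A x y \<in> P"
    obtain p q where pq: "p \<in> P" "le A a (join A p x)" "q \<in> P" "le A a (join A q y)"
      using below x y by blast
    \<comment> \<open>One bound serves both elements: distributivity then gives
      \<open>a \<le> (r + x) \<cdot> (r + y) = r + x \<cdot> y\<close>, an element of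
      \<open>P\<close>.\<close>
    define r where "r = join A p q"
    have c: "p \<in> carrier A" "q \<in> carrier A" "r \<in> carrier A"
      using pq P ideal_in_carrier ideal_join unfolding r_def by blast+
    have r: "r \<in> P" "le A p r" "le A q r"
      using pq P le_join1 le_join2 c ideal_join unfolding r_def by blast+
    have "le A a (join A r x)" "le A a (join A r y)"
      using pq c x y a r le_trans[of a "join A p x" "join A r x"] le_trans[of a "join A q y" "join A r y"]
      by (simp_all add: join_mono le_refl join_closed)
    then have "le A a (join A r (meet A x y))"
      using a x y c join_meet_distrib meet_glb join_closed by simp
    moreover have "join A r (meet A x y) \<in> P"
      using r m P ideal_join by blast
    ultimately show False
      using P a ideal_le by blast
  qed
  show thesis
  proof
    show "ultrafilter (carrier A - P)"
      unfolding ultrafilter_def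
    proof (intro conjI ballI impI)
      show "bone A \<in> carrier A - P"
        using P a bone_closed le_bone ideal_le by blast
    qed (use P prime meet_closed ideal_bzero ideal_le ideal_join in blast)+
    show "a \<in> carrier A - P" "(carrier A - P) \<inter> I = {}"
      using a P by auto
  qed
qed

section \<open>Testing order and identities on ultrafilters\<close>

lemma ultrafilter_separates:
  assumes "a \<in> carrier A" "b \<in> carrier A" "\<not> le A a b"
  obtains U where "ultrafilter U" "a \<in> U" "b \<notin> U"
  by (rule ultrafilter_avoiding_ideal[OF ideal_principal[of b], of a])
    (use assms le_refl[of b] that in auto)

lemma ultrafilter_nonzero:
  assumes "a \<in> carrier A" "a \<noteq> bzero A"
  obtains U where "ultrafilter U" "a \<in> U"
  by (rule ultrafilter_separates[of a "bzero A"])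
    (use assms bzero_closed le_bzero[of a] that in auto)

lemma ultrafilter_join:
  assumes "ultrafilter U" "a \<in> carrier A" "b \<in> carrier A"
  shows "join A a b \<in> U \<longleftrightarrow> a \<in> U \<or> b \<in> U"
  using assms le_join1[of a b] le_join2[of a b] join_closed[of a b] unfolding ultrafilter_def by blast

lemma ultrafilter_meet:
  assumes "ultrafilter U" "a \<in> carrier A" "b \<in> carrier A"
  shows "meet A a b \<in> U \<longleftrightarrow> a \<in> U \<and> b \<in> U"
  using assms meet_le1[of a b] meet_le2[of a b] meet_closed[of a b] unfolding ultrafilter_def by blast

lemma ultrafilter_neg:
  assumes "ultrafilter U" "a \<in> carrier A"
  shows "neg A a \<in> U \<longleftrightarrow> a \<notin> U"
proof -
  have "join A a (neg A a) \<in> U" "meet A a (neg A a) \<notin> U"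
    using assms join_neg meet_neg unfolding ultrafilter_def by auto
  then show ?thesis
    using assms by (auto simp: ultrafilter_join ultrafilter_meet neg_closed)
qed

lemma ultrafilter_le: "\<lbrakk>ultrafilter U; a \<in> U; b \<in> carrier A; le A a b\<rbrakk> \<Longrightarrow> b \<in> U"
  unfolding ultrafilter_def by blast

lemma ultrafilter_in_carrier: "\<lbrakk>ultrafilter U; a \<in> U\<rbrakk> \<Longrightarrow> a \<in> carrier A"
  unfolding ultrafilter_def by blast

text \<open>Injectivity of the Stone representation. It reduces Boolean identities such as the De
  Morgan law to propositional logic about membership.\<close>

lemma ultrafilter_ext:
  assumes "a \<in> carrier A" "b \<in> carrier A" "\<And>U. ultrafilter U \<Longrightarrow> a \<in> U \<longleftrightarrow> b \<in> U"
  shows "a = b"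
proof (rule le_antisym)
  show "le A a b" "le A b a"
    using ultrafilter_separates[of a b] ultrafilter_separates[of b a] assms by auto
qed (use assms in auto)

lemma neg_neg: "a \<in> carrier A \<Longrightarrow> neg A (neg A a) = a"
  by (rule ultrafilter_ext) (simp_all add: ultrafilter_neg neg_closed)

lemma neg_join_neg:
  assumes "a \<in> carrier A" "b \<in> carrier A"
  shows "neg A (join A (neg A a) (neg A b)) = meet A a b"
  using assms by (intro ultrafilter_ext)
    (simp_all add: ultrafilter_neg ultrafilter_join ultrafilter_meet neg_closed join_closed meet_closed)

text \<open>Translates a covering \<open>a + b = 1\<close> into an inequality: an ideal containing
  \<open>b\<close> then also contains the complement of \<open>a\<close>. The same translation
  serves for upward closed clans.\<close>

lemma neg_le_iff:
  assumes "a \<in> carrier A" "b \<in> carrier A"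
  shows "le A (neg A a) b \<longleftrightarrow> join A a b = bone A"
proof
  assume l: "le A (neg A a) b"
  have "join A a b \<in> U" if "ultrafilter U" for U
    using that l assms ultrafilter_le[of U "neg A a" b] by (auto simp: ultrafilter_join ultrafilter_neg)
  then show "join A a b = bone A"
    using assms join_closed bone_closed by (intro ultrafilter_ext) (auto simp: ultrafilter_def)
next
  assume j: "join A a b = bone A"
  show "le A (neg A a) b"
  proof (rule ccontr)
    assume "\<not> ?thesis"
    then obtain U where U: "ultrafilter U" "neg A a \<in> U" "b \<notin> U"
      using ultrafilter_separates[of "neg A a" b] assms neg_closed by blast
    moreover have "join A a b \<in> U"
      using U j unfolding ultrafilter_def by simp
    ultimately show False
      using assms by (simp add: ultrafilter_join ultrafilter_neg)
  qed
qed

lemma neg_eq_bzero: "\<lbrakk>a \<in> carrier A; neg A a = bzero A\<rbrakk> \<Longrightarrow> a = bone A"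
  by (metis join_bzero join_neg)

end


section \<open>Contact relations and clans\<close>

text \<open>For \<open>R = Pre A\<close> this is the canonical precedence between clans; for a
  contact relation and two ultrafilters it is the condition that makes their union a clan.\<close>

definition linked :: "('a \<Rightarrow> 'a \<Rightarrow> bool) \<Rightarrow> 'a set \<Rightarrow> 'a set \<Rightarrow> bool" where
  "linked R S T \<longleftrightarrow> (\<forall>a \<in> S. \<forall>b \<in> T. R a b)"

lemma linkedD: "\<lbrakk>linked R S T; a \<in> S; b \<in> T\<rbrakk> \<Longrightarrow> R a b"
  unfolding linked_def by blast

lemma linked_converse: "linked (\<lambda>a b. R b a) S T \<longleftrightarrow> linked R T S"
  unfolding linked_def by blast

lemma precontact_nonzero:
  "\<lbrakk>precontact A R; a \<in> carrier A; b \<in> carrier A; R a b\<rbrakk> \<Longrightarrow> a \<noteq> bzero A \<and> b \<noteq> bzero A"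
  unfolding precontact_def by blast

lemma precontact_mono:
  "\<lbrakk>precontact A R; a \<in> carrier A; b \<in> carrier A; a' \<in> carrier A; b' \<in> carrier A;
    R a b; le A a a'; le A b b'\<rbrakk> \<Longrightarrow> R a' b'"
  unfolding precontact_def by blast

lemma precontact_join_right:
  "\<lbrakk>precontact A R; a \<in> carrier A; b \<in> carrier A; c \<in> carrier A; R a (join A b c)\<rbrakk>
    \<Longrightarrow> R a b \<or> R a c"
  unfolding precontact_def by blast

lemma precontact_join_left:
  "\<lbrakk>precontact A R; a \<in> carrier A; b \<in> carrier A; c \<in> carrier A; R (join A a b) c\<rbrakk>
    \<Longrightarrow> R a c \<or> R b c"
  unfolding precontact_def by blast

text \<open>Makes every statement about predecessors an instance of one about successors.\<close>

lemma precontact_converse: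
  assumes R: "precontact A R"
  shows "precontact A (\<lambda>a b. R b a)"
  unfolding precontact_def
\<comment> \<open>The instantiated rules split the list of conditions but keep the conjunction in
  the conclusion of the first condition whole.\<close>
proof (intro conjI[of "\<forall>a \<in> carrier A. \<forall>b \<in> carrier A. _ a b"] conjI[of "\<forall>a \<in> carrier A. _ a"] ballI impI)
  fix a b assume "a \<in> carrier A" "b \<in> carrier A" "R b a"
  then show "a \<noteq> bzero A \<and> b \<noteq> bzero A"
    using precontact_nonzero[OF R, of b a] by simp
next
  fix a b a' b' assume "a \<in> carrier A" "b \<in> carrier A" "a' \<in> carrier A" "b' \<in> carrier A"
    "R b a \<and> le A a a' \<and> le A b b'"
  then show "R b' a'"
    using precontact_mono[OF R, of b a b' a'] by simp
next
  fix a b c assume "a \<in> carrier A" "b \<in> carrier A" "c \<in> carrier A" "R (join A b c) a"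
  then show "R b a \<or> R c a"
    using precontact_join_left[OF R, of b c a] by simp
next
  fix a b c assume "a \<in> carrier A" "b \<in> carrier A" "c \<in> carrier A" "R c (join A a b)"
  then show "R c a \<or> R c b"
    using precontact_join_right[OF R, of c a b] by simp
qed

lemma contact_precontact: "contact A R \<Longrightarrow> precontact A R"
  unfolding contact_def by blast

lemma contact_sym: "\<lbrakk>contact A R; a \<in> carrier A; b \<in> carrier A; R a b\<rbrakk> \<Longrightarrow> R b a"
  unfolding contact_def by blast

lemma contact_meet:
  "\<lbrakk>contact A R; a \<in> carrier A; b \<in> carrier A; meet A a b \<noteq> bzero A\<rbrakk> \<Longrightarrow> R a b"
  unfolding contact_def by blast

lemma clan_in_carrier: "\<lbrakk>clan A R \<Gamma>; a \<in> \<Gamma>\<rbrakk> \<Longrightarrow> a \<in> carrier A"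
  unfolding clan_def by blast

lemma clan_bone: "clan A R \<Gamma> \<Longrightarrow> bone A \<in> \<Gamma>"
  unfolding clan_def by blast

lemma clan_bzero: "clan A R \<Gamma> \<Longrightarrow> bzero A \<notin> \<Gamma>"
  unfolding clan_def by blast

lemma clan_le: "\<lbrakk>clan A R \<Gamma>; a \<in> \<Gamma>; b \<in> carrier A; le A a b\<rbrakk> \<Longrightarrow> b \<in> \<Gamma>"
  unfolding clan_def by blast

lemma clan_prime:
  "\<lbrakk>clan A R \<Gamma>; a \<in> carrier A; b \<in> carrier A; join A a b \<in> \<Gamma>\<rbrakk> \<Longrightarrow> a \<in> \<Gamma> \<or> b \<in> \<Gamma>"
  unfolding clan_def by blast

lemma clan_related: "\<lbrakk>clan A R \<Gamma>; a \<in> \<Gamma>; b \<in> \<Gamma>\<rbrakk> \<Longrightarrow> R a b"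
  unfolding clan_def by blast

section \<open>Extension to ultrafilters and clans\<close>

context boolean_alg
begin

lemma clan_join:
  assumes "clan A R \<Gamma>" "a \<in> carrier A" "b \<in> carrier A"
  shows "join A a b \<in> \<Gamma> \<longleftrightarrow> a \<in> \<Gamma> \<or> b \<in> \<Gamma>"
  using assms clan_prime[of A R \<Gamma> a b] clan_le[of A R \<Gamma> a "join A a b"]
    clan_le[of A R \<Gamma> b "join A a b"] le_join1 le_join2 join_closed by auto

lemma clan_neg:
  assumes "clan A R \<Gamma>" "a \<in> carrier A" "a \<notin> \<Gamma>"
  shows "neg A a \<in> \<Gamma>"
  using assms clan_prime[of A R \<Gamma> a "neg A a"] clan_bone[of A R \<Gamma>] join_neg neg_closed by auto

text \<open>Directed downwards, as for a filter base. It covers singletons and ultrafilters, so that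
  single regions and whole ultrafilters can be extended by the same lemmas.\<close>

definition directed :: "'a set \<Rightarrow> bool" where
  "directed S \<longleftrightarrow> S \<subseteq> carrier A \<and> S \<noteq> {} \<and> (\<forall>a \<in> S. \<forall>b \<in> S. \<exists>c \<in> S. le A c a \<and> le A c b)"

lemma directed_singleton: "a \<in> carrier A \<Longrightarrow> directed {a}"
  unfolding directed_def by (simp add: le_refl)

lemma directed_ultrafilter:
  assumes "ultrafilter U"
  shows "directed U"
  unfolding directed_def
proof (intro conjI ballI)
  show "\<exists>c \<in> U. le A c a \<and> le A c b" if "a \<in> U" "b \<in> U" for a b
    using that assms ultrafilter_in_carrier[OF assms]
    by (intro bexI[of _ "meet A a b"]) (auto simp: ultrafilter_meet meet_le1 meet_le2)
qed (use assms in \<open>auto simp: ultrafilter_def\<close>)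

text \<open>Two regions may fail to be related to different members of \<open>S\<close>. By
  directedness and monotonicity both fail at a common lower bound, and there additivity
  applies.\<close>

lemma ideal_unlinked:
  assumes R: "precontact A R" and S: "directed S"
  shows "ideal {b \<in> carrier A. \<exists>a \<in> S. \<not> R a b}" (is "ideal ?I")
  unfolding ideal_def
proof (intro conjI ballI impI)
  have c: "a \<in> carrier A" if "a \<in> S" for a
    using that S unfolding directed_def by auto
  show "?I \<subseteq> carrier A"
    by auto
  obtain s where "s \<in> S"
    using S unfolding directed_def by auto
  then show "bzero A \<in> ?I"
    using precontact_nonzero[OF R, of s "bzero A"] c bzero_closed by auto
  show "join A b d \<in> ?I" if bd: "b \<in> ?I" "d \<in> ?I" for b d
  proof -
    obtain s t where st: "s \<in> S" "t \<in> S" "\<not> R s b" "\<not> R t d"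
      using bd by auto
    then obtain u where u: "u \<in> S" "le A u s" "le A u t"
      using S unfolding directed_def by blast
    have "\<not> R u b" "\<not> R u d"
      using st u bd c precontact_mono[OF R, of u b s b] precontact_mono[OF R, of u d t d] le_refl
      by auto
    then have "\<not> R u (join A b d)"
      using precontact_join_right[OF R, of u b d] bd c u by auto
    then show ?thesis
      using u bd join_closed by auto
  qed
  show "d \<in> ?I" if bd: "b \<in> ?I" "d \<in> carrier A" "le A d b" for b d
  proof -
    obtain s where s: "s \<in> S" "\<not> R s b"
      using bd by auto
    then have "\<not> R s d"
      using bd c precontact_mono[OF R, of s d s b] le_refl by auto
    then show ?thesis
      using s bd by auto
  qed
qed

text \<open>An ultrafilter is linked to \<open>S\<close> as soon as it avoids every region unrelated
  to some member of \<open>S\<close>, and these regions form an ideal.\<close>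

lemma ultrafilter_linked:
  assumes "precontact A R" "directed S" "b \<in> carrier A" "\<And>a. a \<in> S \<Longrightarrow> R a b"
  obtains W where "ultrafilter W" "b \<in> W" "linked R S W"
proof (rule ultrafilter_avoiding_ideal[OF ideal_unlinked[OF assms(1,2)] assms(3)])
  show "b \<notin> {b \<in> carrier A. \<exists>a \<in> S. \<not> R a b}"
    using assms(4) by auto
  fix W assume W: "ultrafilter W" "b \<in> W" "W \<inter> {b \<in> carrier A. \<exists>a \<in> S. \<not> R a b} = {}"
  then have "linked R S W"
    using ultrafilter_in_carrier unfolding linked_def by blast
  with W show thesis
    using that by blast
qed

text \<open>The common core of the directedness, circularity and density arguments: \<open>W\<close>
  has to avoid two ideals at once, and the hypothesis \<open>RQ\<close> has the shape of the time
  axioms because it forbids the two ideals from covering the unit.\<close>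

lemma ultrafilter_linked_both:
  assumes R: "precontact A R" "directed S" and Q: "precontact A Q" "directed T"
    and RQ: "\<And>s t p. \<lbrakk>s \<in> S; t \<in> T; p \<in> carrier A\<rbrakk> \<Longrightarrow> R s p \<or> Q t (neg A p)"
  obtains W where "ultrafilter W" "linked R S W" "linked Q T W"
proof -
  let ?I = "{b \<in> carrier A. \<exists>a \<in> S. \<not> R a b}" and ?J = "{b \<in> carrier A. \<exists>a \<in> T. \<not> Q a b}"
  have I: "ideal ?I" and J: "ideal ?J"
    using ideal_unlinked R Q by auto
  \<comment> \<open>From \<open>i + j = 1\<close> the complement of \<open>i\<close> lies below
    \<open>j\<close>, hence in the second ideal, and \<open>RQ\<close> fails at
    \<open>p = i\<close>.\<close>
  have 1: "bone A \<notin> ideal_sum ?I ?J"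
  proof
    assume "bone A \<in> ideal_sum ?I ?J"
    then obtain i j where ij: "i \<in> ?I" "j \<in> ?J" "le A (bone A) (join A i j)"
      unfolding ideal_sum_def by blast
    then have "join A i j = bone A"
      using le_antisym[of "bone A" "join A i j"] le_bone bone_closed join_closed by auto
    then have "le A (neg A i) j"
      using ij neg_le_iff by auto
    then have "neg A i \<in> ?J"
      using ij ideal_le[OF J, of j "neg A i"] neg_closed by auto
    then show False
      using ij RQ by blast
  qed
  obtain W where W: "ultrafilter W" "W \<inter> ideal_sum ?I ?J = {}"
    by (rule ultrafilter_avoiding_ideal[OF ideal_ideal_sum[OF I J] bone_closed 1])
  have "x \<notin> ?I" "x \<notin> ?J" "x \<in> carrier A" if "x \<in> W" for x
    using that W ideal_sum_supset[OF I J] ultrafilter_in_carrier[OF W(1)] by blast+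
  then have "linked R S W" "linked Q T W"
    unfolding linked_def by blast+
  then show thesis
    using that W(1) by blast
qed

lemma ultrafilter_contact:
  assumes "contact A R" "ultrafilter U" "a \<in> U" "b \<in> U"
  shows "R a b"
proof (rule contact_meet[OF assms(1)])
  have "meet A a b \<in> U" "bzero A \<notin> U"
    using assms unfolding ultrafilter_def by auto
  then show "meet A a b \<noteq> bzero A"
    by metis
qed (use assms ultrafilter_in_carrier in auto)

text \<open>Upward closure and primality pass to unions; only pairs with one member in each
  ultrafilter need \<open>UV\<close>, together with symmetry of contact.\<close>

lemma clan_ultrafilters:
  assumes R: "contact A R" and U: "ultrafilter U" and V: "ultrafilter V" and UV: "linked R U V"
  shows "clan A R (U \<union> V)"
proof -
  have c: "U \<subseteq> carrier A" "V \<subseteq> carrier A"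
    using U V unfolding ultrafilter_def by auto
  show ?thesis
    unfolding clan_def
  proof (intro conjI ballI impI)
    fix a b assume ab: "a \<in> U \<union> V" "b \<in> U \<union> V"
    have "R a b" if "a \<in> U" "b \<in> V" for a b
      using that UV unfolding linked_def by auto
    then show "R a b"
      using ab ultrafilter_contact[OF R U] ultrafilter_contact[OF R V] contact_sym[OF R, of b a] c[THEN subsetD] by auto
  next
    fix a b assume "a \<in> U \<union> V" "b \<in> carrier A" "le A a b"
    then show "b \<in> U \<union> V"
      using ultrafilter_le[OF U, of a b] ultrafilter_le[OF V, of a b] by auto
  next
    fix a b assume "a \<in> carrier A" "b \<in> carrier A" "join A a b \<in> U \<union> V"
    then show "a \<in> U \<union> V \<or> b \<in> U \<union> V"
      using U V by (auto simp: ultrafilter_join)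
  next
    show "bone A \<in> U \<union> V" "bzero A \<notin> U \<union> V"
      using U V by (simp_all add: ultrafilter_def)
  qed (use c in auto)
qed

lemma clan_ultrafilter:
  assumes "contact A R" "ultrafilter U"
  shows "clan A R U"
proof -
  have "linked R U U"
    using ultrafilter_contact[OF assms] unfolding linked_def by auto
  from clan_ultrafilters[OF assms assms(2) this] show ?thesis
    by simp
qed

text \<open>The complement of a clan is an ideal, so every clan is a union of ultrafilters.\<close>

lemma ultrafilter_in_clan:
  assumes \<Gamma>: "clan A R \<Gamma>" and a: "a \<in> \<Gamma>"
  obtains U where "ultrafilter U" "a \<in> U" "U \<subseteq> \<Gamma>"
proof -
  have "ideal (carrier A - \<Gamma>)"
    unfolding ideal_def
    using clan_bzero[OF \<Gamma>] bzero_closed join_closed clan_join[OF \<Gamma>] clan_le[OF \<Gamma>] by auto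
  moreover have "a \<in> carrier A" "a \<notin> carrier A - \<Gamma>"
    using a clan_in_carrier[OF \<Gamma>] by auto
  ultimately obtain U where "ultrafilter U" "a \<in> U" "U \<inter> (carrier A - \<Gamma>) = {}"
    by (rule ultrafilter_avoiding_ideal)
  then show thesis
    using that[of U] unfolding ultrafilter_def by auto
qed

text \<open>First \<open>a\<close> is extended to \<open>U\<close> with every element related to \<open>b\<close>, and then \<open>b\<close> to \<open>V\<close>.\<close>

lemma linked_ultrafilters:
  assumes R: "precontact A R" and ab: "a \<in> carrier A" "b \<in> carrier A" "R a b"
  obtains U V where "ultrafilter U" "a \<in> U" "ultrafilter V" "b \<in> V" "linked R U V"
proof -
  obtain U where U: "ultrafilter U" "a \<in> U" "linked (\<lambda>x y. R y x) {b} U"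
    by (rule ultrafilter_linked[OF precontact_converse[OF R] directed_singleton, of b a])
      (use ab in auto)
  then have "R u b" if "u \<in> U" for u
    using that unfolding linked_def by auto
  then obtain V where "ultrafilter V" "b \<in> V" "linked R U V"
    using ultrafilter_linked[OF R directed_ultrafilter[OF U(1)] ab(2)] by blast
  then show thesis
    using that U by blast
qed

text \<open>Provides the points that witness contact in a dual space. No single ultrafilter would do
  when the meet of \<open>a\<close> and \<open>b\<close> is zero.\<close>

lemma clan_of_related:
  assumes R: "contact A R" and ab: "a \<in> carrier A" "b \<in> carrier A" "R a b"
  obtains \<Gamma> where "clan A R \<Gamma>" "a \<in> \<Gamma>" "b \<in> \<Gamma>"
proof -
  obtain U V where UV: "ultrafilter U" "a \<in> U" "ultrafilter V" "b \<in> V" "linked R U V"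
    using linked_ultrafilters[OF contact_precontact[OF R] ab] by blast
  show thesis
    by (rule that[OF clan_ultrafilters[OF R UV(1,3,5)]]) (use UV in auto)
qed

end


section \<open>Clusters\<close>

lemma cluster_clan: "cluster A \<Gamma> \<Longrightarrow> clan A (Ct A) \<Gamma>"
  unfolding cluster_def t_clan_def by blast

context boolean_alg
begin

text \<open>If both relations failed, each at its own pair, then by monotonicity both would fail at
  the meets of the two pairs. The monotonicity hypothesis is restricted to \<open>U\<close> and
  \<open>V\<close> and treats \<open>R\<close> and \<open>Q\<close> together, so that it also fits
  converses and disjunctions of precedence.\<close>

lemma linked_disj:
  assumes U: "ultrafilter U" and V: "ultrafilter V"
    and mono: "\<And>a b a' b'. \<lbrakk>a \<in> U; b \<in> V; a' \<in> U; b' \<in> V; le A a a'; le A b b'\<rbrakk>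
      \<Longrightarrow> (R a b \<longrightarrow> R a' b') \<and> (Q a b \<longrightarrow> Q a' b')"
    and RQ: "\<And>a b. \<lbrakk>a \<in> U; b \<in> V\<rbrakk> \<Longrightarrow> R a b \<or> Q a b"
  shows "linked R U V \<or> linked Q U V"
proof (rule ccontr)
  assume "\<not> ?thesis"
  then obtain a b a' b' where ab: "a \<in> U" "b \<in> V" "\<not> R a b" "a' \<in> U" "b' \<in> V" "\<not> Q a' b'"
    unfolding linked_def by blast
  then have c: "a \<in> carrier A" "a' \<in> carrier A" "b \<in> carrier A" "b' \<in> carrier A"
    using ultrafilter_in_carrier[OF U] ultrafilter_in_carrier[OF V] by auto
  have m: "meet A a a' \<in> U" "meet A b b' \<in> V"
    using ab c U V by (auto simp: ultrafilter_meet)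
  then have "\<not> R (meet A a a') (meet A b b')" "\<not> Q (meet A a a') (meet A b b')"
    using mono[OF m ab(1,2)] mono[OF m ab(4,5)] ab c by (auto simp: meet_le1 meet_le2)
  then show False
    using RQ[OF m] by auto
qed

end

section \<open>The cluster of an ultrafilter\<close>

context dca
begin

lemma Ct_sym: "\<lbrakk>a \<in> carrier A; b \<in> carrier A\<rbrakk> \<Longrightarrow> Ct A a b \<longleftrightarrow> Ct A b a"
  using contact_sym[OF contact_Ct] by auto

lemma Ct_mono:
  "\<lbrakk>a \<in> carrier A; b \<in> carrier A; a' \<in> carrier A; b' \<in> carrier A;
    Ct A a b; le A a a'; le A b b'\<rbrakk> \<Longrightarrow> Ct A a' b'"
  by (rule precontact_mono[OF contact_precontact[OF contact_Ct]])

lemma Pre_mono: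
  "\<lbrakk>a \<in> carrier A; b \<in> carrier A; a' \<in> carrier A; b' \<in> carrier A;
    Pre A a b; le A a a'; le A b b'\<rbrakk> \<Longrightarrow> Pre A a' b'"
  by (rule precontact_mono[OF precontact_Pre])

lemma s_clan_imp_t_clan:
  assumes "s_clan A \<Gamma>"
  shows "t_clan A \<Gamma>"
proof -
  have \<Gamma>: "clan A (Cs A) \<Gamma>"
    using assms unfolding s_clan_def .
  have "Ct A a b" if "a \<in> \<Gamma>" "b \<in> \<Gamma>" for a b
    using that Cs_imp_Ct[of a b] clan_in_carrier[OF \<Gamma>] clan_related[OF \<Gamma>] by simp
  then show ?thesis
    using \<Gamma> unfolding t_clan_def clan_def by simp
qed

text \<open>The construction of clusters from ultrafilters familiar from proximity spaces.\<close>

definition cluster_of :: "'a set \<Rightarrow> 'a set" where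
  "cluster_of U = {a \<in> carrier A. \<forall>b \<in> U. Ct A a b}"

lemma subset_cluster_of:
  assumes "clan A (Ct A) \<Gamma>" "U \<subseteq> \<Gamma>"
  shows "\<Gamma> \<subseteq> cluster_of U"
  using assms clan_in_carrier[OF assms(1)] clan_related[OF assms(1)] unfolding cluster_of_def by auto

lemma ultrafilter_subset_cluster_of: "ultrafilter U \<Longrightarrow> U \<subseteq> cluster_of U"
  using subset_cluster_of[OF clan_ultrafilter[OF contact_Ct]] by auto

text \<open>Normality enters here: it separates \<open>a\<close> from \<open>b\<close> by some
  \<open>c\<close>, and \<open>U\<close> contains \<open>c\<close> or its complement, which
  contradicts the contact of \<open>a\<close> or of \<open>b\<close> with all of
  \<open>U\<close>.\<close>

lemma cluster_of_related:
  assumes U: "ultrafilter U" and a: "a \<in> cluster_of U" and b: "b \<in> cluster_of U"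
  shows "Ct A a b"
proof (rule ccontr)
  assume "\<not> Ct A a b"
  moreover have ab: "a \<in> carrier A" "b \<in> carrier A"
    using a b unfolding cluster_of_def by auto
  ultimately obtain c where c: "c \<in> carrier A" "\<not> Ct A a c" "\<not> Ct A (neg A c) b"
    using Ct_normal by blast
  then have "c \<notin> U" "neg A c \<notin> U"
    using a b ab Ct_sym[of "neg A c" b] neg_closed unfolding cluster_of_def by auto
  then show False
    using ultrafilter_neg[OF U] c by auto
qed

lemma clan_cluster_of:
  assumes U: "ultrafilter U"
  shows "clan A (Ct A) (cluster_of U)"
  unfolding clan_def
proof (intro conjI ballI impI)
  note c = ultrafilter_in_carrier[OF U]
  show "cluster_of U \<subseteq> carrier A"
    unfolding cluster_of_def by auto
  have 1: "bone A \<in> U"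
    using U unfolding ultrafilter_def by auto
  then show "bone A \<in> cluster_of U"
    using ultrafilter_subset_cluster_of[OF U] by auto
  show "bzero A \<notin> cluster_of U"
  proof
    assume "bzero A \<in> cluster_of U"
    then have "Ct A (bzero A) (bone A)"
      using 1 unfolding cluster_of_def by auto
    then show False
      using precontact_nonzero[OF contact_precontact[OF contact_Ct], of "bzero A" "bone A"]
        bzero_closed bone_closed by auto
  qed
  show "b \<in> cluster_of U" if ab: "a \<in> cluster_of U" "b \<in> carrier A" "le A a b" for a b
  proof -
    have "Ct A b u" if "u \<in> U" for u
      using that ab c[of u] Ct_mono[of a u b u] le_refl[of u] unfolding cluster_of_def by simp
    then show ?thesis
      using ab unfolding cluster_of_def by simp
  qed
  show "a \<in> cluster_of U \<or> b \<in> cluster_of U"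
    if ab: "a \<in> carrier A" "b \<in> carrier A" "join A a b \<in> cluster_of U" for a b
  proof (rule ccontr)
    assume "\<not> ?thesis"
    then obtain u v where uv: "u \<in> U" "v \<in> U" "\<not> Ct A a u" "\<not> Ct A b v"
      using ab unfolding cluster_of_def by blast
    \<comment> \<open>A common test element for both summands, so that additivity of contact can be
      used.\<close>
    have m: "meet A u v \<in> U"
      using uv c U by (simp add: ultrafilter_meet)
    have "\<not> Ct A a (meet A u v)" "\<not> Ct A b (meet A u v)"
      using uv c m ab Ct_mono[of a "meet A u v" a u] Ct_mono[of b "meet A u v" b v] le_refl
        meet_le1[of u v] meet_le2[of u v] by auto
    moreover have "Ct A (join A a b) (meet A u v)"
      using ab m unfolding cluster_of_def by auto
    ultimately show False
      using precontact_join_left[OF contact_precontact[OF contact_Ct], of a b "meet A u v"] ab c m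
      by auto
  qed
  show "Ct A a b" if "a \<in> cluster_of U" "b \<in> cluster_of U" for a b
    using that cluster_of_related[OF U] by auto
qed

text \<open>A region outside fails contact with some element of \<open>U\<close>, which itself
  belongs to the cluster.\<close>

lemma cluster_cluster_of:
  assumes "ultrafilter U"
  shows "cluster A (cluster_of U)"
  unfolding cluster_def t_clan_def
proof (intro conjI ballI clan_cluster_of[OF assms])
  fix a assume "a \<in> carrier A - cluster_of U"
  then obtain b where "b \<in> U" "\<not> Ct A a b"
    unfolding cluster_of_def by auto
  then show "\<exists>b \<in> cluster_of U. \<not> Ct A a b"
    using ultrafilter_subset_cluster_of[OF assms] by auto
qed

text \<open>An element of \<open>\<Delta>\<close> outside \<open>\<Gamma>\<close> would be out of
  contact with an element of \<open>\<Gamma>\<close>, although both lie in the clan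
  \<open>\<Delta>\<close>.\<close>

lemma cluster_maximal:
  assumes "cluster A \<Gamma>" "clan A (Ct A) \<Delta>" "\<Gamma> \<subseteq> \<Delta>"
  shows "\<Delta> = \<Gamma>"
proof
  show "\<Delta> \<subseteq> \<Gamma>"
  proof
    fix a assume a: "a \<in> \<Delta>"
    show "a \<in> \<Gamma>"
    proof (rule ccontr)
      assume "a \<notin> \<Gamma>"
      then obtain b where "b \<in> \<Gamma>" "\<not> Ct A a b"
        using assms(1) a clan_in_carrier[OF assms(2)] unfolding cluster_def by auto
      then show False
        using a clan_related[OF assms(2), of a b] assms(3) by auto
    qed
  qed
qed (use assms in auto)

text \<open>All members of \<open>\<Gamma>\<close> are in contact with \<open>U\<close>, which gives
  one inclusion; maximality of clusters gives equality.\<close>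

lemma cluster_eq_cluster_of:
  assumes "cluster A \<Gamma>" "ultrafilter U" "U \<subseteq> \<Gamma>"
  shows "\<Gamma> = cluster_of U"
  using cluster_maximal[OF assms(1) clan_cluster_of[OF assms(2)]]
    subset_cluster_of[OF cluster_clan[OF assms(1)] assms(3)] by auto

lemma cluster_cases:
  assumes "cluster A \<Gamma>"
  obtains U where "ultrafilter U" "\<Gamma> = cluster_of U"
proof -
  obtain U where "ultrafilter U" "U \<subseteq> \<Gamma>"
    using ultrafilter_in_clan[OF cluster_clan[OF assms] clan_bone[OF cluster_clan[OF assms]]] by blast
  then show thesis
    using that cluster_eq_cluster_of[OF assms] by blast
qed

text \<open>The two mixed axioms \<open>Ct_Pre\<close> and \<open>Pre_Ct\<close> say that enlarging ultrafilters to clusters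
  preserves precedence.\<close>

lemma linked_cluster_of:
  assumes U: "ultrafilter U" and V: "ultrafilter V"
  shows "linked (Pre A) (cluster_of U) (cluster_of V) \<longleftrightarrow> linked (Pre A) U V"
proof
  assume "linked (Pre A) (cluster_of U) (cluster_of V)"
  then show "linked (Pre A) U V"
    using ultrafilter_subset_cluster_of[OF U] ultrafilter_subset_cluster_of[OF V]
    unfolding linked_def by blast
next
  assume UV: "linked (Pre A) U V"
  show "linked (Pre A) (cluster_of U) (cluster_of V)"
    unfolding linked_def
  proof (intro ballI, rule ccontr)
    fix a b assume ab: "a \<in> cluster_of U" "b \<in> cluster_of V" "\<not> Pre A a b"
    have abc: "a \<in> carrier A" "b \<in> carrier A"
      using ab unfolding cluster_of_def by auto
    \<comment> \<open>Two interpolations move the failure of precedence inwards, until it lies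
      between the complement of \<open>c\<close>, which is in \<open>U\<close>, and
      \<open>d\<close>, which is in \<open>V\<close>.\<close>
    obtain c where c: "c \<in> carrier A" "\<not> Ct A a c" "\<not> Pre A (neg A c) b"
      using Ct_Pre[OF abc ab(3)] by blast
    obtain d where d: "d \<in> carrier A" "\<not> Pre A (neg A c) d" "\<not> Ct A (neg A d) b"
      using Pre_Ct[OF neg_closed[OF c(1)] abc(2) c(3)] by blast
    have "c \<notin> U"
      using ab c unfolding cluster_of_def by auto
    then have "neg A c \<in> U"
      using ultrafilter_neg[OF U] c by auto
    moreover have "neg A d \<notin> V"
      using ab abc d Ct_sym[of "neg A d" b] neg_closed unfolding cluster_of_def by auto
    then have "d \<in> V"
      using ultrafilter_neg[OF V] d by auto
    ultimately show False
      using UV d linkedD by metis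
  qed
qed

text \<open>Contact throughout puts \<open>V\<close> inside the cluster of \<open>U\<close>, and a
  cluster is determined by any ultrafilter in it. This is the source of the equality of time points
  in (Tri).\<close>

lemma cluster_of_eqI:
  assumes "ultrafilter U" "ultrafilter V" "linked (Ct A) U V"
  shows "cluster_of U = cluster_of V"
proof (rule cluster_eq_cluster_of[OF cluster_cluster_of])
  show "V \<subseteq> cluster_of U"
    using assms ultrafilter_in_carrier Ct_sym unfolding linked_def cluster_of_def by blast
qed (use assms in auto)

lemma nonzero_in_cluster:
  assumes "a \<in> carrier A" "a \<noteq> bzero A"
  obtains \<Gamma> where "cluster A \<Gamma>" "a \<in> \<Gamma>"
proof -
  obtain U where "ultrafilter U" "a \<in> U"
    using ultrafilter_nonzero[OF assms] by blast
  then show thesis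
    using that[of "cluster_of U"] cluster_cluster_of ultrafilter_subset_cluster_of by blast
qed

text \<open>Time contact is thus witnessed by a single time point: ultrafilters linked by
  \<open>Ct A\<close> generate the same cluster.\<close>

lemma Ct_in_cluster:
  assumes "a \<in> carrier A" "b \<in> carrier A" "Ct A a b"
  obtains \<Gamma> where "cluster A \<Gamma>" "a \<in> \<Gamma>" "b \<in> \<Gamma>"
proof -
  obtain U V where UV: "ultrafilter U" "a \<in> U" "ultrafilter V" "b \<in> V" "linked (Ct A) U V"
    using linked_ultrafilters[OF contact_precontact[OF contact_Ct] assms] by blast
  have "a \<in> cluster_of U" "b \<in> cluster_of U"
    using UV ultrafilter_subset_cluster_of[OF UV(1)] ultrafilter_subset_cluster_of[OF UV(3)]
      cluster_of_eqI[OF UV(1,3,5)] by auto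
  then show thesis
    using that cluster_cluster_of[OF UV(1)] by blast
qed

text \<open>Precedence between regions is witnessed already by time points, which is why conditions
  on \<open>T\<close> alone can determine axioms about \<open>Pre A\<close>.\<close>

lemma Pre_in_clusters:
  assumes "a \<in> carrier A" "b \<in> carrier A" "Pre A a b"
  obtains \<Gamma> \<Delta> where "cluster A \<Gamma>" "a \<in> \<Gamma>" "cluster A \<Delta>" "b \<in> \<Delta>" "linked (Pre A) \<Gamma> \<Delta>"
proof -
  obtain U V where UV: "ultrafilter U" "a \<in> U" "ultrafilter V" "b \<in> V" "linked (Pre A) U V"
    using linked_ultrafilters[OF precontact_Pre assms] by blast
  then show thesis
    using that[of "cluster_of U" "cluster_of V"] cluster_cluster_of[OF UV(1)]
      cluster_cluster_of[OF UV(3)] ultrafilter_subset_cluster_of[OF UV(1)]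
      ultrafilter_subset_cluster_of[OF UV(3)] linked_cluster_of[OF UV(1,3)] by auto
qed

end


section \<open>Time axioms and clusters\<close>

context dca
begin

text \<open>Common successors, common predecessors and intermediate points arise from one extension
  lemma by replacing precedence with its converse in none, both or one of the two places.\<close>

lemma ultrafilter_after:
  assumes "ultrafilter U" "ultrafilter V"
    and "\<And>u v p. \<lbrakk>u \<in> U; v \<in> V; p \<in> carrier A\<rbrakk> \<Longrightarrow> Pre A u p \<or> Pre A v (neg A p)"
  obtains W where "ultrafilter W" "linked (Pre A) U W" "linked (Pre A) V W"
  by (rule ultrafilter_linked_both[OF precontact_Pre directed_ultrafilter[OF assms(1)]
        precontact_Pre directed_ultrafilter[OF assms(2)] assms(3)])

lemma ultrafilter_before:
  assumes "ultrafilter U" "ultrafilter V"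
    and "\<And>u v p. \<lbrakk>u \<in> U; v \<in> V; p \<in> carrier A\<rbrakk> \<Longrightarrow> Pre A p u \<or> Pre A (neg A p) v"
  obtains W where "ultrafilter W" "linked (Pre A) W U" "linked (Pre A) W V"
  by (rule ultrafilter_linked_both[OF precontact_converse[OF precontact_Pre]
        directed_ultrafilter[OF assms(1)] precontact_converse[OF precontact_Pre]
        directed_ultrafilter[OF assms(2)] assms(3)])
    (use that in \<open>simp_all add: linked_converse[of "Pre A"]\<close>)

text \<open>Directed sets are allowed because (circ) and (dens) use it for ultrafilters, whereas
  (tr) needs a point between two single regions.\<close>

lemma between_linked:
  assumes "directed S" "directed T"
    and "\<And>s t p. \<lbrakk>s \<in> S; t \<in> T; p \<in> carrier A\<rbrakk> \<Longrightarrow> Pre A s p \<or> Pre A (neg A p) t"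
  obtains W where "ultrafilter W" "linked (Pre A) S W" "linked (Pre A) W T"
  by (rule ultrafilter_linked_both[OF precontact_Pre assms(1)
        precontact_converse[OF precontact_Pre] assms(2,3)])
    (use that in \<open>simp_all add: linked_converse[of "Pre A"]\<close>)

lemma ultrafilter_nonzero_carrier: "\<lbrakk>ultrafilter U; a \<in> U\<rbrakk> \<Longrightarrow> a \<in> carrier A \<and> a \<noteq> bzero A"
  unfolding ultrafilter_def by blast

lemma cluster_nonzero_carrier: "\<lbrakk>cluster A \<Gamma>; a \<in> \<Gamma>\<rbrakk> \<Longrightarrow> a \<in> carrier A \<and> a \<noteq> bzero A"
  using clan_in_carrier[OF cluster_clan] clan_bzero[OF cluster_clan] by metis

text \<open>Each cluster is \<open>cluster_of U\<close> for some ultrafilter \<open>U\<close>, so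
  existence claims proved for ultrafilters carry over by \<open>linked_cluster_of\<close>. The
  conditions (Ref) and (Tr) come directly from clusters: members of a clan are in contact, and
  primality places \<open>c\<close> or its complement in the middle cluster.\<close>

lemma axiom_imp_condition:
  assumes ax: "satisfies_axiom A ax"
  shows "satisfies_condition {\<Gamma>. cluster A \<Gamma>} (linked (Pre A)) (corresponding ax)"
proof -
  note uc = ultrafilter_nonzero_carrier
  have cl: "cluster_of W \<in> {\<Gamma>. cluster A \<Gamma>}" if "ultrafilter W" for W
    using cluster_cluster_of[OF that] by simp
  show ?thesis
  proof (cases ax)
    case ax_rs
    have "\<exists>W. ultrafilter W \<and> linked (Pre A) U W" if U: "ultrafilter U" for U
    proof -
      have "Pre A u (bone A)" if "u \<in> U" for u
        using ax ax_rs uc[OF U that] by simp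
      then show ?thesis
        using ultrafilter_linked[OF precontact_Pre directed_ultrafilter[OF U] bone_closed] by blast
    qed
    then show ?thesis
      using ax_rs by (auto elim!: cluster_cases) (metis cl linked_cluster_of mem_Collect_eq)
  next
    case ax_ls
    have "\<exists>W. ultrafilter W \<and> linked (Pre A) W U" if U: "ultrafilter U" for U
    proof -
      have "Pre A (bone A) u" if "u \<in> U" for u
        using ax ax_ls uc[OF U that] by simp
      then show ?thesis
        using ultrafilter_linked[OF precontact_converse[OF precontact_Pre] directed_ultrafilter[OF U]
          bone_closed] linked_converse[of "Pre A"] by metis
    qed
    then show ?thesis
      using ax_ls by (auto elim!: cluster_cases) (metis cl linked_cluster_of mem_Collect_eq)
  next
    case ax_up_dir
    have "\<exists>W. ultrafilter W \<and> linked (Pre A) U W \<and> linked (Pre A) V W"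
      if U: "ultrafilter U" and V: "ultrafilter V" for U V
    proof -
      have "Pre A u p \<or> Pre A v (neg A p)" if "u \<in> U" "v \<in> V" "p \<in> carrier A" for u v p
        using ax ax_up_dir uc[OF U that(1)] uc[OF V that(2)] that(3) by simp
      then show ?thesis
        using ultrafilter_after[OF U V] by metis
    qed
    then show ?thesis
      using ax_up_dir by (auto elim!: cluster_cases) (metis cl linked_cluster_of mem_Collect_eq)
  next
    case ax_down_dir
    have "\<exists>W. ultrafilter W \<and> linked (Pre A) W U \<and> linked (Pre A) W V"
      if U: "ultrafilter U" and V: "ultrafilter V" for U V
    proof -
      have "Pre A p u \<or> Pre A (neg A p) v" if "u \<in> U" "v \<in> V" "p \<in> carrier A" for u v p
        using ax ax_down_dir uc[OF U that(1)] uc[OF V that(2)] that(3) by simp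
      then show ?thesis
        using ultrafilter_before[OF U V] by metis
    qed
    then show ?thesis
      using ax_down_dir by (auto elim!: cluster_cases) (metis cl linked_cluster_of mem_Collect_eq)
  next
    case ax_circ
    have "\<exists>W. ultrafilter W \<and> linked (Pre A) V W \<and> linked (Pre A) W U"
      if U: "ultrafilter U" and V: "ultrafilter V" and UV: "linked (Pre A) U V" for U V
    proof -
      have "Pre A v p \<or> Pre A (neg A p) u" if "v \<in> V" "u \<in> U" "p \<in> carrier A" for u v p
        using ax ax_circ uc[OF U that(2)] uc[OF V that(1)] that(3) linkedD[OF UV that(2,1)] by simp
      then show ?thesis
        using between_linked[OF directed_ultrafilter[OF V] directed_ultrafilter[OF U]] by metis
    qed
    then show ?thesis
      using ax_circ by (auto elim!: cluster_cases simp: linked_cluster_of)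
        (metis cl linked_cluster_of mem_Collect_eq)
  next
    case ax_dens
    have "\<exists>W. ultrafilter W \<and> linked (Pre A) U W \<and> linked (Pre A) W V"
      if U: "ultrafilter U" and V: "ultrafilter V" and UV: "linked (Pre A) U V" for U V
    proof -
      have "Pre A u p \<or> Pre A (neg A p) v" if "u \<in> U" "v \<in> V" "p \<in> carrier A" for u v p
        using ax ax_dens uc[OF U that(1)] uc[OF V that(2)] that(3) linkedD[OF UV that(1,2)] by simp
      then show ?thesis
        using between_linked[OF directed_ultrafilter[OF U] directed_ultrafilter[OF V]] by metis
    qed
    then show ?thesis
      using ax_dens by (auto elim!: cluster_cases simp: linked_cluster_of)
        (metis cl linked_cluster_of mem_Collect_eq)
  next
    case ax_ref
    have "Pre A a b" if "cluster A \<Gamma>" "a \<in> \<Gamma>" "b \<in> \<Gamma>" for \<Gamma> a b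
      using ax ax_ref clan_related[OF cluster_clan, OF that] cluster_nonzero_carrier[OF that(1,2)]
        cluster_nonzero_carrier[OF that(1,3)] by simp
    then show ?thesis
      using ax_ref by (simp add: linked_def)
  next
    case ax_lin
    have "linked (Pre A) U V \<or> linked (Pre A) V U"
      if U: "ultrafilter U" and V: "ultrafilter V" for U V
    proof -
      have "linked (Pre A) U V \<or> linked (\<lambda>a b. Pre A b a) U V"
      proof (rule linked_disj[OF U V])
        show "Pre A a b \<or> Pre A b a" if "a \<in> U" "b \<in> V" for a b
          using ax ax_lin uc[OF U that(1)] uc[OF V that(2)] by simp
        show "(Pre A a b \<longrightarrow> Pre A a' b') \<and> (Pre A b a \<longrightarrow> Pre A b' a')"
          if "a \<in> U" "b \<in> V" "a' \<in> U" "b' \<in> V" "le A a a'" "le A b b'" for a b a' b'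
          using Pre_mono[of a b a' b'] Pre_mono[of b a b' a'] that uc[OF U] uc[OF V] by simp
      qed
      then show ?thesis
        by (simp add: linked_converse[of "Pre A"])
    qed
    then show ?thesis
      using ax_lin by (auto elim!: cluster_cases simp: linked_cluster_of) metis
  next
    case ax_tri
    have "cluster_of U = cluster_of V \<or> linked (Pre A) U V \<or> linked (Pre A) V U"
      if U: "ultrafilter U" and V: "ultrafilter V" for U V
    proof -
      \<comment> \<open>The three alternatives are made uniform in two rounds: contact is first
        split from precedence in either direction, then the two directions from each other.\<close>
      have "linked (Ct A) U V \<or> linked (\<lambda>a b. Pre A a b \<or> Pre A b a) U V"
      proof (rule linked_disj[OF U V])
        show "Ct A a b \<or> Pre A a b \<or> Pre A b a" if "a \<in> U" "b \<in> V" for a b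
          using ax ax_tri uc[OF U that(1)] uc[OF V that(2)] by simp
        show "(Ct A a b \<longrightarrow> Ct A a' b') \<and> (Pre A a b \<or> Pre A b a \<longrightarrow> Pre A a' b' \<or> Pre A b' a')"
          if "a \<in> U" "b \<in> V" "a' \<in> U" "b' \<in> V" "le A a a'" "le A b b'" for a b a' b'
          using Pre_mono[of a b a' b'] Pre_mono[of b a b' a'] Ct_mono[of a b a' b'] that uc[OF U]
            uc[OF V] by auto
      qed
      moreover have "linked (Pre A) U V \<or> linked (\<lambda>a b. Pre A b a) U V"
        if R: "linked (\<lambda>a b. Pre A a b \<or> Pre A b a) U V"
      proof (rule linked_disj[OF U V])
        show "Pre A a b \<or> Pre A b a" if "a \<in> U" "b \<in> V" for a b
          using linkedD[OF R that] .
        show "(Pre A a b \<longrightarrow> Pre A a' b') \<and> (Pre A b a \<longrightarrow> Pre A b' a')"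
          if "a \<in> U" "b \<in> V" "a' \<in> U" "b' \<in> V" "le A a a'" "le A b b'" for a b a' b'
          using Pre_mono[of a b a' b'] Pre_mono[of b a b' a'] that uc[OF U] uc[OF V] by simp
      qed
      ultimately show ?thesis
        using cluster_of_eqI[OF U V] by (auto simp: linked_converse[of "Pre A"])
    qed
    then show ?thesis
      using ax_tri by simp (metis cluster_cases linked_cluster_of)
  next
    case ax_tr
    have "Pre A a b" if \<Gamma>: "cluster A \<Gamma>" and \<Delta>: "cluster A \<Delta>" and \<Theta>: "cluster A \<Theta>"
      and l: "linked (Pre A) \<Gamma> \<Delta>" "linked (Pre A) \<Delta> \<Theta>" and ab: "a \<in> \<Gamma>" "b \<in> \<Theta>" for \<Gamma> \<Delta> \<Theta> a b
    proof (rule ccontr)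
      assume "\<not> Pre A a b"
      then obtain c where c: "c \<in> carrier A" "\<not> Pre A a c" "\<not> Pre A (neg A c) b"
        using ax ax_tr cluster_nonzero_carrier[OF \<Gamma> ab(1)] cluster_nonzero_carrier[OF \<Theta> ab(2)] by auto
      then have "c \<in> \<Delta> \<or> neg A c \<in> \<Delta>"
        using clan_neg[OF cluster_clan[OF \<Delta>]] by auto
      then show False
        using c linkedD[OF l(1) ab(1)] linkedD[OF l(2) _ ab(2)] by auto
    qed
    then have tr: "linked (Pre A) \<Gamma> \<Theta>" if "cluster A \<Gamma>" "cluster A \<Delta>" "cluster A \<Theta>"
      "linked (Pre A) \<Gamma> \<Delta>" "linked (Pre A) \<Delta> \<Theta>" for \<Gamma> \<Delta> \<Theta>
      using that unfolding linked_def[of "Pre A" \<Gamma> \<Theta>] by metis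
    show ?thesis
      unfolding ax_tr corresponding.simps satisfies_condition.simps
    proof (intro ballI impI)
      fix \<Gamma> \<Delta> \<Theta> assume "\<Gamma> \<in> {\<Gamma>. cluster A \<Gamma>}" "\<Delta> \<in> {\<Gamma>. cluster A \<Gamma>}"
        "\<Theta> \<in> {\<Gamma>. cluster A \<Gamma>}" "linked (Pre A) \<Gamma> \<Delta> \<and> linked (Pre A) \<Delta> \<Theta>"
      then show "linked (Pre A) \<Gamma> \<Theta>"
        by (intro tr[of \<Gamma> \<Delta> \<Theta>]) simp_all
    qed
  qed
qed

text \<open>Nonzero regions and related pairs are first placed in clusters. The cluster supplied by
  the time condition contains \<open>q\<close> or its complement, which decides the disjunction in
  the axiom; (tr) is the exception and needs an interpolant.\<close>

lemma condition_imp_axiom: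
  assumes cond: "satisfies_condition {\<Gamma>. cluster A \<Gamma>} (linked (Pre A)) (corresponding ax)"
  shows "satisfies_axiom A ax"
proof -
  note 1 = clan_bone[OF cluster_clan]
  note p = clan_neg[OF cluster_clan]
  show ?thesis
  proof (cases ax)
    case ax_rs
    have "Pre A a (bone A)" if "a \<in> carrier A" "a \<noteq> bzero A" for a
      using nonzero_in_cluster[OF that] cond ax_rs 1 linkedD[of "Pre A" _ _ a "bone A"]
      by (metis corresponding.simps(1) mem_Collect_eq satisfies_condition.simps(1))
    then show ?thesis
      using ax_rs by simp
  next
    case ax_ls
    have "Pre A (bone A) a" if "a \<in> carrier A" "a \<noteq> bzero A" for a
      using nonzero_in_cluster[OF that] cond ax_ls 1 linkedD[of "Pre A" _ _ "bone A" a]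
      by (metis corresponding.simps(2) mem_Collect_eq satisfies_condition.simps(2))
    then show ?thesis
      using ax_ls by simp
  next
    case ax_up_dir
    have "Pre A a q \<or> Pre A b (neg A q)"
      if a: "a \<in> carrier A" "a \<noteq> bzero A" and b: "b \<in> carrier A" "b \<noteq> bzero A"
        and q: "q \<in> carrier A" for a b q
    proof -
      obtain \<Gamma> \<Delta> where \<Gamma>: "cluster A \<Gamma>" "a \<in> \<Gamma>" and \<Delta>: "cluster A \<Delta>" "b \<in> \<Delta>"
        using nonzero_in_cluster[OF a] nonzero_in_cluster[OF b] by metis
      then obtain \<Theta> where "cluster A \<Theta>" and l: "linked (Pre A) \<Gamma> \<Theta>" "linked (Pre A) \<Delta> \<Theta>"
        using cond ax_up_dir by auto
      then show ?thesis
        using p[of \<Theta> q] q linkedD[OF l(1) \<Gamma>(2)] linkedD[OF l(2) \<Delta>(2)] by auto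
    qed
    then show ?thesis
      using ax_up_dir by simp
  next
    case ax_down_dir
    have "Pre A q a \<or> Pre A (neg A q) b"
      if a: "a \<in> carrier A" "a \<noteq> bzero A" and b: "b \<in> carrier A" "b \<noteq> bzero A"
        and q: "q \<in> carrier A" for a b q
    proof -
      obtain \<Gamma> \<Delta> where \<Gamma>: "cluster A \<Gamma>" "a \<in> \<Gamma>" and \<Delta>: "cluster A \<Delta>" "b \<in> \<Delta>"
        using nonzero_in_cluster[OF a] nonzero_in_cluster[OF b] by metis
      then obtain \<Theta> where "cluster A \<Theta>" and l: "linked (Pre A) \<Theta> \<Gamma>" "linked (Pre A) \<Theta> \<Delta>"
        using cond ax_down_dir by auto
      then show ?thesis
        using p[of \<Theta> q] q linkedD[OF l(1) _ \<Gamma>(2)] linkedD[OF l(2) _ \<Delta>(2)] by auto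
    qed
    then show ?thesis
      using ax_down_dir by simp
  next
    case ax_circ
    have "Pre A b q \<or> Pre A (neg A q) a"
      if ab: "a \<in> carrier A" "b \<in> carrier A" "Pre A a b" and q: "q \<in> carrier A" for a b q
    proof -
      obtain \<Gamma> \<Delta> where \<Gamma>: "cluster A \<Gamma>" "a \<in> \<Gamma>" and \<Delta>: "cluster A \<Delta>" "b \<in> \<Delta>"
        and "linked (Pre A) \<Gamma> \<Delta>"
        using Pre_in_clusters[OF ab] by metis
      then obtain \<Theta> where "cluster A \<Theta>" and l: "linked (Pre A) \<Delta> \<Theta>" "linked (Pre A) \<Theta> \<Gamma>"
        using cond ax_circ by auto
      then show ?thesis
        using p[of \<Theta> q] q linkedD[OF l(1) \<Delta>(2)] linkedD[OF l(2) _ \<Gamma>(2)] by auto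
    qed
    then show ?thesis
      using ax_circ by simp
  next
    case ax_dens
    have "Pre A a q \<or> Pre A (neg A q) b"
      if ab: "a \<in> carrier A" "b \<in> carrier A" "Pre A a b" and q: "q \<in> carrier A" for a b q
    proof -
      obtain \<Gamma> \<Delta> where \<Gamma>: "cluster A \<Gamma>" "a \<in> \<Gamma>" and \<Delta>: "cluster A \<Delta>" "b \<in> \<Delta>"
        and "linked (Pre A) \<Gamma> \<Delta>"
        using Pre_in_clusters[OF ab] by metis
      then obtain \<Theta> where "cluster A \<Theta>" and l: "linked (Pre A) \<Gamma> \<Theta>" "linked (Pre A) \<Theta> \<Delta>"
        using cond ax_dens by auto
      then show ?thesis
        using p[of \<Theta> q] q linkedD[OF l(1) \<Gamma>(2)] linkedD[OF l(2) _ \<Delta>(2)] by auto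
    qed
    then show ?thesis
      using ax_dens by simp
  next
    case ax_ref
    have "Pre A a b" if ab: "a \<in> carrier A" "b \<in> carrier A" "Ct A a b" for a b
    proof -
      obtain \<Gamma> where \<Gamma>: "cluster A \<Gamma>" "a \<in> \<Gamma>" "b \<in> \<Gamma>"
        using Ct_in_cluster[OF ab] by metis
      then have "linked (Pre A) \<Gamma> \<Gamma>"
        using cond ax_ref by simp
      from linkedD[OF this \<Gamma>(2,3)] show ?thesis .
    qed
    then show ?thesis
      using ax_ref by simp
  next
    case ax_lin
    have "Pre A a b \<or> Pre A b a"
      if a: "a \<in> carrier A" "a \<noteq> bzero A" and b: "b \<in> carrier A" "b \<noteq> bzero A" for a b
    proof -
      obtain \<Gamma> \<Delta> where \<Gamma>: "cluster A \<Gamma>" "a \<in> \<Gamma>" and \<Delta>: "cluster A \<Delta>" "b \<in> \<Delta>"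
        using nonzero_in_cluster[OF a] nonzero_in_cluster[OF b] by metis
      then have "linked (Pre A) \<Gamma> \<Delta> \<or> linked (Pre A) \<Delta> \<Gamma>"
        using cond ax_lin by simp
      then show ?thesis
        using linkedD[of "Pre A", OF _ \<Gamma>(2) \<Delta>(2)] linkedD[of "Pre A", OF _ \<Delta>(2) \<Gamma>(2)] by auto
    qed
    then show ?thesis
      using ax_lin by simp
  next
    case ax_tri
    have "Ct A a b \<or> Pre A a b \<or> Pre A b a"
      if a: "a \<in> carrier A" "a \<noteq> bzero A" and b: "b \<in> carrier A" "b \<noteq> bzero A" for a b
    proof -
      obtain \<Gamma> \<Delta> where \<Gamma>: "cluster A \<Gamma>" "a \<in> \<Gamma>" and \<Delta>: "cluster A \<Delta>" "b \<in> \<Delta>"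
        using nonzero_in_cluster[OF a] nonzero_in_cluster[OF b] by metis
      then have "\<Gamma> = \<Delta> \<or> linked (Pre A) \<Gamma> \<Delta> \<or> linked (Pre A) \<Delta> \<Gamma>"
        using cond ax_tri by simp
      then show ?thesis
        using linkedD[of "Pre A", OF _ \<Gamma>(2) \<Delta>(2)] linkedD[of "Pre A", OF _ \<Delta>(2) \<Gamma>(2)]
          clan_related[OF cluster_clan[OF \<Gamma>(1)] \<Gamma>(2), of b] \<Delta>(2) by auto
    qed
    then show ?thesis
      using ax_tri by simp
  next
    case ax_tr
    \<comment> \<open>The contrapositive of (tr): without an interpolant there is an ultrafilter
      \<open>W\<close> after \<open>a\<close> and before \<open>b\<close>. Extending
      \<open>a\<close> and \<open>b\<close> to ultrafilters linked to all of \<open>W\<close> yields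
      three clusters in a row, to which transitivity applies.\<close>
    have "Pre A a b" if a: "a \<in> carrier A" and b: "b \<in> carrier A"
      and no: "\<And>c. c \<in> carrier A \<Longrightarrow> Pre A a c \<or> Pre A (neg A c) b" for a b
    proof -
      obtain W where W: "ultrafilter W" "linked (Pre A) {a} W" "linked (Pre A) W {b}"
        using between_linked[OF directed_singleton[OF a] directed_singleton[OF b]] no
        by (metis singletonD)
      then have "Pre A a w" "Pre A w b" if "w \<in> W" for w
        using that unfolding linked_def by auto
      then obtain U V where U: "ultrafilter U" "a \<in> U" "linked (Pre A) U W"
        and V: "ultrafilter V" "b \<in> V" "linked (Pre A) W V"
        using ultrafilter_linked[OF precontact_Pre directed_ultrafilter[OF W(1)] b]
          ultrafilter_linked[OF precontact_converse[OF precontact_Pre] directed_ultrafilter[OF W(1)] a]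
          linked_converse[of "Pre A"] by metis
      have "linked (Pre A) (cluster_of U) (cluster_of W)" "linked (Pre A) (cluster_of W) (cluster_of V)"
        using U V W by (simp_all add: linked_cluster_of)
      then have "linked (Pre A) (cluster_of U) (cluster_of V)"
        using cond ax_tr cluster_cluster_of U(1) V(1) W(1) by auto
      then have "linked (Pre A) U V"
        using U V by (simp add: linked_cluster_of)
      from linkedD[OF this U(2) V(2)] show ?thesis .
    qed
    then show ?thesis
      using ax_tr by auto
  qed
qed

end


section \<open>Homomorphisms and isomorphic copies\<close>

lemma boolean_hom_funcset: "boolean_hom A B f \<Longrightarrow> f \<in> carrier A \<rightarrow> carrier B"
  unfolding boolean_hom_def by blast

lemma boolean_hom_simps:
  assumes "boolean_hom A B f"
  shows "\<lbrakk>a \<in> carrier A; b \<in> carrier A\<rbrakk> \<Longrightarrow> f (join A a b) = join B (f a) (f b)"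
    and "\<lbrakk>a \<in> carrier A; b \<in> carrier A\<rbrakk> \<Longrightarrow> f (meet A a b) = meet B (f a) (f b)"
    and "a \<in> carrier A \<Longrightarrow> f (neg A a) = neg B (f a)"
    and "f (bzero A) = bzero B" and "f (bone A) = bone B"
  using assms unfolding boolean_hom_def by simp_all

lemma boolean_hom_le:
  assumes "boolean_hom A B f" "a \<in> carrier A" "b \<in> carrier A" "le A a b"
  shows "le B (f a) (f b)"
  using assms boolean_hom_simps(1)[OF assms(1-3)] unfolding le_def by simp

text \<open>This gives the map of points dual to an algebra morphism. Reflection of the relation by
  \<open>f\<close> is what keeps the members of the preimage related.\<close>

lemma clan_vimage:
  assumes f: "boolean_hom A B f" and \<Gamma>: "clan B R' \<Gamma>" and A: "boolean_alg A"
    and R: "\<And>a b. \<lbrakk>a \<in> carrier A; b \<in> carrier A; R' (f a) (f b)\<rbrakk> \<Longrightarrow> R a b"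
  shows "clan A R {a \<in> carrier A. f a \<in> \<Gamma>}"
  unfolding clan_def
proof (intro conjI ballI impI)
  interpret boolean_alg A
    by (rule A)
  note fc = boolean_hom_funcset[OF f, THEN funcset_mem] and fs = boolean_hom_simps[OF f]
  let ?\<Delta> = "{a \<in> carrier A. f a \<in> \<Gamma>}"
  show "?\<Delta> \<subseteq> carrier A" "bone A \<in> ?\<Delta>" "bzero A \<notin> ?\<Delta>"
    using bone_closed clan_bone[OF \<Gamma>] clan_bzero[OF \<Gamma>] by (auto simp: fs)
  show "b \<in> ?\<Delta>" if "a \<in> ?\<Delta>" "b \<in> carrier A" "le A a b" for a b
    using that clan_le[OF \<Gamma>, of "f a" "f b"] boolean_hom_le[OF f, of a b] fc[of b] by simp
  show "a \<in> ?\<Delta> \<or> b \<in> ?\<Delta>" if "a \<in> carrier A" "b \<in> carrier A" "join A a b \<in> ?\<Delta>" for a b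
    using that clan_prime[OF \<Gamma>, of "f a" "f b"] fc[of a] fc[of b] fs(1)[of a b] by simp
  show "R a b" if "a \<in> ?\<Delta>" "b \<in> ?\<Delta>" for a b
    using that R[of a b] clan_related[OF \<Gamma>, of "f a" "f b"] by simp
qed

text \<open>Of \<open>B\<close> only the signature is given. That it is a dynamic contact algebra is
  a consequence, which is how the locale serves for dual algebras and for renamed copies.\<close>

locale dca_iso = dca A for A :: "'a dca" +
  fixes B :: "'b dca" and h :: "'a \<Rightarrow> 'b"
  assumes hom: "boolean_hom A B h"
    and bij: "bij_betw h (carrier A) (carrier B)"
    and Cs_iff: "\<lbrakk>a \<in> carrier A; b \<in> carrier A\<rbrakk> \<Longrightarrow> Cs B (h a) (h b) \<longleftrightarrow> Cs A a b"
    and Ct_iff: "\<lbrakk>a \<in> carrier A; b \<in> carrier A\<rbrakk> \<Longrightarrow> Ct B (h a) (h b) \<longleftrightarrow> Ct A a b"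
    and Pre_iff: "\<lbrakk>a \<in> carrier A; b \<in> carrier A\<rbrakk> \<Longrightarrow> Pre B (h a) (h b) \<longleftrightarrow> Pre A a b"
begin

lemma carrier_image: "carrier B = h ` carrier A"
  using bij by (simp add: bij_betw_def)

lemma h_eq_iff: "\<lbrakk>a \<in> carrier A; b \<in> carrier A\<rbrakk> \<Longrightarrow> h a = h b \<longleftrightarrow> a = b"
  using bij by (meson bij_betw_def inj_on_eq_iff)

text \<open>Reversed, so that an operation of \<open>B\<close> on images is collected into the image
  of an operation of \<open>A\<close>, where the known laws apply.\<close>

lemmas h_simps = boolean_hom_simps[OF hom, symmetric]
lemmas closed = join_closed meet_closed neg_closed bzero_closed bone_closed

lemma le_image_iff: "\<lbrakk>a \<in> carrier A; b \<in> carrier A\<rbrakk> \<Longrightarrow> le B (h a) (h b) \<longleftrightarrow> le A a b"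
  by (simp add: le_def h_simps closed h_eq_iff)

lemma precontact_image_iff:
  assumes "\<And>a b. \<lbrakk>a \<in> carrier A; b \<in> carrier A\<rbrakk> \<Longrightarrow> R' (h a) (h b) \<longleftrightarrow> R a b"
  shows "precontact B R' \<longleftrightarrow> precontact A R"
  unfolding precontact_def carrier_image
  by (simp add: assms h_simps closed h_eq_iff le_image_iff)

lemma contact_image_iff:
  assumes "\<And>a b. \<lbrakk>a \<in> carrier A; b \<in> carrier A\<rbrakk> \<Longrightarrow> R' (h a) (h b) \<longleftrightarrow> R a b"
  shows "contact B R' \<longleftrightarrow> contact A R"
  using precontact_image_iff[of R' R, OF assms] unfolding contact_def carrier_image
  by (simp add: assms h_simps closed h_eq_iff)

lemma boolean_alg_image: "boolean_alg B"
proof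
  show "join B a b \<in> carrier B" "meet B a b \<in> carrier B" "join B a b = join B b a"
    "meet B a b = meet B b a" if "a \<in> carrier B" "b \<in> carrier B" for a b
    using that join_comm meet_comm by (auto simp: carrier_image h_simps closed)
  show "neg B a \<in> carrier B" "join B a (bzero B) = a" "meet B a (bone B) = a"
    "join B a (neg B a) = bone B" "meet B a (neg B a) = bzero B" if "a \<in> carrier B" for a
    using that
    by (auto simp: carrier_image h_simps closed join_bzero meet_bone join_neg meet_neg)
  show "bzero B \<in> carrier B" "bone B \<in> carrier B" "bzero B \<noteq> bone B"
    using bzero_neq_bone by (auto simp: carrier_image h_simps closed h_eq_iff)
  show "join B (join B a b) c = join B a (join B b c)" "meet B (meet B a b) c = meet B a (meet B b c)"
    if "a \<in> carrier B" "b \<in> carrier B" "c \<in> carrier B" for a b c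
    using that by (auto simp: carrier_image h_simps closed join_assoc meet_assoc)
  show "meet B a (join B b c) = join B (meet B a b) (meet B a c)"
    if "a \<in> carrier B" "b \<in> carrier B" "c \<in> carrier B" for a b c
    using that by (auto simp: carrier_image h_simps closed meet_join_distrib)
  show "join B a (meet B b c) = meet B (join B a b) (join B a c)"
    if "a \<in> carrier B" "b \<in> carrier B" "c \<in> carrier B" for a b c
    using that by (auto simp: carrier_image h_simps closed join_meet_distrib)
qed

lemma dca_image: "dca B"
proof (intro dca.intro boolean_alg_image dca_axioms.intro)
  show "contact B (Cs B)" "contact B (Ct B)" "precontact B (Pre B)"
    using contact_Cs contact_Ct precontact_Pre contact_image_iff[of "Cs B" "Cs A", OF Cs_iff]
      contact_image_iff[of "Ct B" "Ct A", OF Ct_iff] precontact_image_iff[of "Pre B" "Pre A", OF Pre_iff] by simp_all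
  fix x y assume "x \<in> carrier B" "y \<in> carrier B"
  then obtain a b where ab: "a \<in> carrier A" "b \<in> carrier A" "x = h a" "y = h b"
    by (auto simp: carrier_image)
  note s = ab Cs_iff Ct_iff Pre_iff carrier_image h_simps closed
  show "Ct B x y" if "Cs B x y"
    using that Cs_imp_Ct[of a b] by (simp add: s)
  show "\<exists>c \<in> carrier B. \<not> Ct B x c \<and> \<not> Ct B (neg B c) y" if "\<not> Ct B x y"
    using that Ct_normal[of a b] by (simp add: s)
  show "\<exists>c \<in> carrier B. \<not> Ct B x c \<and> \<not> Pre B (neg B c) y" if "\<not> Pre B x y"
    using that Ct_Pre[of a b] by (simp add: s)
  show "\<exists>c \<in> carrier B. \<not> Pre B x c \<and> \<not> Ct B (neg B c) y" if "\<not> Pre B x y"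
    using that Pre_Ct[of a b] by (simp add: s)
qed

lemma clan_image_iff:
  assumes \<Gamma>: "\<Gamma> \<subseteq> carrier A"
    and R: "\<And>a b. \<lbrakk>a \<in> carrier A; b \<in> carrier A\<rbrakk> \<Longrightarrow> R' (h a) (h b) \<longleftrightarrow> R a b"
  shows "clan B R' (h ` \<Gamma>) \<longleftrightarrow> clan A R \<Gamma>"
proof -
  have m: "h a \<in> h ` \<Gamma> \<longleftrightarrow> a \<in> \<Gamma>" if "a \<in> carrier A" for a
    using that \<Gamma> h_eq_iff[OF that] by auto
  have "h ` \<Gamma> \<subseteq> h ` carrier A \<longleftrightarrow> \<Gamma> \<subseteq> carrier A"
    using \<Gamma> by auto
  moreover have "(\<forall>a \<in> \<Gamma>. \<forall>b \<in> carrier A. le B (h a) (h b) \<longrightarrow> h b \<in> h ` \<Gamma>) \<longleftrightarrow>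
      (\<forall>a \<in> \<Gamma>. \<forall>b \<in> carrier A. le A a b \<longrightarrow> b \<in> \<Gamma>)"
    using \<Gamma> m le_image_iff subsetD[OF \<Gamma>] by simp
  moreover have "(\<forall>a \<in> \<Gamma>. \<forall>b \<in> \<Gamma>. R' (h a) (h b)) \<longleftrightarrow> (\<forall>a \<in> \<Gamma>. \<forall>b \<in> \<Gamma>. R a b)"
    using R subsetD[OF \<Gamma>] by simp
  ultimately show ?thesis
    unfolding clan_def carrier_image by (simp add: h_simps closed m)
qed

lemma t_clan_image_iff: "\<Gamma> \<subseteq> carrier A \<Longrightarrow> t_clan B (h ` \<Gamma>) \<longleftrightarrow> t_clan A \<Gamma>"
  unfolding t_clan_def by (rule clan_image_iff) (simp_all add: Ct_iff)

lemma s_clan_image_iff: "\<Gamma> \<subseteq> carrier A \<Longrightarrow> s_clan B (h ` \<Gamma>) \<longleftrightarrow> s_clan A \<Gamma>"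
  unfolding s_clan_def by (rule clan_image_iff) (simp_all add: Cs_iff)

lemma cluster_image_iff:
  assumes \<Gamma>: "\<Gamma> \<subseteq> carrier A"
  shows "cluster B (h ` \<Gamma>) \<longleftrightarrow> cluster A \<Gamma>"
proof -
  have "carrier B - h ` \<Gamma> = h ` (carrier A - \<Gamma>)"
    using \<Gamma> bij by (simp add: carrier_image bij_betw_def inj_on_image_set_diff[of h "carrier A"])
  moreover have "(\<forall>a \<in> carrier A - \<Gamma>. \<exists>b \<in> \<Gamma>. \<not> Ct B (h a) (h b)) \<longleftrightarrow>
      (\<forall>a \<in> carrier A - \<Gamma>. \<exists>b \<in> \<Gamma>. \<not> Ct A a b)"
    using Ct_iff subsetD[OF \<Gamma>] by auto
  ultimately show ?thesis
    unfolding cluster_def by (simp add: t_clan_image_iff[OF \<Gamma>])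
qed

lemma subset_carrier_image:
  assumes "\<Delta> \<subseteq> carrier B"
  obtains \<Gamma> where "\<Gamma> \<subseteq> carrier A" "\<Delta> = h ` \<Gamma>"
  using assms carrier_image subset_imageE by metis

end

text \<open>Injectivity of \<open>e\<close> matters for (Tri), whose condition mentions
  equality.\<close>

lemma satisfies_condition_bij:
  assumes e: "bij_betw e T T'" and r: "\<And>x y. \<lbrakk>x \<in> T; y \<in> T\<rbrakk> \<Longrightarrow> r' (e x) (e y) \<longleftrightarrow> r x y"
  shows "satisfies_condition T r c \<longleftrightarrow> satisfies_condition T' r' c"
proof -
  have T': "T' = e ` T" and "inj_on e T"
    using e by (auto simp: bij_betw_def)
  then have "e x = e y \<longleftrightarrow> x = y" if "x \<in> T" "y \<in> T" for x y
    using that by (auto dest: inj_onD)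
  then show ?thesis
    unfolding T' by (cases c) (simp_all add: r cong: ball_cong bex_cong)
qed


section \<open>Spaces dual to an algebra\<close>

text \<open>The Stone map, read off from a labelling of the points by sets of regions.\<close>

definition extent :: "'b dms \<Rightarrow> ('b \<Rightarrow> 'a set) \<Rightarrow> 'a \<Rightarrow> 'b set" where
  "extent S e a = {x \<in> topspace (Xt S). a \<in> e x}"

text \<open>\<open>duality A S e\<close> says that \<open>S\<close> is a copy of the dual space of \<open>A\<close>, the point \<open>x\<close> of \<open>S\<close>
  representing the t-clan \<open>e x\<close>.\<close>

locale duality = dca A for A :: "'a dca" +
  fixes S :: "'b dms" and e :: "'b \<Rightarrow> 'a set"
  assumes bij_e: "bij_betw e (topspace (Xt S)) {\<Gamma>. t_clan A \<Gamma>}"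
    and Xs_eq: "Xs S = {x \<in> topspace (Xt S). s_clan A (e x)}"
    and Tm_eq: "Tm S = {x \<in> topspace (Xt S). cluster A (e x)}"
    and prec_linked: "\<lbrakk>x \<in> topspace (Xt S); y \<in> topspace (Xt S)\<rbrakk>
      \<Longrightarrow> prec S x y \<longleftrightarrow> linked (Pre A) (e x) (e y)"
    and alg_image: "alg S = extent S e ` carrier A"
    and hom_extent: "boolean_hom A (dual_algebra S) (extent S e)"
begin

lemma e_t_clan: "x \<in> topspace (Xt S) \<Longrightarrow> t_clan A (e x)"
  using bij_betw_apply[OF bij_e, of x] by simp

lemma e_subset: "x \<in> topspace (Xt S) \<Longrightarrow> e x \<subseteq> carrier A"
  using e_t_clan[of x] unfolding t_clan_def clan_def by simp

lemma obtain_point: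
  assumes "t_clan A \<Gamma>"
  obtains x where "x \<in> topspace (Xt S)" "e x = \<Gamma>"
  using assms bij_e unfolding bij_betw_def by (metis imageE mem_Collect_eq)

lemma e_inj: "\<lbrakk>x \<in> topspace (Xt S); y \<in> topspace (Xt S); e x = e y\<rbrakk> \<Longrightarrow> x = y"
  using bij_e unfolding bij_betw_def by (metis inj_onD)

lemma ultrafilter_t_clan: "ultrafilter U \<Longrightarrow> t_clan A U"
  unfolding t_clan_def by (rule clan_ultrafilter[OF contact_Ct])

text \<open>Every ultrafilter is a t-clan and hence labels a point, so points separate
  regions.\<close>

lemma extent_inj:
  assumes "a \<in> carrier A" "b \<in> carrier A" "extent S e a = extent S e b"
  shows "a = b"
proof (rule ultrafilter_ext[OF assms(1,2)])
  fix U assume "ultrafilter U"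
  then obtain x where "x \<in> topspace (Xt S)" "e x = U"
    using obtain_point[OF ultrafilter_t_clan] by metis
  then show "a \<in> U \<longleftrightarrow> b \<in> U"
    using assms(3) unfolding extent_def by blast
qed

lemma satisfies_condition_iff:
  "satisfies_condition (Tm S) (prec S) c \<longleftrightarrow>
    satisfies_condition {\<Gamma>. cluster A \<Gamma>} (linked (Pre A)) c"
proof (rule satisfies_condition_bij)
  have "\<exists>x \<in> Tm S. e x = \<Gamma>" if \<Gamma>: "cluster A \<Gamma>" for \<Gamma>
  proof -
    obtain x where "x \<in> topspace (Xt S)" "e x = \<Gamma>"
      using \<Gamma> obtain_point[of \<Gamma>] unfolding cluster_def by metis
    with \<Gamma> show ?thesis
      by (intro bexI[of _ x]) (simp_all add: Tm_eq)
  qed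
  moreover have "inj_on e (Tm S)"
    by (rule inj_onI) (simp add: e_inj Tm_eq)
  ultimately show "bij_betw e (Tm S) {\<Gamma>. cluster A \<Gamma>}"
    unfolding bij_betw_def by (auto simp: Tm_eq)
qed (simp add: Tm_eq prec_linked)

lemma satisfies_axiom_iff:
  "satisfies_axiom A ax \<longleftrightarrow> satisfies_condition (Tm S) (prec S) (corresponding ax)"
  using axiom_imp_condition condition_imp_axiom satisfies_condition_iff by metis

end

text \<open>Equivalently, \<open>\<theta>\<close> pulls the extent of \<open>a\<close> back to the
  extent of \<open>f a\<close>. Being a relation, it allows either map to be obtained from the
  other.\<close>

definition dual_morphisms ::
    "'a dca \<Rightarrow> ('b \<Rightarrow> 'a set) \<Rightarrow> 'd dms \<Rightarrow> ('d \<Rightarrow> 'c set) \<Rightarrow> ('a \<Rightarrow> 'c) \<Rightarrow> ('d \<Rightarrow> 'b) \<Rightarrow> bool" where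
  "dual_morphisms A e X d f \<theta> \<longleftrightarrow>
     (\<forall>x \<in> topspace (Xt X). \<forall>a \<in> carrier A. a \<in> e (\<theta> x) \<longleftrightarrow> f a \<in> d x)"

lemma boolean_hom_factor:
  assumes A: "boolean_alg A" and g: "boolean_hom A C g" "carrier C = g ` carrier A"
    and f: "boolean_hom A D f" and k: "\<And>a. a \<in> carrier A \<Longrightarrow> k (g a) = f a"
  shows "boolean_hom C D k"
proof -
  interpret boolean_alg A by (rule A)
  note s = boolean_hom_simps[OF g(1), symmetric] boolean_hom_simps[OF f] k
    join_closed meet_closed neg_closed bzero_closed bone_closed
  have "f a \<in> carrier D" if "a \<in> carrier A" for a
    using boolean_hom_funcset[OF f] that by auto
  then show ?thesis
    unfolding boolean_hom_def g(2) by (auto simp: s)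
qed

text \<open>The laws hold after the injective \<open>h\<close>, and \<open>h\<close> can be
  cancelled.\<close>

lemma boolean_hom_cofactor:
  assumes A: "boolean_alg A" and B: "boolean_alg B" and h: "boolean_hom B D h" "inj_on h (carrier B)"
    and g: "boolean_hom A D g" and f: "f \<in> carrier A \<rightarrow> carrier B"
    and fg: "\<And>a. a \<in> carrier A \<Longrightarrow> h (f a) = g a"
  shows "boolean_hom A B f"
proof -
  interpret A: boolean_alg A by (rule A)
  interpret B: boolean_alg B by (rule B)
  have f': "f a \<in> carrier B" if "a \<in> carrier A" for a
    using f that by auto
  note c = A.join_closed A.meet_closed A.neg_closed A.bzero_closed A.bone_closed
    B.join_closed B.meet_closed B.neg_closed B.bzero_closed B.bone_closed f'
  have eq: "x = y" if "h x = h y" "x \<in> carrier B" "y \<in> carrier B" for x y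
    using h(2) that by (auto dest: inj_onD)
  note s = fg boolean_hom_simps[OF g] boolean_hom_simps[OF h(1)] c
  show ?thesis
    unfolding boolean_hom_def
  proof (intro conjI ballI f)
    show "f (join A a b) = join B (f a) (f b)" "f (meet A a b) = meet B (f a) (f b)"
      if "a \<in> carrier A" "b \<in> carrier A" for a b
      using that by (auto intro!: eq simp: s)
    show "f (neg A a) = neg B (f a)" if "a \<in> carrier A" for a
      using that by (auto intro!: eq simp: s)
    show "f (bzero A) = bzero B" "f (bone A) = bone B"
      by (auto intro!: eq simp: s)
  qed
qed

lemma boolean_hom_compose:
  assumes f: "boolean_hom A B f" and g: "boolean_hom B C g"
  shows "boolean_hom A C (\<lambda>a. g (f a))"
proof -
  have "f a \<in> carrier B" if "a \<in> carrier A" for a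
    using boolean_hom_funcset[OF f] that by auto
  moreover have "g b \<in> carrier C" if "b \<in> carrier B" for b
    using boolean_hom_funcset[OF g] that by auto
  ultimately show ?thesis
    unfolding boolean_hom_def by (simp add: boolean_hom_simps[OF f] boolean_hom_simps[OF g])
qed

locale duality_pair = A: duality A S e + B: duality B X d
  for A :: "'a dca" and S :: "'b dms" and e :: "'b \<Rightarrow> 'a set"
    and B :: "'c dca" and X :: "'d dms" and d :: "'d \<Rightarrow> 'c set"
begin

lemma dual_e:
  assumes "dual_morphisms A e X d f \<theta>" "\<theta> \<in> topspace (Xt X) \<rightarrow> topspace (Xt S)"
    and x: "x \<in> topspace (Xt X)"
  shows "e (\<theta> x) = {a \<in> carrier A. f a \<in> d x}"
  using assms A.e_subset[of "\<theta> x"] unfolding dual_morphisms_def by auto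

lemma dual_extent:
  assumes "dual_morphisms A e X d f \<theta>" "\<theta> \<in> topspace (Xt X) \<rightarrow> topspace (Xt S)"
    and a: "a \<in> carrier A"
  shows "\<theta> -` extent S e a \<inter> topspace (Xt X) = extent X d (f a)"
  using assms unfolding dual_morphisms_def extent_def by auto

lemma dms_morphism_dual:
  assumes f: "dca_morphism A B f" and \<theta>: "\<theta> \<in> topspace (Xt X) \<rightarrow> topspace (Xt S)"
    and dual: "dual_morphisms A e X d f \<theta>"
  shows "dms_morphism X S \<theta>"
  unfolding dms_morphism_def
proof (intro conjI ballI impI \<theta>)
  note e = dual_e[OF dual \<theta>]
  have hf: "boolean_hom A B f"
    using f unfolding dca_morphism_def by simp
  have \<theta>': "\<theta> x \<in> topspace (Xt S)" if "x \<in> topspace (Xt X)" for x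
    using \<theta> that by auto
  show "\<theta> ` Xs X \<subseteq> Xs S"
  proof (rule image_subsetI)
    fix x assume "x \<in> Xs X"
    then have xX: "x \<in> topspace (Xt X)" and "clan B (Cs B) (d x)"
      by (simp_all add: B.Xs_eq s_clan_def)
    then have "s_clan A (e (\<theta> x))"
      unfolding s_clan_def e[OF xX] using f
      by (intro clan_vimage[where R' = "Cs B", OF hf _ A.boolean_alg_axioms]) (auto simp: dca_morphism_def)
    then show "\<theta> x \<in> Xs S"
      using A.Xs_eq \<theta>'[OF xX] by simp
  qed
  show "prec S (\<theta> x) (\<theta> y)" if x: "x \<in> topspace (Xt X)" and y: "y \<in> topspace (Xt X)"
    and xy: "prec X x y" for x y
  proof -
    have "linked (Pre B) (d x) (d y)"
      using B.prec_linked[OF x y] xy by simp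
    then have "linked (Pre A) (e (\<theta> x)) (e (\<theta> y))"
      using f unfolding e[OF x] e[OF y] linked_def dca_morphism_def by simp
    then show ?thesis
      using A.prec_linked[OF \<theta>'[OF x] \<theta>'[OF y]] by simp
  qed
  \<comment> \<open>Every region of \<open>S\<close> is an extent, and on extents the preimage map
    is \<open>f\<close> followed by the extent map of \<open>X\<close>.\<close>
  show "boolean_hom (dual_algebra S) (dual_algebra X) (\<lambda>a. \<theta> -` a \<inter> topspace (Xt X))"
    using A.alg_image dual_extent[OF dual \<theta>]
    by (intro boolean_hom_factor[OF A.boolean_alg_axioms A.hom_extent _
          boolean_hom_compose[OF hf B.hom_extent]]) (simp_all add: dual_algebra_def)
qed

text \<open>A relation between \<open>f a\<close> and \<open>f b\<close> is witnessed by points of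
  \<open>X\<close>; their images under \<open>\<theta>\<close> witness the relation between
  \<open>a\<close> and \<open>b\<close>.\<close>

lemma dca_morphism_dual:
  assumes \<theta>: "dms_morphism X S \<theta>" and f: "f \<in> carrier A \<rightarrow> carrier B"
    and dual: "dual_morphisms A e X d f \<theta>"
  shows "dca_morphism A B f"
  unfolding dca_morphism_def
proof (intro conjI ballI impI)
  have \<theta>': "\<theta> \<in> topspace (Xt X) \<rightarrow> topspace (Xt S)" and \<theta>s: "\<theta> ` Xs X \<subseteq> Xs S"
    and \<theta>p: "\<And>x y. \<lbrakk>x \<in> topspace (Xt X); y \<in> topspace (Xt X); prec X x y\<rbrakk> \<Longrightarrow> prec S (\<theta> x) (\<theta> y)"
    and \<theta>h: "boolean_hom (dual_algebra S) (dual_algebra X) (\<lambda>a. \<theta> -` a \<inter> topspace (Xt X))"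
    using \<theta> unfolding dms_morphism_def by auto
  note e = dual_e[OF dual \<theta>']
  have inj: "inj_on (extent X d) (carrier B)"
    by (rule inj_onI) (rule B.extent_inj)
  \<comment> \<open>Following \<open>f\<close> by the injective extent map of \<open>X\<close> gives
    a composite of known homomorphisms.\<close>
  show "boolean_hom A B f"
    by (rule boolean_hom_cofactor[OF A.boolean_alg_axioms B.boolean_alg_axioms B.hom_extent inj
          boolean_hom_compose[OF A.hom_extent \<theta>h] f]) (simp add: dual_extent[OF dual \<theta>'])
  fix a b assume ab: "a \<in> carrier A" "b \<in> carrier A"
  then have fab: "f a \<in> carrier B" "f b \<in> carrier B"
    using f by auto
  show "Cs A a b" if R: "Cs B (f a) (f b)"
  proof -
    obtain \<Gamma> where \<Gamma>: "clan B (Cs B) \<Gamma>" "f a \<in> \<Gamma>" "f b \<in> \<Gamma>"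
      using B.clan_of_related[OF B.contact_Cs fab R] by metis
    then have s: "s_clan B \<Gamma>"
      by (simp add: s_clan_def)
    obtain x where x: "x \<in> topspace (Xt X)" "d x = \<Gamma>"
      using B.obtain_point[OF B.s_clan_imp_t_clan[OF s]] by metis
    then have "\<theta> x \<in> Xs S"
      using s \<theta>s B.Xs_eq by auto
    then have "clan A (Cs A) (e (\<theta> x))"
      using A.Xs_eq by (simp add: s_clan_def)
    then show ?thesis
      using clan_related[of A "Cs A" "e (\<theta> x)" a b] \<Gamma> ab x e[OF x(1)] by simp
  qed
  show "Ct A a b" if R: "Ct B (f a) (f b)"
  proof -
    obtain \<Gamma> where \<Gamma>: "clan B (Ct B) \<Gamma>" "f a \<in> \<Gamma>" "f b \<in> \<Gamma>"
      using B.clan_of_related[OF B.contact_Ct fab R] by metis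
    obtain x where x: "x \<in> topspace (Xt X)" "d x = \<Gamma>"
      using B.obtain_point[of \<Gamma>] \<Gamma>(1) unfolding t_clan_def by metis
    then have "clan A (Ct A) (e (\<theta> x))"
      using A.e_t_clan[of "\<theta> x"] \<theta>' by (auto simp: t_clan_def)
    then show ?thesis
      using clan_related[of A "Ct A" "e (\<theta> x)" a b] \<Gamma> ab x e[OF x(1)] by simp
  qed
  show "Pre A a b" if R: "Pre B (f a) (f b)"
  proof -
    obtain \<Gamma> \<Delta> where \<Gamma>: "cluster B \<Gamma>" "f a \<in> \<Gamma>" and \<Delta>: "cluster B \<Delta>" "f b \<in> \<Delta>"
      and l: "linked (Pre B) \<Gamma> \<Delta>"
      using B.Pre_in_clusters[OF fab R] by metis
    obtain x y where x: "x \<in> topspace (Xt X)" "d x = \<Gamma>" and y: "y \<in> topspace (Xt X)" "d y = \<Delta>"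
      using B.obtain_point[of \<Gamma>] B.obtain_point[of \<Delta>] \<Gamma>(1) \<Delta>(1) unfolding cluster_def by metis
    have "prec S (\<theta> x) (\<theta> y)"
      using \<theta>p[OF x(1) y(1)] B.prec_linked[OF x(1) y(1)] l x y by simp
    then have "linked (Pre A) (e (\<theta> x)) (e (\<theta> y))"
      using A.prec_linked[of "\<theta> x" "\<theta> y"] \<theta>' x y by auto
    then show ?thesis
      using linkedD[of "Pre A" "e (\<theta> x)" "e (\<theta> y)" a b] \<Gamma> \<Delta> ab x y e[OF x(1)] e[OF y(1)] by simp
  qed
qed

lemma ex_dual_of_dca_morphism:
  assumes f: "dca_morphism A B f"
  obtains \<theta> where "\<theta> \<in> topspace (Xt X) \<rightarrow>\<^sub>E topspace (Xt S)" "dual_morphisms A e X d f \<theta>"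
proof -
  have "\<exists>y \<in> topspace (Xt S). e y = {a \<in> carrier A. f a \<in> d x}" if x: "x \<in> topspace (Xt X)" for x
  proof -
    have "t_clan A {a \<in> carrier A. f a \<in> d x}"
      unfolding t_clan_def
      using f B.e_t_clan[OF x] unfolding t_clan_def
      by (intro clan_vimage[where R' = "Ct B", OF _ _ A.boolean_alg_axioms]) (auto simp: dca_morphism_def)
    then show ?thesis
      using A.obtain_point by metis
  qed
  then obtain t where t: "\<And>x. x \<in> topspace (Xt X) \<Longrightarrow> t x \<in> topspace (Xt S) \<and>
      e (t x) = {a \<in> carrier A. f a \<in> d x}"
    by metis
  show thesis
  proof
    show "restrict t (topspace (Xt X)) \<in> topspace (Xt X) \<rightarrow>\<^sub>E topspace (Xt S)"
      using t by auto
    show "dual_morphisms A e X d f (restrict t (topspace (Xt X)))"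
      using t unfolding dual_morphisms_def by simp
  qed
qed

text \<open>The preimage of an extent is a region of \<open>X\<close>, hence the extent of some
  element of \<open>B\<close>; that element is the value of \<open>f\<close>.\<close>

lemma ex_dual_of_dms_morphism:
  assumes \<theta>: "dms_morphism X S \<theta>"
  obtains f where "f \<in> carrier A \<rightarrow>\<^sub>E carrier B" "dual_morphisms A e X d f \<theta>"
proof -
  have \<theta>': "\<theta> \<in> topspace (Xt X) \<rightarrow> topspace (Xt S)"
    and \<theta>h: "boolean_hom (dual_algebra S) (dual_algebra X) (\<lambda>a. \<theta> -` a \<inter> topspace (Xt X))"
    using \<theta> unfolding dms_morphism_def by auto
  have "\<exists>b \<in> carrier B. extent X d b = \<theta> -` extent S e a \<inter> topspace (Xt X)"
    if a: "a \<in> carrier A" for a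
  proof -
    have "extent S e a \<in> carrier (dual_algebra S)"
      using boolean_hom_funcset[OF A.hom_extent] a by auto
    then have "\<theta> -` extent S e a \<inter> topspace (Xt X) \<in> carrier (dual_algebra X)"
      using boolean_hom_funcset[OF \<theta>h] by auto
    then show ?thesis
      using B.alg_image by (auto simp: dual_algebra_def)
  qed
  then obtain f where f: "\<And>a. a \<in> carrier A \<Longrightarrow> f a \<in> carrier B \<and>
      extent X d (f a) = \<theta> -` extent S e a \<inter> topspace (Xt X)"
    by metis
  show thesis
  proof
    show "restrict f (carrier A) \<in> carrier A \<rightarrow>\<^sub>E carrier B"
      using f by auto
    have "a \<in> e (\<theta> x) \<longleftrightarrow> f a \<in> d x" if "x \<in> topspace (Xt X)" "a \<in> carrier A" for x a
    proof -
      have "x \<in> extent X d (f a) \<longleftrightarrow> x \<in> \<theta> -` extent S e a \<inter> topspace (Xt X)"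
        using f that by simp
      then show ?thesis
        using that \<theta>' by (auto simp: extent_def)
    qed
    then show "dual_morphisms A e X d (restrict f (carrier A)) \<theta>"
      unfolding dual_morphisms_def by simp
  qed
qed

text \<open>The label of \<open>\<theta> x\<close> is determined by \<open>f\<close>, and labels are
  injective. Functoriality rests on this uniqueness.\<close>

lemma dual_unique_point_map:
  assumes "dual_morphisms A e X d f \<theta>" "dual_morphisms A e X d f \<theta>'"
    and "\<theta> \<in> topspace (Xt X) \<rightarrow>\<^sub>E topspace (Xt S)" "\<theta>' \<in> topspace (Xt X) \<rightarrow>\<^sub>E topspace (Xt S)"
  shows "\<theta> = \<theta>'"
proof (rule PiE_ext[OF assms(3,4)])
  fix x assume x: "x \<in> topspace (Xt X)"
  have m: "\<theta> \<in> topspace (Xt X) \<rightarrow> topspace (Xt S)" "\<theta>' \<in> topspace (Xt X) \<rightarrow> topspace (Xt S)"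
    using assms(3,4) by (auto simp: PiE_def)
  have "e (\<theta> x) = e (\<theta>' x)"
    using dual_e[OF assms(1) m(1) x] dual_e[OF assms(2) m(2) x] by simp
  then show "\<theta> x = \<theta>' x"
    using A.e_inj[of "\<theta> x" "\<theta>' x"] m x by auto
qed

lemma dual_unique_hom:
  assumes "dual_morphisms A e X d f \<theta>" "dual_morphisms A e X d f' \<theta>"
    and "f \<in> carrier A \<rightarrow>\<^sub>E carrier B" "f' \<in> carrier A \<rightarrow>\<^sub>E carrier B"
  shows "f = f'"
proof (rule PiE_ext[OF assms(3,4)])
  fix a assume a: "a \<in> carrier A"
  then have "extent X d (f a) = extent X d (f' a)"
    using assms(1,2) unfolding dual_morphisms_def extent_def by auto
  then show "f a = f' a"
    using B.extent_inj[of "f a" "f' a"] assms(3,4) a by auto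
qed

end

lemma dual_morphisms_Ident:
  "dual_morphisms A e S e (restrict id (carrier A)) (restrict id (topspace (Xt S)))"
  unfolding dual_morphisms_def by simp

lemma dual_morphisms_compose:
  assumes "dual_morphisms A e X d f \<theta>" "dual_morphisms B d Y c g \<phi>"
    and "f \<in> carrier A \<rightarrow> carrier B" "\<phi> \<in> topspace (Xt Y) \<rightarrow> topspace (Xt X)"
  shows "dual_morphisms A e Y c (compose (carrier A) g f) (compose (topspace (Xt Y)) \<theta> \<phi>)"
proof -
  have "f a \<in> carrier B" if "a \<in> carrier A" for a
    using assms(3) that by auto
  moreover have "\<phi> x \<in> topspace (Xt X)" if "x \<in> topspace (Xt Y)" for x
    using assms(4) that by auto
  ultimately show ?thesis
    using assms(1,2) unfolding dual_morphisms_def by (simp add: compose_eq)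
qed


section \<open>Existence of dual spaces and dual algebras\<close>

text \<open>The point set is an arbitrary bijective copy of the set of t-clans, because the points
  must come from the type \<open>'b\<close>.\<close>

locale clan_space = dca A for A :: "'a dca" +
  fixes X :: "'b set" and e :: "'b \<Rightarrow> 'a set"
  assumes bij_clans: "bij_betw e X {\<Gamma>. t_clan A \<Gamma>}"
begin

definition pts :: "'a \<Rightarrow> 'b set" where
  "pts a = {x \<in> X. a \<in> e x}"

text \<open>The topology with the sets \<open>pts a\<close> as closed base. Their complements form
  an open base because \<open>pts\<close> turns joins into unions.\<close>

definition space_topology :: "'b topology" where
  "space_topology =
    topology (\<lambda>U. U \<subseteq> X \<and> (\<forall>x \<in> U. \<exists>a \<in> carrier A. x \<notin> pts a \<and> X - pts a \<subseteq> U))"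

definition dual_space :: "'b dms" where
  "dual_space = \<lparr>Xt = space_topology, Xs = {x \<in> X. s_clan A (e x)},
     Tm = {x \<in> X. cluster A (e x)}, prec = (\<lambda>x y. linked (Pre A) (e x) (e y)),
     alg = pts ` carrier A\<rparr>"

lemma dual_space_sel [simp]:
  "Xt dual_space = space_topology" "Xs dual_space = {x \<in> X. s_clan A (e x)}"
  "Tm dual_space = {x \<in> X. cluster A (e x)}"
  "prec dual_space = (\<lambda>x y. linked (Pre A) (e x) (e y))" "alg dual_space = pts ` carrier A"
  by (simp_all add: dual_space_def)

lemma e_clan: "x \<in> X \<Longrightarrow> clan A (Ct A) (e x)"
  using bij_betw_apply[OF bij_clans, of x] by (simp add: t_clan_def)

lemma clan_point:
  assumes "t_clan A \<Gamma>"
  obtains x where "x \<in> X" "e x = \<Gamma>"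
  using assms bij_clans unfolding bij_betw_def by (metis imageE mem_Collect_eq)

lemma pts_subset: "pts a \<subseteq> X"
  by (auto simp: pts_def)

lemma pts_join: "\<lbrakk>a \<in> carrier A; b \<in> carrier A\<rbrakk> \<Longrightarrow> pts (join A a b) = pts a \<union> pts b"
  by (auto simp: pts_def clan_join[OF e_clan])

lemma pts_bzero: "pts (bzero A) = {}"
  by (auto simp: pts_def clan_bzero[OF e_clan])

lemma pts_bone: "pts (bone A) = X"
  by (auto simp: pts_def clan_bone[OF e_clan])

text \<open>Choosing an ultrafilter containing the complement of \<open>a\<close> gives an s-clan;
  this is why nonempty regular closed sets will meet \<open>Xs\<close>.\<close>

lemma point_avoiding:
  assumes "a \<in> carrier A" "a \<noteq> bone A"
  obtains x where "x \<in> X" "x \<notin> pts a" "s_clan A (e x)"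
proof -
  have "neg A a \<in> carrier A" "neg A a \<noteq> bzero A"
    using assms neg_closed neg_eq_bzero by auto
  then obtain U where U: "ultrafilter U" "neg A a \<in> U"
    by (rule ultrafilter_nonzero)
  then have s: "s_clan A U"
    unfolding s_clan_def using clan_ultrafilter[OF contact_Cs] by simp
  obtain x where x: "x \<in> X" "e x = U"
    using clan_point[OF s_clan_imp_t_clan[OF s]] by metis
  moreover have "x \<notin> pts a"
    using x U ultrafilter_neg[OF U(1) assms(1)] by (simp add: pts_def)
  ultimately show thesis
    using that s by simp
qed

lemma istopology_space:
  "istopology (\<lambda>U. U \<subseteq> X \<and> (\<forall>x \<in> U. \<exists>a \<in> carrier A. x \<notin> pts a \<and> X - pts a \<subseteq> U))"
  unfolding istopology_def
proof (intro conjI allI impI)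
  fix U V
  assume U: "U \<subseteq> X \<and> (\<forall>x \<in> U. \<exists>a \<in> carrier A. x \<notin> pts a \<and> X - pts a \<subseteq> U)"
    and V: "V \<subseteq> X \<and> (\<forall>x \<in> V. \<exists>a \<in> carrier A. x \<notin> pts a \<and> X - pts a \<subseteq> V)"
  show "U \<inter> V \<subseteq> X"
    using U by auto
  show "\<forall>x \<in> U \<inter> V. \<exists>a \<in> carrier A. x \<notin> pts a \<and> X - pts a \<subseteq> U \<inter> V"
  proof
    fix x assume "x \<in> U \<inter> V"
    then obtain a b where ab: "a \<in> carrier A" "x \<notin> pts a" "X - pts a \<subseteq> U"
      "b \<in> carrier A" "x \<notin> pts b" "X - pts b \<subseteq> V"
      using U V by (metis IntD1 IntD2)
    then show "\<exists>a \<in> carrier A. x \<notin> pts a \<and> X - pts a \<subseteq> U \<inter> V"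
      by (intro bexI[of _ "join A a b"]) (auto simp: pts_join join_closed)
  qed
next
  fix K
  assume K: "\<forall>U \<in> K. U \<subseteq> X \<and> (\<forall>x \<in> U. \<exists>a \<in> carrier A. x \<notin> pts a \<and> X - pts a \<subseteq> U)"
  then show "\<Union>K \<subseteq> X"
    by auto
  show "\<forall>x \<in> \<Union>K. \<exists>a \<in> carrier A. x \<notin> pts a \<and> X - pts a \<subseteq> \<Union>K"
  proof
    fix x assume "x \<in> \<Union>K"
    then obtain U where U: "U \<in> K" "x \<in> U"
      by auto
    then obtain a where "a \<in> carrier A" "x \<notin> pts a" "X - pts a \<subseteq> U"
      using K by metis
    with U show "\<exists>a \<in> carrier A. x \<notin> pts a \<and> X - pts a \<subseteq> \<Union>K"
      by (intro bexI[of _ a]) auto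
  qed
qed

lemma openin_space:
  "openin space_topology U \<longleftrightarrow>
    U \<subseteq> X \<and> (\<forall>x \<in> U. \<exists>a \<in> carrier A. x \<notin> pts a \<and> X - pts a \<subseteq> U)"
  unfolding space_topology_def topology_inverse'[OF istopology_space] ..

lemma openin_compl_pts: "a \<in> carrier A \<Longrightarrow> openin space_topology (X - pts a)"
  unfolding openin_space by auto

lemma topspace_space [simp]: "topspace space_topology = X"
proof -
  have "openin space_topology X"
    using openin_compl_pts[OF bzero_closed] by (simp add: pts_bzero)
  moreover have "topspace space_topology \<subseteq> X"
    using openin_space[THEN iffD1, OF openin_topspace] by simp
  ultimately show ?thesis
    using openin_subset by auto
qed

lemma closedin_pts: "a \<in> carrier A \<Longrightarrow> closedin space_topology (pts a)"
  unfolding closedin_def using openin_compl_pts pts_subset by simp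

text \<open>The key computation relating topology and algebra. If a basic neighbourhood, the
  complement of \<open>pts b\<close>, missed the complement of \<open>pts a\<close>, then
  \<open>a + b\<close> would be the unit, so \<open>b\<close> would lie above the complement of
  \<open>a\<close> and belong to the clan of \<open>x\<close>.\<close>

lemma closure_compl_pts:
  assumes a: "a \<in> carrier A"
  shows "space_topology closure_of (X - pts a) = pts (neg A a)"
proof
  have "x \<in> pts (neg A a)" if "x \<in> X - pts a" for x
    using that clan_neg[OF e_clan a, of x] by (simp add: pts_def)
  then show "space_topology closure_of (X - pts a) \<subseteq> pts (neg A a)"
    by (intro closure_of_minimal closedin_pts neg_closed a) auto
  show "pts (neg A a) \<subseteq> space_topology closure_of (X - pts a)"
  proof
    fix x assume x: "x \<in> pts (neg A a)"
    have "\<exists>y \<in> X - pts a. y \<in> U" if U: "x \<in> U" "openin space_topology U" for U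
    proof -
      obtain b where b: "b \<in> carrier A" "x \<notin> pts b" "X - pts b \<subseteq> U"
        using U openin_space by metis
      have xX: "x \<in> X"
        using x pts_subset by auto
      have "join A a b \<noteq> bone A"
      proof
        assume "join A a b = bone A"
        then have "le A (neg A a) b"
          using neg_le_iff a b by auto
        then have "b \<in> e x"
          using clan_le[OF e_clan[OF xX], of "neg A a" b] x b by (simp add: pts_def)
        then show False
          using b xX by (simp add: pts_def)
      qed
      then obtain y where "y \<in> X" "y \<notin> pts (join A a b)"
        using point_avoiding[OF join_closed[OF a b(1)]] by metis
      then have "y \<in> X - pts a" "y \<in> U"
        using a b pts_join by auto
      then show ?thesis
        by auto
    qed
    moreover have "x \<in> topspace space_topology"
      using x pts_subset by auto
    ultimately show "x \<in> space_topology closure_of (X - pts a)"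
      unfolding in_closure_of by blast
  qed
qed

lemma interior_pts:
  assumes "a \<in> carrier A"
  shows "space_topology interior_of pts a = X - pts (neg A a)"
  unfolding interior_of_closure_of using closure_compl_pts[OF assms] by simp

lemma rc_neg_pts: "a \<in> carrier A \<Longrightarrow> rc_neg space_topology (pts a) = pts (neg A a)"
  unfolding rc_neg_def by (simp add: closure_compl_pts)

lemma regular_closedin_pts: "a \<in> carrier A \<Longrightarrow> regular_closedin space_topology (pts a)"
  unfolding regular_closedin_def by (simp add: interior_pts closure_compl_pts neg_closed neg_neg)

lemma rc_meet_pts:
  assumes "a \<in> carrier A" "b \<in> carrier A"
  shows "rc_meet space_topology (pts a) (pts b) = pts (meet A a b)"
proof -
  have "space_topology interior_of (pts a \<inter> pts b) = X - pts (join A (neg A a) (neg A b))"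
    using assms by (auto simp: interior_of_Int interior_pts pts_join neg_closed)
  then show ?thesis
    unfolding rc_meet_def
    using assms by (simp add: closure_compl_pts join_closed neg_closed neg_join_neg)
qed

lemma boolean_hom_pts: "boolean_hom A (dual_algebra dual_space) pts"
  unfolding boolean_hom_def
  by (auto simp: dual_algebra_def pts_join rc_meet_pts rc_neg_pts pts_bzero pts_bone)

lemma extent_dual_space: "extent dual_space e = pts"
  by (simp add: fun_eq_iff extent_def pts_def)

lemma duality_dual_space: "duality A dual_space e"
  by unfold_locales (simp_all add: bij_clans extent_dual_space boolean_hom_pts)

sublocale duality A dual_space e
  by (rule duality_dual_space)

text \<open>Each relation is recovered from its own kind of witness: s-clans for \<open>Cs\<close>,
  t-clans for \<open>Ct\<close>, and clusters for \<open>Pre\<close>.\<close>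

lemma dca_iso_pts: "dca_iso A (dual_algebra dual_space) pts"
proof
  show "boolean_hom A (dual_algebra dual_space) pts"
    by (rule boolean_hom_pts)
  have "inj_on pts (carrier A)"
    by (rule inj_onI) (simp add: extent_inj extent_dual_space)
  then show "bij_betw pts (carrier A) (carrier (dual_algebra dual_space))"
    by (simp add: bij_betw_def dual_algebra_def)
  fix a b assume ab: "a \<in> carrier A" "b \<in> carrier A"
  show "Cs (dual_algebra dual_space) (pts a) (pts b) \<longleftrightarrow> Cs A a b"
  proof
    assume "Cs (dual_algebra dual_space) (pts a) (pts b)"
    then obtain x where "s_clan A (e x)" "a \<in> e x" "b \<in> e x"
      by (auto simp: dual_algebra_def pts_def)
    then show "Cs A a b"
      using clan_related[of A "Cs A" "e x" a b] by (simp add: s_clan_def)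
  next
    assume "Cs A a b"
    then obtain \<Gamma> where \<Gamma>: "clan A (Cs A) \<Gamma>" "a \<in> \<Gamma>" "b \<in> \<Gamma>"
      using clan_of_related[OF contact_Cs ab] by metis
    then have s: "s_clan A \<Gamma>"
      by (simp add: s_clan_def)
    obtain x where "x \<in> X" "e x = \<Gamma>"
      using clan_point[OF s_clan_imp_t_clan[OF s]] by metis
    then show "Cs (dual_algebra dual_space) (pts a) (pts b)"
      using s \<Gamma> by (auto simp: dual_algebra_def pts_def)
  qed
  show "Ct (dual_algebra dual_space) (pts a) (pts b) \<longleftrightarrow> Ct A a b"
  proof
    assume "Ct (dual_algebra dual_space) (pts a) (pts b)"
    then obtain x where "x \<in> X" "a \<in> e x" "b \<in> e x"
      by (auto simp: dual_algebra_def pts_def)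
    then show "Ct A a b"
      using clan_related[OF e_clan, of x a b] by simp
  next
    assume "Ct A a b"
    then obtain \<Gamma> where \<Gamma>: "clan A (Ct A) \<Gamma>" "a \<in> \<Gamma>" "b \<in> \<Gamma>"
      using clan_of_related[OF contact_Ct ab] by metis
    obtain x where "x \<in> X" "e x = \<Gamma>"
      using clan_point[of \<Gamma>] \<Gamma>(1) unfolding t_clan_def by metis
    then show "Ct (dual_algebra dual_space) (pts a) (pts b)"
      using \<Gamma> by (auto simp: dual_algebra_def pts_def)
  qed
  show "Pre (dual_algebra dual_space) (pts a) (pts b) \<longleftrightarrow> Pre A a b"
  proof
    assume "Pre (dual_algebra dual_space) (pts a) (pts b)"
    then show "Pre A a b"
      by (auto simp: dual_algebra_def pts_def linked_def)
  next
    assume "Pre A a b"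
    then obtain \<Gamma> \<Delta> where \<Gamma>: "cluster A \<Gamma>" "a \<in> \<Gamma>" and \<Delta>: "cluster A \<Delta>" "b \<in> \<Delta>"
      and l: "linked (Pre A) \<Gamma> \<Delta>"
      using Pre_in_clusters[OF ab] by metis
    obtain x y where "x \<in> X" "e x = \<Gamma>" "y \<in> X" "e y = \<Delta>"
      using clan_point[of \<Gamma>] clan_point[of \<Delta>] \<Gamma>(1) \<Delta>(1) unfolding cluster_def by metis
    then show "Pre (dual_algebra dual_space) (pts a) (pts b)"
      using \<Gamma> \<Delta> l by (auto simp: dual_algebra_def pts_def)
  qed
qed

interpretation iso: dca_iso A "dual_algebra dual_space" pts
  by (rule dca_iso_pts)

lemma rho_dual_space:
  assumes "x \<in> X"
  shows "rho dual_space x = pts ` e x"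
proof -
  have "x \<in> pts a \<longleftrightarrow> a \<in> e x" for a
    using assms by (simp add: pts_def)
  then show ?thesis
    using clan_in_carrier[OF e_clan[OF assms]] unfolding rho_def by auto
qed

lemma dms_dual_space: "dms dual_space"
proof (rule dms.intro)
  \<comment> \<open>One ultrafilter settles all nonemptiness claims: it is itself an s-clan, and it
    generates a cluster.\<close>
  obtain U where "ultrafilter U"
    using ultrafilter_nonzero[OF bone_closed] bzero_neq_bone by metis
  then have s: "s_clan A U" and c: "cluster A (cluster_of U)"
    using clan_ultrafilter[OF contact_Cs] cluster_cluster_of by (auto simp: s_clan_def)
  obtain x where "x \<in> X" "e x = U"
    using clan_point[OF s_clan_imp_t_clan[OF s]] by metis
  then show "topspace (Xt dual_space) \<noteq> {}" "Xs dual_space \<noteq> {}"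
    using s by auto
  obtain y where "y \<in> X" "e y = cluster_of U"
    using clan_point[of "cluster_of U"] c unfolding cluster_def by metis
  then show "Tm dual_space \<noteq> {}"
    using c by auto
  show "Xs dual_space \<subseteq> topspace (Xt dual_space)" "Tm dual_space \<subseteq> topspace (Xt dual_space)"
    by auto
  show "rc_subalgebra (Xt dual_space) (alg dual_space)"
    using bzero_closed bone_closed pts_bzero pts_bone
    unfolding rc_subalgebra_def
    by (auto simp: regular_closedin_pts rc_meet_pts rc_neg_pts meet_closed neg_closed join_closed
        simp flip: pts_join)
  show "closed_base (Xt dual_space) (alg dual_space)"
    unfolding closed_base_def
  proof (intro conjI ballI allI impI)
    fix F assume "closedin (Xt dual_space) F"
    then have F: "F \<subseteq> X" and o: "openin space_topology (X - F)"
      unfolding closedin_def by auto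
    show "\<exists>N \<subseteq> alg dual_space. F = topspace (Xt dual_space) \<inter> \<Inter>N"
    proof (intro exI[of _ "{P \<in> pts ` carrier A. F \<subseteq> P}"] conjI)
      have "x \<in> F" if x: "x \<in> X" "\<forall>P \<in> pts ` carrier A. F \<subseteq> P \<longrightarrow> x \<in> P" for x
      proof (rule ccontr)
        assume "x \<notin> F"
        then obtain a where "a \<in> carrier A" "x \<notin> pts a" "X - pts a \<subseteq> X - F"
          using x(1) o unfolding openin_space by (metis DiffI)
        then show False
          using x(2) F by blast
      qed
      then show "F = topspace (Xt dual_space) \<inter> \<Inter>{P \<in> pts ` carrier A. F \<subseteq> P}"
        using F by auto
    qed auto
  qed (auto simp: closedin_pts)
  show "F \<inter> Xs dual_space \<noteq> {}" if F: "regular_closedin (Xt dual_space) F" "F \<noteq> {}" for F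
  proof -
    let ?I = "space_topology interior_of F"
    \<comment> \<open>A nonempty regular closed set has nonempty interior, which contains a basic
      open set and therefore an s-clan.\<close>
    have "?I \<noteq> {}"
      using F unfolding regular_closedin_def by (metis closure_of_empty dual_space_sel(1))
    then obtain x where "x \<in> ?I"
      by auto
    then obtain a where a: "a \<in> carrier A" "x \<notin> pts a" "X - pts a \<subseteq> ?I"
      using openin_interior_of[of space_topology F] unfolding openin_space by metis
    have "x \<in> X"
      using \<open>x \<in> ?I\<close> interior_of_subset_topspace[of space_topology F] by auto
    then have "a \<noteq> bone A"
      using a pts_bone by auto
    then obtain y where "y \<in> X" "y \<notin> pts a" "s_clan A (e y)"
      using point_avoiding a(1) by metis
    then show ?thesis
      using a(3) interior_of_subset[of space_topology F] by auto
  qed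
  show "dca (dual_algebra dual_space)"
    by (rule iso.dca_image)
  show "cluster (dual_algebra dual_space) (rho dual_space x)" if "x \<in> Tm dual_space" for x
    using that iso.cluster_image_iff[of "e x"] clan_in_carrier[OF e_clan[of x]]
    by (auto simp: rho_dual_space)
  show "prec dual_space x y \<longleftrightarrow> (\<forall>a \<in> alg dual_space. \<forall>b \<in> alg dual_space.
      x \<in> a \<and> y \<in> b \<longrightarrow> Pre (dual_algebra dual_space) a b)"
    if "x \<in> topspace (Xt dual_space)" "y \<in> topspace (Xt dual_space)" for x y
  proof -
    have "x \<in> X" "y \<in> X" and "x \<in> pts a \<longleftrightarrow> a \<in> e x" "y \<in> pts a \<longleftrightarrow> a \<in> e y" for a
      using that by (auto simp: pts_def)
    then show ?thesis
      using clan_in_carrier[OF e_clan[of x]] clan_in_carrier[OF e_clan[of y]]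
      by (auto simp: iso.Pre_iff linked_def)
  qed
qed

lemma t0_dual_space: "t0_space (Xt dual_space)"
  unfolding t0_space_def
proof (intro ballI impI)
  fix x y assume "x \<in> topspace (Xt dual_space)" "y \<in> topspace (Xt dual_space)" "x \<noteq> y"
  then have xy: "x \<in> X" "y \<in> X" "e x \<noteq> e y"
    using e_inj[of x y] by auto
  then obtain a where a: "a \<in> e x \<longleftrightarrow> a \<notin> e y"
    by auto
  then have "a \<in> carrier A"
    using clan_in_carrier[OF e_clan[OF xy(1)]] clan_in_carrier[OF e_clan[OF xy(2)]] by auto
  from openin_compl_pts[OF this]
  show "\<exists>U. openin (Xt dual_space) U \<and> (x \<notin> U \<longleftrightarrow> y \<in> U)"
    using a xy by (intro exI[of _ "X - pts a"]) (auto simp: pts_def)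
qed

text \<open>A clan of the dual algebra is the image under \<open>pts\<close> of a clan of
  \<open>A\<close>, and every clan of \<open>A\<close> labels a point.\<close>

lemma dm_compact_dual_space: "dm_compact dual_space"
proof -
  let ?D = "dual_algebra dual_space"
  have pt: "\<exists>\<Gamma> x. x \<in> X \<and> e x = \<Gamma> \<and> \<Gamma> \<subseteq> carrier A \<and> \<Delta> = pts ` \<Gamma> \<and> \<Delta> = rho dual_space x"
    if \<Delta>: "t_clan ?D \<Delta>" for \<Delta>
  proof -
    have "\<Delta> \<subseteq> carrier ?D"
      using \<Delta> unfolding t_clan_def clan_def by simp
    then obtain \<Gamma> where \<Gamma>: "\<Gamma> \<subseteq> carrier A" "\<Delta> = pts ` \<Gamma>"
      by (rule iso.subset_carrier_image)
    then have "t_clan A \<Gamma>"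
      using \<Delta> iso.t_clan_image_iff by simp
    then obtain x where "x \<in> X" "e x = \<Gamma>"
      by (rule clan_point)
    then show ?thesis
      using \<Gamma> rho_dual_space[of x] by auto
  qed
  have "\<exists>x \<in> Xs dual_space. \<Delta> = rho dual_space x" if "s_clan ?D \<Delta>" for \<Delta>
    using pt[OF dca.s_clan_imp_t_clan[OF iso.dca_image that]] that iso.s_clan_image_iff by auto
  moreover have "\<exists>x \<in> Tm dual_space. \<Delta> = rho dual_space x" if "cluster ?D \<Delta>" for \<Delta>
    using pt[of \<Delta>] that iso.cluster_image_iff cluster_def[of ?D \<Delta>] by auto
  moreover have "\<exists>x \<in> topspace (Xt dual_space). \<Delta> = rho dual_space x" if "t_clan ?D \<Delta>" for \<Delta>
    using pt[OF that] by auto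
  ultimately show ?thesis
    unfolding dm_compact_def by simp
qed

lemma alg_dual_space_eqpoll: "carrier A \<approx> alg dual_space"
  using iso.bij unfolding eqpoll_def by (auto simp: dual_algebra_def)

end

section \<open>Spaces as duals of their own algebras\<close>

context dms
begin

lemma dual_algebra_sel:
  "carrier (dual_algebra S) = alg S" "join (dual_algebra S) = (\<union>)"
  "meet (dual_algebra S) = rc_meet (Xt S)" "neg (dual_algebra S) = rc_neg (Xt S)"
  "bzero (dual_algebra S) = {}" "bone (dual_algebra S) = topspace (Xt S)"
  by (simp_all add: dual_algebra_def)

lemma alg_closed:
  "a \<in> alg S \<Longrightarrow> a \<subseteq> topspace (Xt S)" "{} \<in> alg S" "topspace (Xt S) \<in> alg S"
  "\<lbrakk>a \<in> alg S; b \<in> alg S\<rbrakk> \<Longrightarrow> a \<union> b \<in> alg S"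
  "\<lbrakk>a \<in> alg S; b \<in> alg S\<rbrakk> \<Longrightarrow> rc_meet (Xt S) a b \<in> alg S"
  "a \<in> alg S \<Longrightarrow> rc_neg (Xt S) a \<in> alg S"
  using alg_subalgebra alg_closed_base closedin_subset[of "Xt S" a]
  unfolding rc_subalgebra_def closed_base_def by auto

lemma clan_rho:
  assumes x: "x \<in> topspace (Xt S)"
    and R: "\<And>a b. \<lbrakk>a \<in> alg S; b \<in> alg S; x \<in> a; x \<in> b\<rbrakk> \<Longrightarrow> R a b"
  shows "clan (dual_algebra S) R (rho S x)"
  unfolding clan_def rho_def le_def dual_algebra_sel using x R alg_closed(2,3) by auto

lemma extent_rho: "a \<in> alg S \<Longrightarrow> extent S (rho S) a = a"
  using alg_closed(1)[of a] unfolding extent_def rho_def by auto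

text \<open>The T0 property makes \<open>rho S\<close> injective and DM-compactness makes it
  surjective. For \<open>Xs\<close> and \<open>Tm\<close>, compactness gives a point of the subset
  with the same label, and injectivity identifies the two points.\<close>

lemma duality_rho:
  assumes t0: "t0_space (Xt S)" and compact: "dm_compact S"
  shows "duality (dual_algebra S) S (rho S)"
proof (rule duality.intro[OF dca_dual_algebra duality_axioms.intro])
  have t: "t_clan (dual_algebra S) (rho S x)" if "x \<in> topspace (Xt S)" for x
    unfolding t_clan_def by (rule clan_rho[OF that]) (auto simp: dual_algebra_def)
  have s: "s_clan (dual_algebra S) (rho S x)" if "x \<in> Xs S" for x
    unfolding s_clan_def using that Xs_subset by (intro clan_rho) (auto simp: dual_algebra_def)
  note inj = inj_on_rho[OF t0]
  show "bij_betw (rho S) (topspace (Xt S)) {\<Gamma>. t_clan (dual_algebra S) \<Gamma>}"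
    using inj t compact unfolding bij_betw_def dm_compact_def by auto
  show "Xs S = {x \<in> topspace (Xt S). s_clan (dual_algebra S) (rho S x)}"
  proof
    show "Xs S \<subseteq> {x \<in> topspace (Xt S). s_clan (dual_algebra S) (rho S x)}"
      using s Xs_subset by auto
    show "{x \<in> topspace (Xt S). s_clan (dual_algebra S) (rho S x)} \<subseteq> Xs S"
    proof
      fix x assume x: "x \<in> {x \<in> topspace (Xt S). s_clan (dual_algebra S) (rho S x)}"
      then obtain y where y: "y \<in> Xs S" "rho S x = rho S y"
        using compact unfolding dm_compact_def by auto
      then show "x \<in> Xs S"
        using inj_onD[OF inj, of x y] x Xs_subset by auto
    qed
  qed
  show "Tm S = {x \<in> topspace (Xt S). cluster (dual_algebra S) (rho S x)}"
  proof
    show "Tm S \<subseteq> {x \<in> topspace (Xt S). cluster (dual_algebra S) (rho S x)}"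
      using cluster_rho Tm_subset by auto
    show "{x \<in> topspace (Xt S). cluster (dual_algebra S) (rho S x)} \<subseteq> Tm S"
    proof
      fix x assume x: "x \<in> {x \<in> topspace (Xt S). cluster (dual_algebra S) (rho S x)}"
      then obtain y where y: "y \<in> Tm S" "rho S x = rho S y"
        using compact unfolding dm_compact_def by auto
      then show "x \<in> Tm S"
        using inj_onD[OF inj, of x y] x Tm_subset by auto
    qed
  qed
  show "prec S x y \<longleftrightarrow> linked (Pre (dual_algebra S)) (rho S x) (rho S y)"
    if "x \<in> topspace (Xt S)" "y \<in> topspace (Xt S)" for x y
    using prec_iff[OF that] by (auto simp: linked_def rho_def)
  show "alg S = extent S (rho S) ` carrier (dual_algebra S)"
    by (simp add: dual_algebra_sel extent_rho)
  show "boolean_hom (dual_algebra S) (dual_algebra S) (extent S (rho S))"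
    unfolding boolean_hom_def dual_algebra_sel by (simp add: extent_rho alg_closed)
qed

end

text \<open>Only the labels of the points change; the extent of \<open>h a\<close> under the new
  labels is that of \<open>a\<close> under the old ones.\<close>

lemma (in dca_iso) duality_image:
  assumes "duality A S e"
  shows "duality B S (\<lambda>x. h ` e x)"
proof (rule duality.intro[OF dca_image duality_axioms.intro])
  interpret d: duality A S e
    by (rule assms)
  have "inj_on (\<lambda>x. h ` e x) (topspace (Xt S))"
  proof (rule inj_onI)
    fix x y assume xy: "x \<in> topspace (Xt S)" "y \<in> topspace (Xt S)" "h ` e x = h ` e y"
    then have "e x = e y"
      using inj_on_image_eq_iff[of h "carrier A" "e x" "e y"] bij d.e_subset
      by (simp add: bij_betw_def)
    then show "x = y"
      using d.e_inj xy by simp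
  qed
  moreover have "\<Delta> \<in> (\<lambda>x. h ` e x) ` topspace (Xt S)" if \<Delta>: "t_clan B \<Delta>" for \<Delta>
  proof -
    obtain \<Gamma> where \<Gamma>: "\<Gamma> \<subseteq> carrier A" "\<Delta> = h ` \<Gamma>"
      using subset_carrier_image[of \<Delta>] \<Delta> unfolding t_clan_def clan_def by metis
    then have "t_clan A \<Gamma>"
      using \<Delta> t_clan_image_iff by simp
    then show ?thesis
      unfolding image_iff using d.obtain_point \<Gamma>(2) by metis
  qed
  ultimately show "bij_betw (\<lambda>x. h ` e x) (topspace (Xt S)) {\<Gamma>. t_clan B \<Gamma>}"
    using d.e_t_clan d.e_subset t_clan_image_iff unfolding bij_betw_def by auto
  show "Xs S = {x \<in> topspace (Xt S). s_clan B (h ` e x)}"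
    using d.Xs_eq d.e_subset s_clan_image_iff by auto
  show "Tm S = {x \<in> topspace (Xt S). cluster B (h ` e x)}"
    using d.Tm_eq d.e_subset cluster_image_iff by auto
  show "prec S x y \<longleftrightarrow> linked (Pre B) (h ` e x) (h ` e y)"
    if "x \<in> topspace (Xt S)" "y \<in> topspace (Xt S)" for x y
    using d.prec_linked[OF that] Pre_iff subsetD[OF d.e_subset[OF that(1)]]
      subsetD[OF d.e_subset[OF that(2)]] by (simp add: linked_def)
  have ext: "extent S (\<lambda>x. h ` e x) (h a) = extent S e a" if "a \<in> carrier A" for a
  proof -
    have "h a \<in> h ` e x \<longleftrightarrow> a \<in> e x" if x: "x \<in> topspace (Xt S)" for x
      using d.e_subset[OF x] h_eq_iff[OF \<open>a \<in> carrier A\<close>] by auto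
    then show ?thesis
      unfolding extent_def by auto
  qed
  then show "alg S = extent S (\<lambda>x. h ` e x) ` carrier B"
    using d.alg_image by (simp add: carrier_image image_image)
  show "boolean_hom B (dual_algebra S) (extent S (\<lambda>x. h ` e x))"
    by (rule boolean_hom_factor[OF boolean_alg_axioms hom carrier_image d.hom_extent ext])
qed

text \<open>Carries the dual algebra of a space, whose elements are sets of points, to the element
  type of the algebras. Here \<open>k\<close> inverts \<open>h\<close> on the carrier.\<close>

definition dca_copy :: "'a dca \<Rightarrow> ('a \<Rightarrow> 'b) \<Rightarrow> 'b dca" where
  "dca_copy A h =
     (let k = inv_into (carrier A) h in
      \<lparr>carrier = h ` carrier A, join = (\<lambda>x y. h (join A (k x) (k y))),
       meet = (\<lambda>x y. h (meet A (k x) (k y))), neg = (\<lambda>x. h (neg A (k x))),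
       bzero = h (bzero A), bone = h (bone A), Cs = (\<lambda>x y. Cs A (k x) (k y)),
       Ct = (\<lambda>x y. Ct A (k x) (k y)), Pre = (\<lambda>x y. Pre A (k x) (k y))\<rparr>)"

lemma (in dca) dca_iso_copy:
  assumes "inj_on h (carrier A)"
  shows "dca_iso A (dca_copy A h) h"
proof
  show "boolean_hom A (dca_copy A h) h"
    unfolding boolean_hom_def dca_copy_def Let_def by (auto simp: inv_into_f_f[OF assms])
  show "bij_betw h (carrier A) (carrier (dca_copy A h))"
    using assms by (simp add: bij_betw_def dca_copy_def Let_def)
qed (simp_all add: dca_copy_def Let_def inv_into_f_f[OF assms])

lemma carrier_dca_copy [simp]: "carrier (dca_copy A h) = h ` carrier A"
  by (simp add: dca_copy_def Let_def)


section \<open>Fully faithful and essentially surjective functors\<close>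

lemma opposite_sel [simp]:
  "Ob (opposite C) = Ob C" "Hom (opposite C) x y = Hom C y x"
  "Comp (opposite C) x y z g f = Comp C z y x f g" "Ident (opposite C) x = Ident C x"
  by (simp_all add: opposite_def)

lemma full_subcategory_sel [simp]:
  "Ob (full_subcategory C P) = {x \<in> Ob C. P x}" "Hom (full_subcategory C P) = Hom C"
  "Comp (full_subcategory C P) = Comp C" "Ident (full_subcategory C P) = Ident C"
  by (simp_all add: full_subcategory_def)

lemma category_opposite:
  assumes "category C"
  shows "category (opposite C)"
proof -
  interpret category C by (rule assms)
  show ?thesis
    by unfold_locales
      (simp_all add: Ident_in_Hom Comp_in_Hom Comp_Ident_right Comp_Ident_left Comp_assoc)
qed

lemma category_full_subcategory:
  assumes "category C"
  shows "category (full_subcategory C P)"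
proof -
  interpret category C by (rule assms)
  show ?thesis
    by unfold_locales
      (simp_all add: Ident_in_Hom Comp_in_Hom Comp_Ident_right Comp_Ident_left Comp_assoc)
qed

text \<open>A quasi-inverse \<open>G\<close> is obtained by choosing isomorphisms \<open>\<epsilon> d : F (G d) \<rightarrow> d\<close> with inverses
  \<open>\<delta> d\<close> and lifting \<open>\<delta> d' \<circ> h \<circ> \<epsilon> d\<close> along \<open>F\<close>.\<close>

lemma equivalent_categoriesI:
  fixes C :: "('o, 'm) cat" and D :: "('p, 'n) cat"
  assumes C: "category C" and D: "category D" and F: "is_functor C D F"
    and full_faithful: "\<And>x y. \<lbrakk>x \<in> Ob C; y \<in> Ob C\<rbrakk>
      \<Longrightarrow> bij_betw (fmor F x y) (Hom C x y) (Hom D (fobj F x) (fobj F y))"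
    and ess_surj: "\<And>d. d \<in> Ob D \<Longrightarrow> \<exists>x \<in> Ob C. \<exists>f. isomorphism D (fobj F x) d f"
  shows "equivalent_categories C D"
proof -
  interpret C: category C by (rule C)
  interpret D: category D by (rule D)
  interpret F: is_functor C D F by (rule F)
  have "\<forall>d. \<exists>x f g. d \<in> Ob D \<longrightarrow> x \<in> Ob C \<and> f \<in> Hom D (fobj F x) d \<and> g \<in> Hom D d (fobj F x) \<and>
      Comp D (fobj F x) d (fobj F x) g f = Ident D (fobj F x) \<and>
      Comp D d (fobj F x) d f g = Ident D d"
    using ess_surj unfolding isomorphism_def by metis
  then obtain G \<epsilon> \<delta> where G: "\<And>d. d \<in> Ob D \<Longrightarrow> G d \<in> Ob C"
    and \<epsilon>: "\<And>d. d \<in> Ob D \<Longrightarrow> \<epsilon> d \<in> Hom D (fobj F (G d)) d"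
    and \<delta>: "\<And>d. d \<in> Ob D \<Longrightarrow> \<delta> d \<in> Hom D d (fobj F (G d))"
    and \<delta>\<epsilon>: "\<And>d. d \<in> Ob D \<Longrightarrow>
      Comp D (fobj F (G d)) d (fobj F (G d)) (\<delta> d) (\<epsilon> d) = Ident D (fobj F (G d))"
    and \<epsilon>\<delta>: "\<And>d. d \<in> Ob D \<Longrightarrow> Comp D d (fobj F (G d)) d (\<epsilon> d) (\<delta> d) = Ident D d"
    by metis
  have "\<forall>x y k. \<exists>f. x \<in> Ob C \<longrightarrow> y \<in> Ob C \<longrightarrow> k \<in> Hom D (fobj F x) (fobj F y) \<longrightarrow>
      f \<in> Hom C x y \<and> fmor F x y f = k"
    using full_faithful unfolding bij_betw_def by (metis imageE)
  then obtain lift where lift: "\<And>x y k. \<lbrakk>x \<in> Ob C; y \<in> Ob C; k \<in> Hom D (fobj F x) (fobj F y)\<rbrakk>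
      \<Longrightarrow> lift x y k \<in> Hom C x y"
    and F_lift: "\<And>x y k. \<lbrakk>x \<in> Ob C; y \<in> Ob C; k \<in> Hom D (fobj F x) (fobj F y)\<rbrakk>
      \<Longrightarrow> fmor F x y (lift x y k) = k"
    by metis
  \<comment> \<open>Faithfulness: equations in \<open>C\<close> are checked after applying
    \<open>F\<close>.\<close>
  have eqI: "f = f'" if "fmor F x y f = fmor F x y f'" "x \<in> Ob C" "y \<in> Ob C"
      "f \<in> Hom C x y" "f' \<in> Hom C x y" for x y f f'
    using full_faithful[of x y] that unfolding bij_betw_def by (metis inj_onD)
  \<comment> \<open>Composites are bracketed to the right. This can hide the pair
    \<open>\<epsilon> \<circ> \<delta>\<close> inside a longer composite, which
    \<open>cancel_\<epsilon>\<close> accounts for.\<close>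
  have D_assoc: "Comp D w x z (Comp D x y z h g) f = Comp D w y z h (Comp D w x y g f)"
    if "w \<in> Ob D" "x \<in> Ob D" "y \<in> Ob D" "z \<in> Ob D" "f \<in> Hom D w x" "g \<in> Hom D x y"
      "h \<in> Hom D y z" for w x y z f g h
    using D.Comp_assoc that by simp
  have cancel_\<epsilon>: "Comp D x (fobj F (G d)) d (\<epsilon> d) (Comp D x d (fobj F (G d)) (\<delta> d) f) = f"
    if "x \<in> Ob D" "d \<in> Ob D" "f \<in> Hom D x d" for x d f
    using D.Comp_assoc[of x d "fobj F (G d)" d f "\<delta> d" "\<epsilon> d"] that
    by (simp add: F.fobj_in_Ob G \<delta> \<epsilon> \<epsilon>\<delta> D.Comp_Ident_left)
  note [simp] = F.fobj_in_Ob F.fmor_in_Hom F.fmor_Ident F.fmor_Comp G \<epsilon> \<delta> \<epsilon>\<delta> \<delta>\<epsilon> lift F_lift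
    cancel_\<epsilon> C.Ident_in_Hom C.Comp_in_Hom D.Ident_in_Hom D.Comp_in_Hom
    C.Comp_Ident_left C.Comp_Ident_right D.Comp_Ident_left D.Comp_Ident_right D_assoc
  define Gm where "Gm d d' h = lift (G d) (G d')
      (Comp D (fobj F (G d)) d' (fobj F (G d')) (\<delta> d') (Comp D (fobj F (G d)) d d' h (\<epsilon> d)))" for d d' h
  define GG where "GG = \<lparr>fobj = G, fmor = Gm\<rparr>"
  define \<eta> where "\<eta> x = lift x (G (fobj F x)) (\<delta> (fobj F x))" for x
  have Gm: "Gm d d' h \<in> Hom C (G d) (G d')"
    and F_Gm: "fmor F (G d) (G d') (Gm d d' h) =
      Comp D (fobj F (G d)) d' (fobj F (G d')) (\<delta> d') (Comp D (fobj F (G d)) d d' h (\<epsilon> d))"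
    if "d \<in> Ob D" "d' \<in> Ob D" "h \<in> Hom D d d'" for d d' h
    using that unfolding Gm_def by simp_all
  note [simp] = Gm F_Gm
  have GG: "is_functor D C GG"
  proof
    show "fobj GG d \<in> Ob C" if "d \<in> Ob D" for d
      using that by (simp add: GG_def)
    show "fmor GG d d' h \<in> Hom C (fobj GG d) (fobj GG d')"
      if "d \<in> Ob D" "d' \<in> Ob D" "h \<in> Hom D d d'" for d d' h
      using that by (simp add: GG_def)
    show "fmor GG d d (Ident D d) = Ident C (fobj GG d)" if "d \<in> Ob D" for d
      using that unfolding GG_def func.simps by (intro eqI[of "G d" "G d"]) simp_all
    show "fmor GG d d'' (Comp D d d' d'' h' h) =
        Comp C (fobj GG d) (fobj GG d') (fobj GG d'') (fmor GG d' d'' h') (fmor GG d d' h)"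
      if "d \<in> Ob D" "d' \<in> Ob D" "d'' \<in> Ob D" "h \<in> Hom D d d'" "h' \<in> Hom D d' d''" for d d' d'' h h'
      using that unfolding GG_def func.simps by (intro eqI[of "G d" "G d''"]) simp_all
  qed
  have \<eta>: "\<eta> x \<in> Hom C x (G (fobj F x))" "fmor F x (G (fobj F x)) (\<eta> x) = \<delta> (fobj F x)"
    if "x \<in> Ob C" for x
    using that unfolding \<eta>_def by simp_all
  have "natural_isomorphism C C id_func (comp_func GG F) \<eta>"
    unfolding natural_isomorphism_def isomorphism_def id_func_def comp_func_def GG_def func.simps
  proof (intro conjI ballI)
    fix x assume x: "x \<in> Ob C"
    show "\<eta> x \<in> Hom C x (G (fobj F x))"
      using x by (simp add: \<eta>)
    \<comment> \<open>Since \<open>\<eta> x\<close> is lifted from \<open>\<delta>\<close>, its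
      inverse is lifted from \<open>\<epsilon>\<close>.\<close>
    let ?\<theta> = "lift (G (fobj F x)) x (\<epsilon> (fobj F x))"
    show "\<exists>g \<in> Hom C (G (fobj F x)) x. Comp C x (G (fobj F x)) x g (\<eta> x) = Ident C x \<and>
        Comp C (G (fobj F x)) x (G (fobj F x)) (\<eta> x) g = Ident C (G (fobj F x))"
    proof (intro bexI[of _ ?\<theta>] conjI)
      show "Comp C x (G (fobj F x)) x ?\<theta> (\<eta> x) = Ident C x"
        using x \<eta>[OF x] by (intro eqI[of x x]) simp_all
      show "Comp C (G (fobj F x)) x (G (fobj F x)) (\<eta> x) ?\<theta> = Ident C (G (fobj F x))"
        using x \<eta>[OF x] by (intro eqI[of "G (fobj F x)" "G (fobj F x)"]) simp_all
    qed (use x in simp)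
  next
    fix x y f assume x: "x \<in> Ob C" and y: "y \<in> Ob C" and f: "f \<in> Hom C x y"
    then show "Comp C x y (G (fobj F y)) (\<eta> y) f =
        Comp C x (G (fobj F x)) (G (fobj F y)) (Gm (fobj F x) (fobj F y) (fmor F x y f)) (\<eta> x)"
      using \<eta>[OF x] \<eta>[OF y] by (intro eqI[of x "G (fobj F y)"]) simp_all
  qed
  moreover have "natural_isomorphism D D (comp_func F GG) id_func \<epsilon>"
    unfolding natural_isomorphism_def isomorphism_def id_func_def comp_func_def GG_def func.simps
  proof (intro conjI ballI)
    fix d assume d: "d \<in> Ob D"
    then show "\<epsilon> d \<in> Hom D (fobj F (G d)) d"
      by simp
    show "\<exists>g \<in> Hom D d (fobj F (G d)). Comp D (fobj F (G d)) d (fobj F (G d)) g (\<epsilon> d) =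
        Ident D (fobj F (G d)) \<and> Comp D d (fobj F (G d)) d (\<epsilon> d) g = Ident D d"
      using d by (intro bexI[of _ "\<delta> d"]) simp_all
  qed simp
  ultimately show ?thesis
    using C D F GG unfolding equivalent_categories_def by blast
qed


section \<open>The duality\<close>

text \<open>Morphisms are extensional functions, so composites and identities agree with the plain
  maps only on the carrier.\<close>

lemma boolean_hom_cong:
  assumes A: "boolean_alg A" and f: "boolean_hom A B f"
    and eq: "\<And>a. a \<in> carrier A \<Longrightarrow> f a = g a"
  shows "boolean_hom A B g"
proof -
  interpret boolean_alg A by (rule A)
  have "g a \<in> carrier B" if "a \<in> carrier A" for a
    using boolean_hom_funcset[OF f] that unfolding eq[OF that, symmetric] by auto
  then show ?thesis
    unfolding boolean_hom_def
    by (simp add: join_closed meet_closed neg_closed bzero_closed bone_closed eq[symmetric]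
        boolean_hom_simps[OF f])
qed

lemma dca_morphism_compose:
  assumes A: "dca A" and fg: "dca_morphism A B f" "dca_morphism B C g"
  shows "dca_morphism A C (compose (carrier A) g f)"
proof -
  have f: "boolean_hom A B f" and g: "boolean_hom B C g"
    using fg unfolding dca_morphism_def by auto
  have "f a \<in> carrier B" if "a \<in> carrier A" for a
    using boolean_hom_funcset[OF f] that by auto
  moreover have "boolean_hom A C (compose (carrier A) g f)"
    by (rule boolean_hom_cong[OF _ boolean_hom_compose[OF f g]])
      (use A in \<open>simp_all add: compose_eq dca_def\<close>)
  ultimately show ?thesis
    using fg unfolding dca_morphism_def by (simp add: compose_eq)
qed

lemma dca_morphism_Ident:
  assumes "dca A"
  shows "dca_morphism A A (restrict id (carrier A))"
proof -
  interpret dca A by (rule assms)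
  show ?thesis
    unfolding dca_morphism_def boolean_hom_def
    by (simp add: join_closed meet_closed neg_closed bzero_closed bone_closed)
qed

lemma dms_morphism_compose:
  assumes S: "dms S" and \<theta>: "dms_morphism S S' \<theta>" and \<phi>: "dms_morphism S' S'' \<phi>"
  shows "dms_morphism S S'' (compose (topspace (Xt S)) \<phi> \<theta>)"
proof -
  let ?X = "topspace (Xt S)" and ?Y = "topspace (Xt S')"
  have \<theta>X: "\<theta> x \<in> ?Y" if "x \<in> ?X" for x
    using \<theta> that unfolding dms_morphism_def by auto
  have \<phi>X: "\<phi> x \<in> topspace (Xt S'')" if "x \<in> ?Y" for x
    using \<phi> that unfolding dms_morphism_def by auto
  have Xs: "\<theta> ` Xs S \<subseteq> Xs S'" "\<phi> ` Xs S' \<subseteq> Xs S''" "Xs S \<subseteq> ?X"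
    using \<theta> \<phi> dms.Xs_subset[OF S] unfolding dms_morphism_def by auto
  have "boolean_hom (dual_algebra S'') (dual_algebra S)
      (\<lambda>a. \<theta> -` (\<phi> -` a \<inter> ?Y) \<inter> ?X)"
    using boolean_hom_compose[of "dual_algebra S''" "dual_algebra S'"
        "\<lambda>a. \<phi> -` a \<inter> ?Y" "dual_algebra S" "\<lambda>a. \<theta> -` a \<inter> ?X"] \<theta> \<phi>
    unfolding dms_morphism_def by simp
  moreover have "\<theta> -` (\<phi> -` a \<inter> ?Y) \<inter> ?X = compose ?X \<phi> \<theta> -` a \<inter> ?X" for a
    using \<theta>X by (auto simp: compose_eq)
  ultimately have "boolean_hom (dual_algebra S'') (dual_algebra S) (\<lambda>a. compose ?X \<phi> \<theta> -` a \<inter> ?X)"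
    by simp
  moreover have "compose ?X \<phi> \<theta> ` Xs S \<subseteq> Xs S''"
    using Xs by (auto simp: compose_def)
  moreover have "prec S'' (compose ?X \<phi> \<theta> x) (compose ?X \<phi> \<theta> y)"
    if "x \<in> ?X" "y \<in> ?X" "prec S x y" for x y
  proof -
    have "prec S' (\<theta> x) (\<theta> y)"
      using \<theta> that unfolding dms_morphism_def by simp
    then show ?thesis
      using \<phi> \<theta>X that unfolding dms_morphism_def by (simp add: compose_eq)
  qed
  moreover have "compose ?X \<phi> \<theta> \<in> ?X \<rightarrow> topspace (Xt S'')"
    using \<theta>X \<phi>X by (auto simp: compose_eq)
  ultimately show ?thesis
    unfolding dms_morphism_def by auto
qed

lemma dms_morphism_Ident:
  assumes "dms S"
  shows "dms_morphism S S (restrict id (topspace (Xt S)))"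
proof -
  interpret dms S by (rule assms)
  have "boolean_hom (dual_algebra S) (dual_algebra S) (\<lambda>a. a)"
    unfolding boolean_hom_def by simp
  then have "boolean_hom (dual_algebra S) (dual_algebra S)
      (\<lambda>a. restrict id (topspace (Xt S)) -` a \<inter> topspace (Xt S))"
  proof (rule boolean_hom_cong[rotated])
    fix a assume "a \<in> carrier (dual_algebra S)"
    then show "a = restrict id (topspace (Xt S)) -` a \<inter> topspace (Xt S)"
      using alg_closed(1)[of a] by (auto simp: dual_algebra_sel)
  qed (use dca_dual_algebra in \<open>simp add: dca_def\<close>)
  moreover have "restrict id (topspace (Xt S)) ` Xs S \<subseteq> Xs S"
    using Xs_subset by auto
  ultimately show ?thesis
    unfolding dms_morphism_def by simp
qed

lemma category_DCA: "category (DCA small)"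
proof
  fix A B C D f g h
  show "Ident (DCA small) A \<in> Hom (DCA small) A A" if "A \<in> Ob (DCA small)"
    using that dca_morphism_Ident by (auto simp: DCA_def)
  show "Comp (DCA small) A B C g f \<in> Hom (DCA small) A C"
    if "A \<in> Ob (DCA small)" "f \<in> Hom (DCA small) A B" "g \<in> Hom (DCA small) B C"
    using that dca_morphism_compose[of A B f C g] by (auto simp: DCA_def compose_def)
  show "Comp (DCA small) A A B f (Ident (DCA small) A) = f"
    "Comp (DCA small) A B B (Ident (DCA small) B) f = f" if "f \<in> Hom (DCA small) A B"
    using that by (auto simp: DCA_def compose_def fun_eq_iff PiE_iff extensional_def)
  show "Comp (DCA small) A C D h (Comp (DCA small) A B C g f) =
      Comp (DCA small) A B D (Comp (DCA small) B C D h g) f" if "f \<in> Hom (DCA small) A B"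
    using that by (auto simp: DCA_def compose_def fun_eq_iff PiE_iff)
qed

lemma category_DMS: "category (DMS small)"
proof
  fix S S' S'' S''' f g h
  show "Ident (DMS small) S \<in> Hom (DMS small) S S" if "S \<in> Ob (DMS small)"
    using that dms_morphism_Ident by (auto simp: DMS_def)
  show "Comp (DMS small) S S' S'' g f \<in> Hom (DMS small) S S''"
    if "S \<in> Ob (DMS small)" "f \<in> Hom (DMS small) S S'" "g \<in> Hom (DMS small) S' S''"
    using that dms_morphism_compose[of S S' f S'' g] by (auto simp: DMS_def compose_def)
  show "Comp (DMS small) S S S' f (Ident (DMS small) S) = f"
    "Comp (DMS small) S S' S' (Ident (DMS small) S') f = f" if "f \<in> Hom (DMS small) S S'"
    using that by (auto simp: DMS_def compose_def fun_eq_iff PiE_iff extensional_def)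
  show "Comp (DMS small) S S'' S''' h (Comp (DMS small) S S' S'' g f) =
      Comp (DMS small) S S' S''' (Comp (DMS small) S' S'' S''' h g) f" if "f \<in> Hom (DMS small) S S'"
    using that by (auto simp: DMS_def compose_def fun_eq_iff PiE_iff)
qed

section \<open>Existence of dual objects and dual morphisms in the two categories\<close>

lemma DCA_Ax_simps [simp]:
  "Ob (DCA_Ax small Ax) = {A. dca A \<and> small (carrier A) \<and> (\<forall>ax \<in> Ax. satisfies_axiom A ax)}"
  "Hom (DCA_Ax small Ax) A B = {f \<in> carrier A \<rightarrow>\<^sub>E carrier B. dca_morphism A B f}"
  "Comp (DCA_Ax small Ax) A B C g f = compose (carrier A) g f"
  "Ident (DCA_Ax small Ax) A = restrict id (carrier A)"
  by (auto simp: DCA_Ax_def DCA_def)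

lemma DMS_star_simps [simp]:
  "Ob (DMS_star small Cond) = {S. dms S \<and> smallsize small (alg S) \<and> t0_space (Xt S) \<and>
    dm_compact S \<and> (\<forall>c \<in> Cond. satisfies_condition (Tm S) (prec S) c)}"
  "Hom (DMS_star small Cond) S S' =
    {\<theta> \<in> topspace (Xt S) \<rightarrow>\<^sub>E topspace (Xt S'). dms_morphism S S' \<theta>}"
  "Comp (DMS_star small Cond) S S' S'' \<phi> \<theta> = compose (topspace (Xt S)) \<phi> \<theta>"
  "Ident (DMS_star small Cond) S = restrict id (topspace (Xt S))"
  by (auto simp: DMS_star_def DMS_def)

text \<open>An injection of the powerset of the carrier into \<open>'b\<close> codes the t-clans as
  points, and its inverse provides the labels.\<close>

lemma ex_dual_space:
  fixes A :: "'a dca"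
  assumes small: "\<And>X. small X \<Longrightarrow> Pow X \<lesssim> (UNIV :: 'b set)" and A: "A \<in> Ob (DCA_Ax small Ax)"
  obtains S :: "'b dms" and e
  where "S \<in> Ob (DMS_star small (corresponding ` Ax))" "duality A S e"
proof -
  interpret dca A
    using A by simp
  obtain i :: "'a set \<Rightarrow> 'b" where i: "inj_on i (Pow (carrier A))"
    using small A unfolding lepoll_def by auto
  have T: "{\<Gamma>. t_clan A \<Gamma>} \<subseteq> Pow (carrier A)"
    unfolding t_clan_def clan_def by auto
  let ?T = "{\<Gamma>. t_clan A \<Gamma>}"
  have "bij_betw (inv_into ?T i) (i ` ?T) ?T"
    by (rule bij_betw_inv_into) (use inj_on_subset[OF i T] in \<open>simp add: bij_betw_def\<close>)
  then interpret clan_space A "i ` ?T" "inv_into ?T i"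
    by unfold_locales
  have "smallsize small (alg dual_space)"
    using A alg_dual_space_eqpoll unfolding smallsize_def by auto
  then have "dual_space \<in> Ob (DMS_star small (corresponding ` Ax))"
    using A dms_dual_space t0_dual_space dm_compact_dual_space satisfies_axiom_iff
    by (simp del: dual_space_sel)
  then show thesis
    using that duality_dual_space by blast
qed

text \<open>The dual algebra is renamed along a bijection from \<open>alg S\<close> to a small set,
  which becomes the carrier.\<close>

lemma ex_dual_dca:
  assumes S: "S \<in> Ob (DMS_star small (corresponding ` Ax))"
  obtains A e where "A \<in> Ob (DCA_Ax small Ax)" "duality A S e"
proof -
  have "dms S" "t0_space (Xt S)" "dm_compact S"
    using S by auto
  then have d: "duality (dual_algebra S) S (rho S)"
    by (rule dms.duality_rho)
  obtain X where X: "small X" "alg S \<approx> X"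
    using S eqpoll_sym by (auto simp: smallsize_def)
  then obtain h where h: "bij_betw h (alg S) X"
    unfolding eqpoll_def by blast
  have c: "carrier (dual_algebra S) = alg S"
    by (simp add: dual_algebra_def)
  let ?A = "dca_copy (dual_algebra S) h"
  interpret dca_iso "dual_algebra S" ?A h
    using dca.dca_iso_copy[OF duality.axioms(1)[OF d], of h] h c by (simp add: bij_betw_def)
  have dA: "duality ?A S (\<lambda>x. h ` rho S x)"
    by (rule duality_image[OF d])
  have "small (carrier ?A)"
    using h X c by (simp add: bij_betw_def)
  then have "?A \<in> Ob (DCA_Ax small Ax)"
    using S dca_image duality.satisfies_axiom_iff[OF dA] by simp
  then show thesis
    using that dA by blast
qed

lemma ex_dual_dms_morphism:
  assumes "duality A S e" "duality B X d" "dca_morphism A B f"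
  shows "\<exists>\<theta> \<in> topspace (Xt X) \<rightarrow>\<^sub>E topspace (Xt S). dms_morphism X S \<theta> \<and> dual_morphisms A e X d f \<theta>"
proof -
  interpret duality_pair A S e B X d
    using assms(1,2) by (rule duality_pair.intro)
  obtain \<theta> where \<theta>: "\<theta> \<in> topspace (Xt X) \<rightarrow>\<^sub>E topspace (Xt S)" "dual_morphisms A e X d f \<theta>"
    by (rule ex_dual_of_dca_morphism[OF assms(3)])
  then have "\<theta> \<in> topspace (Xt X) \<rightarrow> topspace (Xt S)"
    by (simp add: PiE_def)
  from dms_morphism_dual[OF assms(3) this \<theta>(2)] show ?thesis
    using \<theta> by blast
qed

lemma dual_Ident_unique:
  assumes "duality A S e" "dual_morphisms A e S e (restrict id (carrier A)) \<theta>"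
    and "\<theta> \<in> topspace (Xt S) \<rightarrow>\<^sub>E topspace (Xt S)"
  shows "\<theta> = restrict id (topspace (Xt S))"
proof -
  interpret duality_pair A S e A S e
    using assms(1) by (intro duality_pair.intro)
  show ?thesis
    by (rule dual_unique_point_map[OF assms(2) dual_morphisms_Ident assms(3)]) auto
qed

lemma compose_Ident_Ident:
  "compose (carrier A) (restrict id (carrier A)) (restrict id (carrier A)) = restrict id (carrier A)"
  by (auto simp: compose_def fun_eq_iff)

text \<open>Both spaces are dual to the same algebra, and the maps dual to its identity are inverse to
  each other by uniqueness.\<close>

lemma isomorphism_of_dualities:
  assumes A: "A \<in> Ob (DCA_Ax small Ax)" and S: "duality A S e" and X: "duality A X d"
  shows "\<exists>\<theta>. isomorphism (DMS_star small Cond) S X \<theta>"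
proof -
  let ?i = "restrict id (carrier A)"
  have i: "dca_morphism A A ?i"
    using A by (simp add: dca_morphism_Ident)
  obtain \<theta> where \<theta>: "\<theta> \<in> topspace (Xt X) \<rightarrow>\<^sub>E topspace (Xt S)" "dms_morphism X S \<theta>"
    "dual_morphisms A e X d ?i \<theta>"
    using ex_dual_dms_morphism[OF S X i] by blast
  obtain \<phi> where \<phi>: "\<phi> \<in> topspace (Xt S) \<rightarrow>\<^sub>E topspace (Xt X)" "dms_morphism S X \<phi>"
    "dual_morphisms A d S e ?i \<phi>"
    using ex_dual_dms_morphism[OF X S i] by blast
  have i': "?i \<in> carrier A \<rightarrow> carrier A"
    by auto
  have m: "\<theta> \<in> topspace (Xt X) \<rightarrow> topspace (Xt S)" "\<phi> \<in> topspace (Xt S) \<rightarrow> topspace (Xt X)"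
    using \<theta>(1) \<phi>(1) by (simp_all add: PiE_def)
  have "compose (topspace (Xt S)) \<theta> \<phi> = restrict id (topspace (Xt S))"
    using dual_morphisms_compose[OF \<theta>(3) \<phi>(3) i' m(2), unfolded compose_Ident_Ident]
    by (rule dual_Ident_unique[OF S]) (use m in \<open>auto simp: compose_def\<close>)
  moreover have "compose (topspace (Xt X)) \<phi> \<theta> = restrict id (topspace (Xt X))"
    using dual_morphisms_compose[OF \<phi>(3) \<theta>(3) i' m(1), unfolded compose_Ident_Ident]
    by (rule dual_Ident_unique[OF X]) (use m in \<open>auto simp: compose_def\<close>)
  ultimately show ?thesis
    using \<theta> \<phi> unfolding isomorphism_def by auto
qed

theorem theorem6p14:
  fixes Ax :: "time_axiom set"
    and small :: "'a set \<Rightarrow> bool"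
  assumes "\<And>X. small X \<Longrightarrow> Pow X \<lesssim> (UNIV :: 'b set)"
  shows "dually_equivalent
           (DCA_Ax small Ax :: ('a dca, 'a \<Rightarrow> 'a) cat)
           (DMS_star small (corresponding ` Ax) :: ('b dms, 'b \<Rightarrow> 'b) cat)"
proof -
  let ?C = "DCA_Ax small Ax :: ('a dca, 'a \<Rightarrow> 'a) cat"
    and ?D = "DMS_star small (corresponding ` Ax) :: ('b dms, 'b \<Rightarrow> 'b) cat"
  have C: "category ?C" and D: "category ?D"
    unfolding DCA_Ax_def DMS_star_def
    by (intro category_full_subcategory category_DCA category_DMS)+
  have "\<forall>A. \<exists>S e. A \<in> Ob ?C \<longrightarrow> S \<in> Ob ?D \<and> duality A S e"
    using ex_dual_space[OF assms] by metis
  then obtain sp :: "'a dca \<Rightarrow> 'b dms" and pt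
    where sp: "\<And>A. A \<in> Ob ?C \<Longrightarrow> sp A \<in> Ob ?D" and dual: "\<And>A. A \<in> Ob ?C \<Longrightarrow> duality A (sp A) (pt A)"
    by metis
  \<comment> \<open>A homomorphism from \<open>B\<close> to \<open>A\<close> is an arrow from
    \<open>A\<close> to \<open>B\<close> in the opposite category, and its dual runs from
    \<open>sp A\<close> to \<open>sp B\<close>.\<close>
  have "\<forall>A B f. \<exists>\<theta>. A \<in> Ob ?C \<longrightarrow> B \<in> Ob ?C \<longrightarrow> f \<in> Hom ?C B A \<longrightarrow>
      \<theta> \<in> Hom ?D (sp A) (sp B) \<and> dual_morphisms B (pt B) (sp A) (pt A) f \<theta>"
    using ex_dual_dms_morphism[OF dual dual] by (simp del: DCA_Ax_simps(1)) blast
  then obtain mor where mor: "\<And>A B f. \<lbrakk>A \<in> Ob ?C; B \<in> Ob ?C; f \<in> Hom ?C B A\<rbrakk> \<Longrightarrow>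
      mor A B f \<in> Hom ?D (sp A) (sp B)"
    and dual_mor: "\<And>A B f. \<lbrakk>A \<in> Ob ?C; B \<in> Ob ?C; f \<in> Hom ?C B A\<rbrakk> \<Longrightarrow>
      dual_morphisms B (pt B) (sp A) (pt A) f (mor A B f)"
    by metis
  define F where "F = \<lparr>fobj = sp, fmor = mor\<rparr>"
  have pair: "duality_pair B (sp B) (pt B) A (sp A) (pt A)" if "A \<in> Ob ?C" "B \<in> Ob ?C" for A B
    using dual that by (intro duality_pair.intro)
  \<comment> \<open>By uniqueness the functor laws reduce to showing that identities and composites
    are dual to each other.\<close>
  have mor_eqI: "mor A B f = \<theta>"
    if "A \<in> Ob ?C" "B \<in> Ob ?C" "f \<in> Hom ?C B A" "\<theta> \<in> Hom ?D (sp A) (sp B)"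
      "dual_morphisms B (pt B) (sp A) (pt A) f \<theta>" for A B f \<theta>
    using duality_pair.dual_unique_point_map[OF pair[OF that(1,2)] dual_mor[OF that(1-3)] that(5)]
      mor[OF that(1-3)] that(4) by simp
  note CIdent = category.Ident_in_Hom[OF C] and CComp = category.Comp_in_Hom[OF C]
    and DIdent = category.Ident_in_Hom[OF D] and DComp = category.Comp_in_Hom[OF D]
  have "is_functor (opposite ?C) ?D F"
  proof
    fix A B E f g assume A: "A \<in> Ob (opposite ?C)"
    then show "fobj F A \<in> Ob ?D"
      using sp by (simp add: F_def del: DCA_Ax_simps DMS_star_simps)
    have "mor A A (Ident ?C A) = Ident ?D (sp A)"
      using A dual_morphisms_Ident[of A "pt A" "sp A"]
      by (intro mor_eqI CIdent DIdent sp) (simp_all del: DCA_Ax_simps(1) DMS_star_simps(1))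
    then show "fmor F A A (Ident (opposite ?C) A) = Ident ?D (fobj F A)"
      by (simp add: F_def)
    assume B: "B \<in> Ob (opposite ?C)" and f: "f \<in> Hom (opposite ?C) A B"
    then show "fmor F A B f \<in> Hom ?D (fobj F A) (fobj F B)"
      using A mor by (simp add: F_def del: DCA_Ax_simps DMS_star_simps)
    assume E: "E \<in> Ob (opposite ?C)" and g: "g \<in> Hom (opposite ?C) B E"
    have obs: "A \<in> Ob ?C" "B \<in> Ob ?C" "E \<in> Ob ?C" and homs: "f \<in> Hom ?C B A" "g \<in> Hom ?C E B"
      using A B E f g by (simp_all del: DCA_Ax_simps DMS_star_simps)
    have "mor A E (Comp ?C E B A f g) = Comp ?D (sp A) (sp B) (sp E) (mor B E g) (mor A B f)"
    proof (rule mor_eqI)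
      show "dual_morphisms E (pt E) (sp A) (pt A) (Comp ?C E B A f g)
          (Comp ?D (sp A) (sp B) (sp E) (mor B E g) (mor A B f))"
        unfolding DCA_Ax_simps(3) DMS_star_simps(3)
        by (rule dual_morphisms_compose[OF dual_mor dual_mor])
          (use obs homs mor[OF obs(1,2) homs(1)] in \<open>auto simp del: DCA_Ax_simps(1)\<close>)
    qed (use obs homs CComp DComp mor sp in blast)+
    then show "fmor F A E (Comp (opposite ?C) A B E g f) =
        Comp ?D (fobj F A) (fobj F B) (fobj F E) (fmor F B E g) (fmor F A B f)"
      by (simp add: F_def del: DCA_Ax_simps DMS_star_simps)
  qed
  moreover have "bij_betw (fmor F A B) (Hom (opposite ?C) A B) (Hom ?D (fobj F A) (fobj F B))"
    if "A \<in> Ob (opposite ?C)" "B \<in> Ob (opposite ?C)" for A B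
  proof -
    have obs: "A \<in> Ob ?C" "B \<in> Ob ?C"
      using that by (simp_all del: DCA_Ax_simps)
    interpret duality_pair B "sp B" "pt B" A "sp A" "pt A"
      by (rule pair[OF obs])
    have "inj_on (mor A B) (Hom ?C B A)"
    proof (rule inj_onI)
      fix f f' assume f: "f \<in> Hom ?C B A" and f': "f' \<in> Hom ?C B A" and eq: "mor A B f = mor A B f'"
      show "f = f'"
        using dual_unique_hom[OF dual_mor[OF obs f]] dual_mor[OF obs f'] eq f f' by simp
    qed
    moreover have "\<theta> \<in> mor A B ` Hom ?C B A" if \<theta>: "\<theta> \<in> Hom ?D (sp A) (sp B)" for \<theta>
    proof -
      have \<theta>': "dms_morphism (sp A) (sp B) \<theta>"
        using \<theta> by simp
      obtain f where f: "f \<in> carrier B \<rightarrow>\<^sub>E carrier A" "dual_morphisms B (pt B) (sp A) (pt A) f \<theta>"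
        by (rule ex_dual_of_dms_morphism[OF \<theta>'])
      then have "dca_morphism B A f"
        by (intro dca_morphism_dual[OF \<theta>']) (simp_all add: PiE_def)
      then have "f \<in> Hom ?C B A"
        using f by simp
      then show ?thesis
        using mor_eqI[OF obs _ \<theta> f(2)] by blast
    qed
    ultimately have "bij_betw (mor A B) (Hom ?C B A) (Hom ?D (sp A) (sp B))"
      using mor[OF obs] unfolding bij_betw_def by blast
    then show ?thesis
      by (simp add: F_def del: DCA_Ax_simps DMS_star_simps)
  qed
  \<comment> \<open>The given space and the chosen space \<open>sp A\<close> are dual to the same
    algebra, hence isomorphic.\<close>
  moreover have "\<exists>A \<in> Ob (opposite ?C). \<exists>\<theta>. isomorphism ?D (fobj F A) S \<theta>" if S: "S \<in> Ob ?D" for S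
  proof -
    obtain A e where A: "A \<in> Ob ?C" "duality A S e"
      by (rule ex_dual_dca[OF S])
    have "\<exists>\<theta>. isomorphism ?D (sp A) S \<theta>"
      by (rule isomorphism_of_dualities[OF A(1) dual[OF A(1)] A(2)])
    then show ?thesis
      using A(1) by (intro bexI[of _ A]) (simp_all add: F_def del: DCA_Ax_simps DMS_star_simps)
  qed
  ultimately show ?thesis
    unfolding dually_equivalent_def
    by (intro equivalent_categoriesI[OF category_opposite[OF C] D])
qed

end
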